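(* Let $\alpha<0$ and $t>0$ be fixed. Suppose that the characteristics of $X$ are absolutely continuous in time, that is, $B_t=\int_0^tb_s\,ds$, $C_t=\int_0^tc_s\,ds$, $\nu(dt,dx)=dt\,K_t(dx)$, that $$\int_0^t\int_{\mathbb{R}\setminus\{0\}}(x^2\wedge|x|)K_s(dx)\,ds<\infty ,$$ and that $$\int_0^t\int_{x>1}e^{(|\alpha|+1)x}K_s(dx)\,ds<\infty .$$ Then, for $s>0$, $m^{(\alpha)}_{s,t}$ is well-defined as well as $m^{(\alpha-1)}_{s,t}$, and the following recurrent differential equation holds: $$m^{(\alpha-1)}_{s,t}=\frac1\alpha\Big(m^{(\alpha)}_{s,t}\,H^{(\alpha)}_s-\frac{d}{ds}m^{(\alpha)}_{s,t}\Big).$$ In the case where $X$ is a Lévy process (with Laplace exponent $\Phi(\alpha)$), $$m^{(\alpha-1)}_s=\frac1\alpha\Big(m^{(\alpha)}_s\,\Phi(\alpha)+\frac{d}{ds}m^{(\alpha)}_s\Big).$$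
   Context: $X=(X_t)_{t\ge 0}$ is a real-valued process with independent increments, $X_0=0$, which is a semimartingale with respect to its natural filtration, with deterministic semimartingale triplet $(B,C,\nu)$. The functions $b=(b_s)_{s\ge 0}$, $c=(c_s)_{s\ge 0}$ are measurable and $K=(K_s)_{s\ge 0}$ is a kernel on $\mathbb{R}\setminus\{0\}$. Because of the integrability condition on $x^2\wedge|x|$, no truncation of jumps is used, i.e. for $\lambda\in\mathbb{R}$ $${\bf E}e^{i\lambda X_t}=\exp\Big\{i\lambda B_t-\tfrac12\lambda^2C_t+\int_0^t\int_{\mathbb{R}\setminus\{0\}}(e^{i\lambda x}-1-i\lambda x)K_s(dx)\,ds\Big\}.$$ Define $$H^{(\alpha)}_s=\alpha b_s-\tfrac12\alpha^2c_s-\int_{\mathbb{R}\setminus\{0\}}(e^{-\alpha x}-1+\alpha x)K_s(dx).$$ When $X$ is a Lévy process with parameters $(b_0,c_0,K_0)$ (so $b_s=b_0$, $c_s=c_0$, $K_s=K_0$), ${\bf E}(e^{-\alpha X_t})=e^{-t\Phi(\alpha)}$ with $\Phi(\alpha)=\alpha b_0-\frac12\alpha^2c_0-\int_{\mathbb{R}\setminus\{0\}}(e^{-\alpha x}-1+\alpha x)K_0(dx)$. Notation: $I_t=\int_0^te^{-X_s}ds$, $m^{(\alpha)}_t={\bf E}(I_t^{\alpha})$, and, for $s<t$, $m^{(\alpha)}_{s,t}={\bf E}\big[\big(\int_s^te^{-(X_u-X_{s-})}du\big)^{\alpha}\big]$.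
   Formalization: Since b, c, K are only measurable in time, the equation for m_{s,t} can fail at exceptional s; it is proved for almost every s in (0,t) and for every s in (0,t) at which H^{(α)} is continuous, with existence of the derivative there. *)

theory Defs
  imports "HOL-Probability.Probability"
begin

text \<open>
  Processes are functions \<open>X :: real \<Rightarrow> 'a \<Rightarrow> real\<close> of which only the values at times
  \<open>u \<ge> 0\<close> matter.
\<close>

definition natural_filtration :: "'a measure \<Rightarrow> (real \<Rightarrow> 'a \<Rightarrow> real) \<Rightarrow> real \<Rightarrow> 'a measure" where
  "natural_filtration M X s =
     sigma (space M) (\<Union>u\<in>{0..s}. {X u -` A \<inter> space M | A. A \<in> sets borel})"

definition adapted :: "(real \<Rightarrow> 'a measure) \<Rightarrow> (real \<Rightarrow> 'a \<Rightarrow> real) \<Rightarrow> bool" where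
  "adapted F X \<longleftrightarrow> (\<forall>u\<ge>0. X u \<in> borel_measurable (F u))"

definition cadlag_process :: "'a measure \<Rightarrow> (real \<Rightarrow> 'a \<Rightarrow> real) \<Rightarrow> bool" where
  "cadlag_process M X \<longleftrightarrow>
     (\<forall>\<omega>\<in>space M. (\<forall>u\<ge>0. continuous (at_right u) (\<lambda>r. X r \<omega>)) \<and>
                    (\<forall>u>0. \<exists>l. ((\<lambda>r. X r \<omega>) \<longlongrightarrow> l) (at_left u)))"

definition left_lim :: "(real \<Rightarrow> 'a \<Rightarrow> real) \<Rightarrow> real \<Rightarrow> 'a \<Rightarrow> real" where
  "left_lim X s \<omega> = Lim (at_left s) (\<lambda>r. X r \<omega>)"

definition martingale :: "'a measure \<Rightarrow> (real \<Rightarrow> 'a measure) \<Rightarrow> (real \<Rightarrow> 'a \<Rightarrow> real) \<Rightarrow> bool" where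
  "martingale M F N \<longleftrightarrow>
     adapted F N \<and> (\<forall>u\<ge>0. integrable M (N u)) \<and>
     (\<forall>s\<ge>0. \<forall>u\<ge>s. AE \<omega> in M. real_cond_exp M (F s) (N u) \<omega> = N s \<omega>)"

text \<open>
  Finite-valued localising times suffice: \<open>T n\<close> may be replaced by \<open>min (T n) n\<close>.
\<close>

definition local_martingale :: "'a measure \<Rightarrow> (real \<Rightarrow> 'a measure) \<Rightarrow> (real \<Rightarrow> 'a \<Rightarrow> real) \<Rightarrow> bool" where
  "local_martingale M F N \<longleftrightarrow>
     adapted F N \<and> cadlag_process M N \<and>
     (\<exists>T :: nat \<Rightarrow> 'a \<Rightarrow> real.
        (\<forall>n. stopping_time F (T n) \<and> (\<forall>\<omega>\<in>space M. 0 \<le> T n \<omega>)) \<and>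
        (AE \<omega> in M. incseq (\<lambda>n. T n \<omega>) \<and> filterlim (\<lambda>n. T n \<omega>) at_top sequentially) \<and>
        (\<forall>n. martingale M F (\<lambda>u \<omega>. N (min u (T n \<omega>)) \<omega>)))"

definition bounded_variation_on :: "real \<Rightarrow> real \<Rightarrow> (real \<Rightarrow> real) \<Rightarrow> bool" where
  "bounded_variation_on a b f \<longleftrightarrow>
     bdd_above {\<Sum>i<n. \<bar>f (p (Suc i)) - f (p i)\<bar> | (n :: nat) p. mono p \<and> range p \<subseteq> {a..b}}"

definition finite_variation_process ::
    "'a measure \<Rightarrow> (real \<Rightarrow> 'a measure) \<Rightarrow> (real \<Rightarrow> 'a \<Rightarrow> real) \<Rightarrow> bool" where
  "finite_variation_process M F A \<longleftrightarrow>
     adapted F A \<and> cadlag_process M A \<and>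
     (\<forall>\<omega>\<in>space M. A 0 \<omega> = 0 \<and> (\<forall>u\<ge>0. bounded_variation_on 0 u (\<lambda>r. A r \<omega>)))"

definition semimartingale :: "'a measure \<Rightarrow> (real \<Rightarrow> 'a measure) \<Rightarrow> (real \<Rightarrow> 'a \<Rightarrow> real) \<Rightarrow> bool" where
  "semimartingale M F X \<longleftrightarrow>
     (\<exists>N A. local_martingale M F N \<and> (\<forall>\<omega>\<in>space M. N 0 \<omega> = 0) \<and>
            finite_variation_process M F A \<and>
            (\<forall>u\<ge>0. \<forall>\<omega>\<in>space M. X u \<omega> = X 0 \<omega> + N u \<omega> + A u \<omega>))"

text \<open>
  Processes with independent increments started at zero: each increment after time \<open>s\<close> is
  independent of the past up to \<open>s\<close>.
\<close>

definition independent_increments_process :: "'a measure \<Rightarrow> (real \<Rightarrow> 'a \<Rightarrow> real) \<Rightarrow> bool" where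
  "independent_increments_process M X \<longleftrightarrow>
     prob_space M \<and> (\<forall>u\<ge>0. X u \<in> borel_measurable M) \<and> cadlag_process M X \<and>
     (\<forall>\<omega>\<in>space M. X 0 \<omega> = 0) \<and>
     (\<forall>s\<ge>0. \<forall>u\<ge>s. prob_space.indep_set M (sets (natural_filtration M X s))
        (sets (vimage_algebra (space M) (\<lambda>\<omega>. X u \<omega> - X s \<omega>) borel)))"

definition levy_process :: "'a measure \<Rightarrow> (real \<Rightarrow> 'a \<Rightarrow> real) \<Rightarrow> bool" where
  "levy_process M X \<longleftrightarrow>
     independent_increments_process M X \<and>
     (\<forall>s\<ge>0. \<forall>h\<ge>0. distr M borel (\<lambda>\<omega>. X (s + h) \<omega> - X s \<omega>) = distr M borel (X h))"

definition jump_kernel :: "(real \<Rightarrow> real measure) \<Rightarrow> bool" where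
  "jump_kernel K \<longleftrightarrow>
     (\<forall>s\<ge>0. sets (K s) = sets (restrict_space borel (- {0}))) \<and>
     (\<forall>A\<in>sets (restrict_space borel (- {0})).
        (\<lambda>s. emeasure (K s) A) \<in> borel_measurable (restrict_space borel {0..}))"

text \<open>
  Deterministic triplet \<open>(B, C, ds K\<^sub>s(dx))\<close> of a process with independent increments on \<open>[0, t]\<close>,
  with no truncation of jumps.  It is read off from the Levy-Khintchine formula; together with the
  independence of increments this fixes the laws of all increments.  The jump integrals
  converge when \<open>x\<^sup>2 \<and> \<bar>x\<bar>\<close> is integrable for \<open>ds K\<^sub>s(dx)\<close> on \<open>[0, t]\<close>.
\<close>

definition has_triplet_upto ::
    "'a measure \<Rightarrow> (real \<Rightarrow> 'a \<Rightarrow> real) \<Rightarrow> real \<Rightarrow> (real \<Rightarrow> real) \<Rightarrow> (real \<Rightarrow> real) \<Rightarrow>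
     (real \<Rightarrow> real measure) \<Rightarrow> bool" where
  "has_triplet_upto M X t B C K \<longleftrightarrow>
     mono_on {0..t} C \<and>
     (\<forall>u\<in>{0..t}. \<forall>z::real.
        (CLINT \<omega>|M. iexp (z * X u \<omega>)) =
        exp (\<i> * z * B u - z\<^sup>2 * C u / 2 +
             (CLINT s:{0..u}|lborel. (CLINT x|K s. iexp (z * x) - 1 - \<i> * z * x))))"

definition has_density_upto :: "real \<Rightarrow> (real \<Rightarrow> real) \<Rightarrow> (real \<Rightarrow> real) \<Rightarrow> bool" where
  "has_density_upto t B b \<longleftrightarrow>
     set_integrable lborel {0..t} b \<and> (\<forall>u\<in>{0..t}. B u = (LBINT s:{0..u}. b s))"

definition laplace_exponent :: "real \<Rightarrow> real \<Rightarrow> real \<Rightarrow> real measure \<Rightarrow> real" where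
  "laplace_exponent \<alpha> b c K =
     \<alpha> * b - \<alpha>\<^sup>2 * c / 2 - (LINT x|K. exp (- \<alpha> * x) - 1 + \<alpha> * x)"

definition H ::
    "real \<Rightarrow> (real \<Rightarrow> real) \<Rightarrow> (real \<Rightarrow> real) \<Rightarrow> (real \<Rightarrow> real measure) \<Rightarrow> real \<Rightarrow> real" where
  "H \<alpha> b c K s = laplace_exponent \<alpha> (b s) (c s) (K s)"

definition exp_functional :: "(real \<Rightarrow> 'a \<Rightarrow> real) \<Rightarrow> real \<Rightarrow> 'a \<Rightarrow> real" where
  "exp_functional X t \<omega> = (LBINT u:{0..t}. exp (- X u \<omega>))"

definition exp_functional_between :: "(real \<Rightarrow> 'a \<Rightarrow> real) \<Rightarrow> real \<Rightarrow> real \<Rightarrow> 'a \<Rightarrow> real" where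
  "exp_functional_between X s t \<omega> = (LBINT u:{s..t}. exp (- (X u \<omega> - left_lim X s \<omega>)))"

definition moment :: "'a measure \<Rightarrow> (real \<Rightarrow> 'a \<Rightarrow> real) \<Rightarrow> real \<Rightarrow> real \<Rightarrow> real" where
  "moment M X \<alpha> t = (LINT \<omega>|M. exp_functional X t \<omega> powr \<alpha>)"

definition moment_between ::
    "'a measure \<Rightarrow> (real \<Rightarrow> 'a \<Rightarrow> real) \<Rightarrow> real \<Rightarrow> real \<Rightarrow> real \<Rightarrow> real" where
  "moment_between M X \<alpha> s t = (LINT \<omega>|M. exp_functional_between X s t \<omega> powr \<alpha>)"

text \<open>
  Well-definedness: the inner time integral converges on every path, and the resulting random
  variable has a finite moment.
\<close>

definition moment_well_defined :: "'a measure \<Rightarrow> (real \<Rightarrow> 'a \<Rightarrow> real) \<Rightarrow> real \<Rightarrow> real \<Rightarrow> bool" where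
  "moment_well_defined M X \<alpha> t \<longleftrightarrow>
     (\<forall>\<omega>\<in>space M. set_integrable lborel {0..t} (\<lambda>u. exp (- X u \<omega>))) \<and>
     integrable M (\<lambda>\<omega>. exp_functional X t \<omega> powr \<alpha>)"

definition moment_between_well_defined ::
    "'a measure \<Rightarrow> (real \<Rightarrow> 'a \<Rightarrow> real) \<Rightarrow> real \<Rightarrow> real \<Rightarrow> real \<Rightarrow> bool" where
  "moment_between_well_defined M X \<alpha> s t \<longleftrightarrow>
     (\<forall>\<omega>\<in>space M. set_integrable lborel {s..t} (\<lambda>u. exp (- (X u \<omega> - left_lim X s \<omega>)))) \<and>
     integrable M (\<lambda>\<omega>. exp_functional_between X s t \<omega> powr \<alpha>)"

definition moment_between_ode_at ::
    "'a measure \<Rightarrow> (real \<Rightarrow> 'a \<Rightarrow> real) \<Rightarrow> (real \<Rightarrow> real) \<Rightarrow> (real \<Rightarrow> real) \<Rightarrow>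
     (real \<Rightarrow> real measure) \<Rightarrow> real \<Rightarrow> real \<Rightarrow> real \<Rightarrow> bool" where
  "moment_between_ode_at M X b c K \<alpha> s t \<longleftrightarrow>
     (\<lambda>r. moment_between M X \<alpha> r t) differentiable (at s) \<and>
     moment_between M X (\<alpha> - 1) s t =
       1 / \<alpha> * (moment_between M X \<alpha> s t * H \<alpha> b c K s -
                 deriv (\<lambda>r. moment_between M X \<alpha> r t) s)"

definition moment_ode_at ::
    "'a measure \<Rightarrow> (real \<Rightarrow> 'a \<Rightarrow> real) \<Rightarrow> real \<Rightarrow> real \<Rightarrow> real measure \<Rightarrow> real \<Rightarrow> real \<Rightarrow> bool" where
  "moment_ode_at M X b\<^sub>0 c\<^sub>0 K\<^sub>0 \<alpha> s \<longleftrightarrow>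
     (\<lambda>r. moment M X \<alpha> r) differentiable (at s) \<and>
     moment M X (\<alpha> - 1) s =
       1 / \<alpha> * (moment M X \<alpha> s * laplace_exponent \<alpha> b\<^sub>0 c\<^sub>0 K\<^sub>0 + deriv (moment M X \<alpha>) s)"

end

(* Write be = -alpha > 0. First, the characteristic function of X_u extends analytically to the
   strip 0 <= Re w < be + 1; a one-sided Landau-Pringsheim argument turns this into finiteness of the
   exponential moments and E exp(a X_u) = exp(k_a(u)) with k_a = -int H(-a), and a limit a -> be + 1
   gives the end point.

   Let Y_s be the integral of exp(-X_u) over [s,t], and J_s = exp(X_s) Y_s. Since the moments make
   X_s = X_{s-} almost surely, m_{s,t} at the power alpha is E J_s^(-be). J_s is a limit of functions of
   increments after s, hence independent of X_s, so E Y_s^(-be) = exp(k_be(s)) E J_s^(-be). The point of Y is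
   that it is absolutely continuous path by path, with no stochastic calculus needed:
   d/ds Y_s^(-be) = be Y_s^(-be-1) exp(-X_s), and the expectation of the right-hand side is
   be exp(k_be(s)) E J_s^(-be-1), which is continuous in s. Hence exp(k_be(s)) E J_s^(-be) is
   continuously differentiable, and the equation follows wherever k_be' = -H(alpha), that is, at
   almost every s by Lebesgue's theorem, and at continuity points of H(alpha).

   For a Levy process, stationarity of the increments identifies J_s on [s,t] in law with the
   functional on [0,t-s]. *)
theory Submission
  imports Defs "HOL-Complex_Analysis.Complex_Analysis"
begin

subsection \<open>Differentiation of integrals\<close>

text \<open>\<open>J\<close> cannot be differentiated path by path: \<open>J T s\<close> is
  \<open>exp (X s)\<close> times \<open>Y T s\<close>, and the first factor is merely cadlag.
  \<open>Y\<close> lacks that factor, and independence replaces it in expectation by the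
  deterministic continuous number \<open>exp (k be s)\<close>, which can be divided out again. The
  derivative of the power \<open>- be\<close> of \<open>Y\<close> involves the power
  \<open>- be - 1\<close>, whose expectation Jensen's inequality bounds by exponential moments of
  \<open>X\<close> of order exactly \<open>be + 1\<close>; hence the need for the closed end point
  of the strip, although analytic continuation alone reaches only its interior. Independence enters
  as a product formula for expectations: for bounded continuous functions of \<open>J T s\<close>,
  along which Riemann sums converge, and by monotone truncation for negative powers. The latter
  happens in the extended half line, so finiteness of the moments of \<open>J\<close> comes out as a
  result. The triplet enters the moment argument only through the exponents \<open>k\<close>, so a
  Levy process can reuse the argument on every horizon, beyond the interval on which the triplet is
  given.\<close>

lemma has_real_derivative_if_small_oscillation:
  fixes F :: "real \<Rightarrow> real"
  assumes "\<And>e. e > 0 \<Longrightarrow> \<exists>d>0. \<forall>y. \<bar>y - x\<bar> < d \<longrightarrow> \<bar>F y - F x - D * (y - x)\<bar> \<le> e * \<bar>y - x\<bar>"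
  shows "(F has_real_derivative D) (at x)"
  unfolding has_field_derivative_def has_derivative_at_alt
proof (intro conjI allI impI)
  show "bounded_linear ((*) D)" by (rule bounded_linear_mult_right)
  fix e :: real assume "e > 0"
  from assms[OF this] show "\<exists>d>0. \<forall>y. norm (y - x) < d \<longrightarrow> norm (F y - F x - D * (y - x)) \<le> e * norm (y - x)"
    by simp
qed

text \<open>The core of Lebesgue's differentiation theorem for the gauge integral. Each failing pair
  \<open>(x, y)\<close> spans an interval whose Henstock error exceeds \<open>c\<close> times its
  length. Disjoint fine intervals have small total error by Henstock's lemma, and Vitali's theorem
  selects disjoint ones that cover almost all failing points.\<close>

lemma negligible_coarse_points:
  fixes f :: "real \<Rightarrow> real"
  assumes f: "f integrable_on {a..b}" and "c > 0"
  defines "F \<equiv> (\<lambda>x. integral {a..x} f)"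
  shows "negligible {x\<in>{a<..<b}. \<forall>d>0. \<exists>y\<in>{a<..<b}. \<bar>y - x\<bar> < d \<and> c * \<bar>y - x\<bar> < \<bar>F y - F x - f x * (y - x)\<bar>}"
    (is "negligible ?S")
proof (rule iffD2[OF negligible_outer_le], intro allI impI)
  fix e :: real assume "e > 0"
  \<comment> \<open>A total error below \<open>c * e\<close>, with error at least \<open>c\<close>
    per unit of length, bounds the total length by \<open>e\<close>.\<close>
  define e' where "e' = c * e"
  have "e' > 0" using \<open>e > 0\<close> \<open>c > 0\<close> by (simp add: e'_def)
  have f': "f integrable_on cbox a b" using f by simp
  obtain \<gamma> where \<gamma>: "gauge \<gamma>"
    and fine: "\<And>p. p tagged_partial_division_of (cbox a b) \<Longrightarrow> \<gamma> fine p \<Longrightarrow>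
             sum (\<lambda>(x,k). norm(measure lborel k *\<^sub>R f x - integral k f)) p < e'"
    by (rule Henstock_lemma[OF f' \<open>e' > 0\<close>]) (rule that)
  \<comment> \<open>The tag \<open>x\<close> is an end point of its interval and \<open>y\<close>
    may lie on either side; \<open>m\<close> and \<open>r\<close> present the interval as a closed
    ball, the form in which Vitali's theorem is applied.\<close>
  define K where "K = {(x, y). x \<in> {a<..<b} \<and> y \<in> {a<..<b} \<and> x \<noteq> y \<and>
      c * \<bar>y - x\<bar> < \<bar>F y - F x - f x * (y - x)\<bar> \<and> {min x y..max x y} \<subseteq> \<gamma> x}"
  define m where "m = (\<lambda>(x::real, y::real). (x + y) / 2)"
  define r where "r = (\<lambda>(x::real, y::real). \<bar>y - x\<bar> / 2)"
  have ball: "cball (m i) (r i) = {min (fst i) (snd i)..max (fst i) (snd i)}" for i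
    by (cases i, cases "fst i \<le> snd i") (simp_all add: m_def r_def cball_eq_atLeastAtMost field_simps)
  have Fdiff: "integral {x..y} f = F y - F x" if "a \<le> x" "x \<le> y" "y \<le> b" for x y
    using Henstock_Kurzweil_Integration.integral_combine[of a x y f] that
      integrable_subinterval_real[OF f, of a y] by (auto simp: F_def)
  obtain C where C: "countable C" "C \<subseteq> K"
     "pairwise (\<lambda>i j. disjnt (cball (m i) (r i)) (cball (m j) (r j))) C"
     "negligible (?S - (\<Union>i \<in> C. cball (m i) (r i)))"
  proof (rule Vitali_covering_theorem_cballs[of K r ?S m])
    show "0 < r i" if "i \<in> K" for i using that by (auto simp: K_def r_def)
    fix x d :: real assume x: "x \<in> ?S" and "d > 0"
    obtain \<eta> where "\<eta> > 0" and \<eta>: "ball x \<eta> \<subseteq> \<gamma> x"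
      using \<gamma> by (meson gauge_def open_contains_ball)
    have "min d \<eta> > 0" using \<open>d > 0\<close> \<open>\<eta> > 0\<close> by simp
    with x obtain y where y: "y \<in> {a<..<b}" "\<bar>y - x\<bar> < min d \<eta>" "c * \<bar>y - x\<bar> < \<bar>F y - F x - f x * (y - x)\<bar>"
      by blast
    have "{min x y..max x y} \<subseteq> ball x \<eta>" using y(2) by (auto simp: dist_real_def)
    moreover have "x \<noteq> y" using y(3) by auto
    ultimately have "(x, y) \<in> K" using x y(1,3) order_trans[OF _ \<eta>] by (simp add: K_def)
    moreover have "x \<in> cball (m (x,y)) (r (x,y))" unfolding ball by auto
    moreover have "r (x,y) < d" using y(2) \<open>d > 0\<close> by (auto simp: r_def)
    ultimately show "\<exists>i. i \<in> K \<and> x \<in> cball (m i) (r i) \<and> r i < d" by (intro exI[of _ "(x,y)"] conjI)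
  qed
  define I where "I = (\<lambda>i. cball (m i) (r i))"
  have finite_bound: "(\<Sum>i\<in>C'. measure lebesgue (I i)) \<le> e" if C': "C' \<subseteq> C" "finite C'" for C'
  proof -
    define p where "p = (\<lambda>i. (fst i, I i)) ` C'"
    \<comment> \<open>Distinct pairs have disjoint intervals, each containing its own tag, so no
      term of the Henstock sum is lost when indices become tagged intervals.\<close>
    have inj: "inj_on (\<lambda>i. (fst i, I i)) C'"
    proof (rule inj_onI)
      fix i j assume ij: "i \<in> C'" "j \<in> C'" "(fst i, I i) = (fst j, I j)"
      show "i = j"
      proof (rule ccontr)
        assume "i \<noteq> j"
        then have "disjnt (I i) (I j)" using pairwiseD[OF C(3)] C' ij(1,2) unfolding I_def by blast
        moreover have "fst i \<in> I i" by (auto simp: I_def ball)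
        ultimately show False using ij(3) by (auto simp: disjnt_def)
      qed
    qed
    have part: "p tagged_partial_division_of (cbox a b)"
      unfolding tagged_partial_division_of_def
    proof (intro conjI allI impI)
      show "finite p" using C' by (simp add: p_def)
    next
      fix x k assume "(x, k) \<in> p"
      then obtain i where i: "i \<in> C'" "x = fst i" "k = I i" by (auto simp: p_def)
      then have iK: "i \<in> K" using C C' by auto
      show "x \<in> k" using i by (auto simp: I_def ball)
      show "k \<subseteq> cbox a b" using i iK by (auto simp: I_def ball K_def)
      show "\<exists>a b. k = cbox a b" using i by (auto simp: I_def ball)
    next
      fix x k x2 k2 assume *: "(x, k) \<in> p \<and> (x2, k2) \<in> p \<and> (x, k) \<noteq> (x2, k2)"
      then obtain i where i: "i \<in> C'" "x = fst i" "k = I i" by (auto simp: p_def)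
      with * obtain j where j: "j \<in> C'" "k2 = I j" "i \<noteq> j" using i by (auto simp: p_def)
      then have "disjnt (I i) (I j)" using pairwiseD[OF C(3)] C' i(1) unfolding I_def by blast
      then show "interior k \<inter> interior k2 = {}"
        using i j interior_subset[of k] interior_subset[of k2] by (auto simp: disjnt_def)
    qed
    have pf: "\<gamma> fine p"
    proof (rule fineI)
      fix x k assume "(x, k) \<in> p"
      then obtain i where i: "i \<in> C'" "x = fst i" "k = I i" by (auto simp: p_def)
      then have "i \<in> K" using C C' by auto
      then show "k \<subseteq> \<gamma> x" using i by (auto simp: I_def ball K_def)
    qed
    have "(\<Sum>i\<in>C'. c * measure lebesgue (I i)) \<le> (\<Sum>i\<in>C'. norm (measure lborel (I i) *\<^sub>R f (fst i) - integral (I i) f))"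
    proof (rule sum_mono)
      fix i assume "i \<in> C'"
      then have "i \<in> K" using C C' by auto
      then obtain x y where i: "i = (x, y)" "x \<in> {a<..<b}" "y \<in> {a<..<b}"
        "c * \<bar>y - x\<bar> < \<bar>F y - F x - f x * (y - x)\<bar>" by (auto simp: K_def)
      have I: "I i = {min x y..max x y}" by (simp add: I_def ball i(1))
      have len: "measure lebesgue (I i) = \<bar>y - x\<bar>" "measure lborel (I i) = \<bar>y - x\<bar>"
        unfolding I by (auto simp: min_def max_def)
      have int: "integral (I i) f = F (max x y) - F (min x y)" unfolding I using i by (intro Fdiff) auto
      have fst: "fst i = x" by (simp add: i(1))
      have "norm (measure lborel (I i) *\<^sub>R f (fst i) - integral (I i) f) = \<bar>F y - F x - f x * (y - x)\<bar>"
        unfolding len int fst by (cases "x \<le> y") (auto simp: algebra_simps abs_if)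
      then show "c * measure lebesgue (I i) \<le> norm (measure lborel (I i) *\<^sub>R f (fst i) - integral (I i) f)"
        using i(4) len by simp
    qed
    also have "\<dots> = (\<Sum>(x,k)\<in>p. norm (measure lborel k *\<^sub>R f x - integral k f))"
      unfolding p_def by (subst sum.reindex[OF inj]) (simp add: o_def)
    also have "\<dots> < e'" by (rule fine[OF part pf])
    finally show ?thesis using \<open>c > 0\<close> by (simp add: e'_def sum_distrib_left[symmetric])
  qed
  define N where "N = ?S - (\<Union>i\<in>C. I i)"
  have N: "negligible N" using C(4) by (simp add: N_def I_def)
  \<comment> \<open>Henstock's lemma sees only finite families; the bound \<open>e\<close> is the
    same for all of them and so passes to the countable union.\<close>
  have U: "(\<Union>i\<in>C. I i) \<in> lmeasurable" "measure lebesgue (\<Union>i\<in>C. I i) \<le> e"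
  proof -
    have meas: "I i \<in> lmeasurable" if "i \<in> C" for i by (simp add: I_def)
    have bd: "measure lebesgue (\<Union>i\<in>C'. I i) \<le> e" if C': "C' \<subseteq> C" "finite C'" for C'
      by (rule order_trans[OF measure_UNION_le finite_bound[OF C']]) (use C' in \<open>auto simp: I_def\<close>)
    show "(\<Union>i\<in>C. I i) \<in> lmeasurable" "measure lebesgue (\<Union>i\<in>C. I i) \<le> e"
      using fmeasurable_UN_bound[OF C(1) meas bd] measure_UN_bound[OF C(1) meas bd] by auto
  qed
  have "?S \<subseteq> N \<union> (\<Union>i\<in>C. I i)" by (auto simp: N_def)
  moreover have "N \<union> (\<Union>i\<in>C. I i) \<in> lmeasurable" using U N by (simp add: fmeasurable.Un negligible_imp_measurable)
  moreover have "measure lebesgue (N \<union> (\<Union>i\<in>C. I i)) \<le> e"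
    using U N measure_Un_le[of N lebesgue "\<Union>i\<in>C. I i"] negligible_imp_measure0[OF N] negligible_imp_measurable[OF N]
    by (auto simp: fmeasurableD)
  ultimately show "\<exists>T. ?S \<subseteq> T \<and> T \<in> lmeasurable \<and> measure lebesgue T \<le> e" by blast
qed

text \<open>A point outside the coarse sets of all levels \<open>1 / Suc n\<close> is a point of
  differentiability, and countably many null sets have a null union.\<close>

lemma AE_has_real_derivative_integral:
  fixes f :: "real \<Rightarrow> real"
  assumes f: "f integrable_on {a..b}"
  shows "AE x in lebesgue. x \<in> {a<..<b} \<longrightarrow> ((\<lambda>x. integral {a..x} f) has_real_derivative f x) (at x)"
proof -
  define F where "F = (\<lambda>x. integral {a..x} f)"
  define S where "S n = {x\<in>{a<..<b}. \<forall>d>0. \<exists>y\<in>{a<..<b}. \<bar>y - x\<bar> < d \<and>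
     (1 / real (Suc n)) * \<bar>y - x\<bar> < \<bar>F y - F x - f x * (y - x)\<bar>}" for n
  have "negligible (S n)" for n
    unfolding S_def F_def by (rule negligible_coarse_points[OF f]) simp
  then have "negligible (\<Union>n. S n)" by (intro negligible_countable_Union) auto
  then have "AE x in lebesgue. x \<notin> (\<Union>n. S n)"
    by (intro AE_not_in) (simp add: negligible_iff_null_sets)
  then show ?thesis
  proof (rule AE_mp, intro AE_I2 impI)
    fix x assume nS: "x \<notin> (\<Union>n. S n)" and x: "x \<in> {a<..<b}"
    show "((\<lambda>x. integral {a..x} f) has_real_derivative f x) (at x)"
      unfolding F_def[symmetric]
    proof (rule has_real_derivative_if_small_oscillation)
      fix e :: real assume "e > 0"
      then obtain n where n: "1 / real (Suc n) < e" using reals_Archimedean[of e] by (auto simp: inverse_eq_divide)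
      from nS x obtain d where "d > 0" and d: "\<And>y. y \<in> {a<..<b} \<Longrightarrow> \<bar>y - x\<bar> < d \<Longrightarrow>
         \<bar>F y - F x - f x * (y - x)\<bar> \<le> (1 / real (Suc n)) * \<bar>y - x\<bar>"

        unfolding S_def UN_iff mem_Collect_eq by (smt (verit, best) UNIV_I)
      \<comment> \<open>The coarse sets test only \<open>y\<close> inside the open interval, so
        \<open>y\<close> must be kept away from both ends.\<close>
      define d' where "d' = min d (min (x - a) (b - x))"
      have "d' > 0" using x \<open>d > 0\<close> by (simp add: d'_def)
      moreover have "\<bar>F y - F x - f x * (y - x)\<bar> \<le> e * \<bar>y - x\<bar>" if "\<bar>y - x\<bar> < d'" for y
      proof -
        have "\<bar>F y - F x - f x * (y - x)\<bar> \<le> (1 / real (Suc n)) * \<bar>y - x\<bar>"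
          using that by (intro d) (auto simp: d'_def)
        also have "\<dots> \<le> e * \<bar>y - x\<bar>" using n by (intro mult_right_mono) auto
        finally show ?thesis .
      qed
      ultimately show "\<exists>d>0. \<forall>y. \<bar>y - x\<bar> < d \<longrightarrow> \<bar>F y - F x - f x * (y - x)\<bar> \<le> e * \<bar>y - x\<bar>" by blast
    qed
  qed
qed

subsection \<open>Cadlag paths\<close>

definition cadlag_path :: "(real \<Rightarrow> real) \<Rightarrow> bool" where
  "cadlag_path f \<longleftrightarrow> (\<forall>u\<ge>0. continuous (at_right u) f) \<and> (\<forall>u>0. \<exists>l. (f \<longlongrightarrow> l) (at_left u))"

text \<open>One-sided limits bound the path near each point, and compactness of the interval makes
  the bound uniform.\<close>

lemma cadlag_path_bounded:
  assumes f: "cadlag_path f" and "0 \<le> a"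
  obtains B where "B > 0" "\<And>u. u \<in> {a..b} \<Longrightarrow> \<bar>f u\<bar> \<le> B"
proof -
  have local: "\<exists>U B. open U \<and> x \<in> U \<and> (\<forall>u\<in>U \<inter> {a..b}. \<bar>f u\<bar> \<le> B)" if "x \<in> {a..b}" for x
  proof -
    have "x \<ge> 0" using that \<open>0 \<le> a\<close> by auto
    then have "(f \<longlongrightarrow> f x) (at_right x)" using f by (auto simp: cadlag_path_def continuous_within)
    then have "\<forall>\<^sub>F u in at_right x. dist (f u) (f x) < 1" by (rule tendstoD) simp
    then obtain r where r: "r > x" "\<And>u. x < u \<Longrightarrow> u < r \<Longrightarrow> dist (f u) (f x) < 1"
      by (auto simp: eventually_at_right_field)
    obtain q L where q: "q < x" "\<And>u. q < u \<Longrightarrow> u < x \<Longrightarrow> 0 \<le> u \<Longrightarrow> dist (f u) L < 1"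
    proof (cases "x > 0")
      case True
      then obtain l where "(f \<longlongrightarrow> l) (at_left x)" using f by (auto simp: cadlag_path_def)
      then have "\<forall>\<^sub>F u in at_left x. dist (f u) l < 1" by (rule tendstoD) simp
      then show ?thesis using that by (auto simp: eventually_at_left_field)
    next
      \<comment> \<open>Here \<open>x = 0\<close>; no nonnegative \<open>u\<close> lies to the left
        of it, so the condition on \<open>q\<close> and \<open>L\<close> is empty.\<close>
      case False
      then show ?thesis using that[of "x - 1"] by auto
    qed
    have "\<bar>f u\<bar> \<le> \<bar>f x\<bar> + \<bar>L\<bar> + 1" if "u \<in> {q<..<r} \<inter> {a..b}" for u
      using r(2)[of u] q(2)[of u] that \<open>0 \<le> a\<close> by (cases u x rule: linorder_cases) (auto simp: dist_real_def)
    then show ?thesis using r(1) q(1) by (intro exI[of _ "{q<..<r}"] exI[of _ "\<bar>f x\<bar> + \<bar>L\<bar> + 1"]) auto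
  qed
  then obtain U B where U: "\<And>x. x \<in> {a..b} \<Longrightarrow> open (U x) \<and> x \<in> U x \<and> (\<forall>u\<in>U x \<inter> {a..b}. \<bar>f u\<bar> \<le> B x)"
    by metis
  obtain D where D: "D \<subseteq> {a..b}" "finite D" "{a..b} \<subseteq> (\<Union>x\<in>D. U x)"
  proof (rule compactE_image[OF compact_Icc, of "{a..b}" U a b])
    show "open (U x)" if "x \<in> {a..b}" for x using U[OF that] by blast
    show "{a..b} \<subseteq> (\<Union>x\<in>{a..b}. U x)" using U by blast
  qed (rule that)
  define M where "M = Max (insert 1 (B ` D))"
  have "M \<ge> 1" unfolding M_def using D(2) by (intro Max_ge) auto
  moreover have "\<bar>f u\<bar> \<le> M" if "u \<in> {a..b}" for u
  proof -
    from that D obtain x where x: "x \<in> D" "u \<in> U x" by auto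
    then have "\<bar>f u\<bar> \<le> B x" using U D that by blast
    also have "B x \<le> M" unfolding M_def using D(2) x by (intro Max_ge) auto
    finally show ?thesis .
  qed
  ultimately show ?thesis using that[of M] by auto
qed

text \<open>The point of the grid \<open>s + \<nat>/(n+1)\<close> strictly to the right of \<open>u\<close>; strictness lets right
  continuity be applied as a limit along \<open>at_right u\<close>.\<close>

definition grid_right :: "real \<Rightarrow> nat \<Rightarrow> real \<Rightarrow> real" where
  "grid_right s n u = s + (of_int \<lfloor>(u - s) * real (Suc n)\<rfloor> + 1) / real (Suc n)"

lemma grid_right_gt: "u < grid_right s n u"
proof -
  have "(u - s) * real (Suc n) < of_int \<lfloor>(u - s) * real (Suc n)\<rfloor> + 1" by linarith
  then have "u - s < (of_int \<lfloor>(u - s) * real (Suc n)\<rfloor> + 1) / real (Suc n)"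
    by (subst pos_less_divide_eq) auto
  then show ?thesis by (simp add: grid_right_def)
qed

lemma grid_right_le: "grid_right s n u \<le> u + 1 / real (Suc n)"
proof -
  have "of_int \<lfloor>(u - s) * real (Suc n)\<rfloor> \<le> (u - s) * real (Suc n)" by linarith
  then have "of_int \<lfloor>(u - s) * real (Suc n)\<rfloor> / real (Suc n) \<le> u - s"
    by (subst pos_divide_le_eq) auto
  then show ?thesis by (simp add: grid_right_def add_divide_distrib)
qed

lemma grid_right_measurable [measurable]: "grid_right s n \<in> borel_measurable borel"
  unfolding grid_right_def by measurable

lemma grid_right_tendsto: "filterlim (\<lambda>n. grid_right s n u) (at_right u) sequentially"
  unfolding filterlim_at
proof (intro conjI)
  have neq: "grid_right s n u \<in> {u<..} \<and> grid_right s n u \<noteq> u" for n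
    using grid_right_gt[of u s n] by simp
  then show "\<forall>\<^sub>F n in sequentially. grid_right s n u \<in> {u<..} \<and> grid_right s n u \<noteq> u"
    by (rule always_eventually[OF allI])
  have "(\<lambda>n. u + 1 / real (Suc n)) \<longlonglongrightarrow> u + 0"
    by (intro tendsto_add tendsto_const) (use LIMSEQ_inverse_real_of_nat in \<open>simp add: inverse_eq_divide\<close>)
  then have lim: "(\<lambda>n. u + 1 / real (Suc n)) \<longlonglongrightarrow> u" by simp
  show "(\<lambda>n. grid_right s n u) \<longlonglongrightarrow> u"
    by (rule tendsto_sandwich[OF always_eventually always_eventually tendsto_const lim])
      (use grid_right_gt[of u s, THEN less_imp_le] grid_right_le[of s _ u] in blast)+
qed

lemma cadlag_path_grid_tendsto:
  assumes "cadlag_path f" "u \<ge> 0"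
  shows "(\<lambda>n. f (grid_right s n u)) \<longlonglongrightarrow> f u"
  using assms filterlim_compose[OF _ grid_right_tendsto, of f "nhds (f u)" u s]
  by (auto simp: cadlag_path_def continuous_within)

subsection \<open>Negative powers of tail integrals\<close>

text \<open>Both bounds come from one mean value and the monotonicity of the derivative. They serve
  to enclose increments of a negative power, and later as the tangent inequality of a convex
  function.\<close>

lemma powr_minus_mean_value_bounds:
  fixes a b q :: real
  assumes "0 < a" "a \<le> b" "0 < q"
  shows "q * b powr (- q - 1) * (b - a) \<le> a powr (- q) - b powr (- q)"
    and "a powr (- q) - b powr (- q) \<le> q * a powr (- q - 1) * (b - a)"
proof -
  have "\<exists>\<xi>. a \<le> \<xi> \<and> \<xi> \<le> b \<and> a powr (- q) - b powr (- q) = q * \<xi> powr (- q - 1) * (b - a)"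
  proof (cases "a = b")
    case False
    then have "a < b" using assms by simp
    have "\<exists>z>a. z < b \<and> b powr (- q) - a powr (- q) = (b - a) * (- q * z powr (- q - 1))"
    proof (rule MVT2[OF \<open>a < b\<close>])
      fix x assume "a \<le> x" "x \<le> b"
      then have "x > 0" using assms by simp
      then show "((\<lambda>x. x powr (- q)) has_real_derivative - q * x powr (- q - 1)) (at x)"
        using has_real_derivative_powr[of x "- q"] by simp
    qed
    then obtain z where z: "a < z" "z < b"
        "b powr (- q) - a powr (- q) = (b - a) * (- q * z powr (- q - 1))" by blast
    then show ?thesis by (intro exI[of _ z]) (simp add: algebra_simps)
  qed (use assms in auto)
  then obtain \<xi> where \<xi>: "a \<le> \<xi>" "\<xi> \<le> b" "a powr (- q) - b powr (- q) = q * \<xi> powr (- q - 1) * (b - a)"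
    by blast
  have "b powr (- q - 1) \<le> \<xi> powr (- q - 1)" "\<xi> powr (- q - 1) \<le> a powr (- q - 1)"
    using \<xi> assms by (auto intro!: powr_mono2')
  then show "q * b powr (- q - 1) * (b - a) \<le> a powr (- q) - b powr (- q)"
    and "a powr (- q) - b powr (- q) \<le> q * a powr (- q - 1) * (b - a)"
    unfolding \<xi>(3) using assms by (auto intro!: mult_right_mono mult_left_mono)
qed

text \<open>Increments of second order force a zero derivative, without differentiability of
  \<open>F\<close> being known beforehand.\<close>

lemma quadratic_increments_imp_eq:
  fixes F :: "real \<Rightarrow> real"
  assumes "\<And>x y. s \<le> x \<Longrightarrow> x \<le> y \<Longrightarrow> y \<le> r \<Longrightarrow> \<bar>F y - F x\<bar> \<le> C * (y - x)\<^sup>2" and "s \<le> r"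
  shows "F s = F r"
proof -
  have "(F has_real_derivative 0) (at x within {s..r})" if x: "x \<in> {s..r}" for x
    unfolding has_field_derivative_def has_derivative_within_alt
  proof (intro conjI allI impI)
    fix e :: real assume "e > 0"
    define d where "d = e / (\<bar>C\<bar> + 1)"
    have "d > 0" using \<open>e > 0\<close> by (simp add: d_def)
    moreover have "\<bar>F y - F x\<bar> \<le> e * \<bar>y - x\<bar>" if y: "y \<in> {s..r}" "\<bar>y - x\<bar> < d" for y
    proof -
      have "\<bar>F y - F x\<bar> \<le> C * (y - x)\<^sup>2"
        using assms(1)[of x y] assms(1)[of y x] x y
        by (cases "x \<le> y") (auto simp: abs_minus_commute power2_commute)
      also have "\<dots> \<le> (\<bar>C\<bar> + 1) * (\<bar>y - x\<bar> * \<bar>y - x\<bar>)"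
        by (auto simp: power2_eq_square intro!: mult_right_mono)
      also have "\<dots> \<le> (\<bar>C\<bar> + 1) * (d * \<bar>y - x\<bar>)"
        using y by (intro mult_left_mono mult_right_mono) auto
      also have "\<dots> = e * \<bar>y - x\<bar>" by (simp add: d_def)
      finally show ?thesis .
    qed
    ultimately show "\<exists>d>0. \<forall>y\<in>{s..r}. norm (y - x) < d \<longrightarrow> norm (F y - F x - 0 * (y - x)) \<le> e * norm (y - x)"
      by auto
  qed (rule bounded_linear_mult_right)
  then obtain c where "\<forall>x\<in>{s..r}. F x = c"
    using has_field_derivative_zero_constant[of "{s..r}" F] by auto
  then show ?thesis using \<open>s \<le> r\<close> by auto
qed

text \<open>The chain rule for \<open>Y powr (- p)\<close> when \<open>Y\<close> has density
  \<open>- v\<close> and \<open>v\<close> is only bounded, so that \<open>Y\<close> may fail to be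
  differentiable at some points. On a short interval from \<open>x\<close> to \<open>y\<close>, the
  increment of the power and \<open>p\<close> times the integral of the right-hand integrand both
  lie between \<open>p * Y x powr (- p - 1) * I\<close> and
  \<open>p * Y y powr (- p - 1) * I\<close>, where \<open>I\<close> is the integral of
  \<open>v\<close>. These two numbers differ by second order, hence so do the two
  increments.\<close>

lemma integral_powr_of_tail_integral:
  fixes v :: "real \<Rightarrow> real"
  assumes p: "0 < p" and "s \<le> r" "r \<le> t"
    and v: "v integrable_on {s..t}" "\<And>u. u \<in> {s..t} \<Longrightarrow> 0 \<le> v u" "\<And>u. u \<in> {s..t} \<Longrightarrow> v u \<le> B"
  defines "Y \<equiv> \<lambda>x. integral {x..t} v"
  assumes pos: "Y r > 0"
    and g: "(\<lambda>u. Y u powr (- p - 1) * v u) integrable_on {s..r}"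
  shows "Y r powr (- p) - Y s powr (- p) = p * integral {s..r} (\<lambda>u. Y u powr (- p - 1) * v u)"
proof -
  define g where "g = (\<lambda>u. Y u powr (- p - 1) * v u)"
  have Yd: "Y x - Y y = integral {x..y} v" if "s \<le> x" "x \<le> y" "y \<le> t" for x y
    using Henstock_Kurzweil_Integration.integral_combine[of x y t v] that
      integrable_subinterval_real[OF v(1), of x t] by (auto simp: Y_def)
  have vi: "v integrable_on {x..y}" if "s \<le> x" "y \<le> t" for x y
    using integrable_subinterval_real[OF v(1), of x y] that by auto
  have Ymono: "Y y \<le> Y x" if "s \<le> x" "x \<le> y" "y \<le> t" for x y
    using Yd[OF that] Henstock_Kurzweil_Integration.integral_nonneg[OF vi, of x y] v(2) that by force
  have gi: "g integrable_on {x..y}" if "s \<le> x" "y \<le> r" for x y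
    using integrable_subinterval_real[OF g, of x y] that by (auto simp: g_def)
  define F where "F = (\<lambda>x. Y x powr (- p) - p * integral {s..x} g)"
  \<comment> \<open>Two factors \<open>B\<close> bound two factors \<open>I\<close>. The power
    \<open>- p - 2\<close> bounds the slope of the power \<open>- p - 1\<close>, and it is taken at
    \<open>Y r\<close>, the smallest value of \<open>Y\<close> up to time \<open>r\<close>.\<close>
  define L where "L = p * ((p + 1) * Y r powr (- (p + 1) - 1)) * (B * B)"
  have "\<bar>F y - F x\<bar> \<le> L * (y - x)\<^sup>2" if xy: "s \<le> x" "x \<le> y" "y \<le> r" for x y
  proof -
    have yt: "y \<le> t" using xy \<open>r \<le> t\<close> by simp
    have Yy: "0 < Y y" "Y r \<le> Y y" using pos Ymono[of y r] xy \<open>r \<le> t\<close> by auto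
    have Yx: "Y y \<le> Y x" using Ymono xy yt by simp
    define I where "I = integral {x..y} v"
    have I: "Y x - Y y = I" using Yd xy yt by (simp add: I_def)
    have "I \<le> integral {x..y} (\<lambda>_. B)"
      unfolding I_def using xy yt v(3) by (intro integral_le vi) auto
    then have IB: "I \<le> B * (y - x)" using xy by (simp add: mult.commute)
    have I0: "0 \<le> I" using Yx I by simp
    have "integral {x..y} g \<le> integral {x..y} (\<lambda>u. Y y powr (- p - 1) * v u)"
    proof (rule integral_le)
      fix u assume u: "u \<in> {x..y}"
      then have "Y y \<le> Y u" using Ymono[of u y] xy yt by auto
      then have "Y u powr (- p - 1) \<le> Y y powr (- p - 1)" using Yy p by (intro powr_mono2') auto
      then show "g u \<le> Y y powr (- p - 1) * v u"
        unfolding g_def using v(2) u xy yt by (intro mult_right_mono) auto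
    qed (use gi xy yt vi in \<open>auto intro!: integrable_on_mult_right\<close>)
    then have up: "integral {x..y} g \<le> Y y powr (- p - 1) * I" by (simp add: I_def)
    have "integral {x..y} (\<lambda>u. Y x powr (- p - 1) * v u) \<le> integral {x..y} g"
    proof (rule integral_le)
      fix u assume u: "u \<in> {x..y}"
      then have "Y u \<le> Y x" "0 < Y u" using Ymono[of x u] Ymono[of u y] Yy xy yt by auto
      then have "Y x powr (- p - 1) \<le> Y u powr (- p - 1)" using p by (intro powr_mono2') auto
      then show "Y x powr (- p - 1) * v u \<le> g u"
        unfolding g_def using v(2) u xy yt by (intro mult_right_mono) auto
    qed (use gi xy yt vi in \<open>auto intro!: integrable_on_mult_right\<close>)
    then have lo: "Y x powr (- p - 1) * I \<le> integral {x..y} g" by (simp add: I_def)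
    note A = powr_minus_mean_value_bounds[OF Yy(1) Yx p, unfolded I]
    have up': "p * integral {x..y} g \<le> p * Y y powr (- p - 1) * I"
      and lo': "p * Y x powr (- p - 1) * I \<le> p * integral {x..y} g"
      using mult_left_mono[OF up, of p] mult_left_mono[OF lo, of p] p by (auto simp: mult.assoc)
    have "integral {s..y} g = integral {s..x} g + integral {x..y} g"
      using Henstock_Kurzweil_Integration.integral_combine[of s x y g] xy gi by auto
    then have "F y - F x = (Y y powr (- p) - Y x powr (- p)) - p * integral {x..y} g"
      by (simp add: F_def algebra_simps)
    then have "\<bar>F y - F x\<bar> \<le> p * Y y powr (- p - 1) * I - p * Y x powr (- p - 1) * I"
      using A up' lo' by linarith
    also have "\<dots> = p * (Y y powr (- (p + 1)) - Y x powr (- (p + 1))) * I"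
    proof -
      have *: "- (p + 1) = - p - 1" by simp
      show ?thesis unfolding * by (simp only: algebra_simps)
    qed
    \<comment> \<open>The width of the enclosure is again an increment of a negative power, now with
      exponent \<open>p + 1\<close>; this yields the second factor \<open>I\<close>.\<close>
    also have "\<dots> \<le> p * ((p + 1) * Y y powr (- (p + 1) - 1) * I) * I"
      using powr_minus_mean_value_bounds(2)[OF Yy(1) Yx, of "p + 1"] p I0 unfolding I
      by (intro mult_right_mono mult_left_mono) auto
    also have "\<dots> \<le> p * ((p + 1) * Y r powr (- (p + 1) - 1) * I) * I"
      using Yy pos p I0 by (intro mult_right_mono mult_left_mono powr_mono2') auto
    also have "\<dots> = p * ((p + 1) * Y r powr (- (p + 1) - 1)) * (I * I)" by simp
    also have "\<dots> \<le> p * ((p + 1) * Y r powr (- (p + 1) - 1)) * ((B * (y - x)) * (B * (y - x)))"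
      using IB I0 p by (intro mult_left_mono mult_mono) auto
    also have "\<dots> = L * (y - x)\<^sup>2" by (simp add: L_def power2_eq_square)
    finally show ?thesis .
  qed
  then have "F s = F r" using \<open>s \<le> r\<close> by (rule quadratic_increments_imp_eq)
  then show ?thesis by (simp add: F_def g_def)
qed

subsection \<open>Laplace transforms by analytic continuation\<close>

lemma continuous_on_integral_dominated:
  fixes f :: "complex \<Rightarrow> 'a \<Rightarrow> complex"
  assumes meas: "\<And>z. z \<in> S \<Longrightarrow> f z \<in> borel_measurable M"
    and cont: "\<And>x. x \<in> space M \<Longrightarrow> continuous_on S (\<lambda>z. f z x)"
    and dom: "\<And>z0. z0 \<in> S \<Longrightarrow> \<exists>r>0. \<exists>g. integrable M g \<and> (AE x in M. \<forall>z\<in>S \<inter> ball z0 r. norm (f z x) \<le> g x)"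
  shows "continuous_on S (\<lambda>z. \<integral>x. f z x \<partial>M)"
  unfolding continuous_on_sequentially
proof (intro allI ballI impI)
  fix X :: "nat \<Rightarrow> complex" and a
  assume a: "a \<in> S" and X: "(\<forall>n. X n \<in> S) \<and> X \<longlonglongrightarrow> a"
  obtain r g where r: "r > 0" and g: "integrable M g" "AE x in M. \<forall>z\<in>S \<inter> ball a r. norm (f z x) \<le> g x"
    using dom[OF a] by blast
  have "\<forall>\<^sub>F n in sequentially. X n \<in> ball a r"
    using X r by (auto dest!: tendstoD simp: dist_commute)
  then obtain N where N: "\<And>n. n \<ge> N \<Longrightarrow> X n \<in> ball a r" by (auto simp: eventually_sequentially)
  have "(\<lambda>n. \<integral>x. f (X (n + N)) x \<partial>M) \<longlonglongrightarrow> (\<integral>x. f a x \<partial>M)"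
  proof (rule integral_dominated_convergence[OF _ _ g(1)])
    show "AE x in M. (\<lambda>n. f (X (n + N)) x) \<longlonglongrightarrow> f a x"
    proof (rule AE_I2)
      fix x assume "x \<in> space M"
      then have "((\<lambda>z. f z x) \<circ> X) \<longlonglongrightarrow> f a x"
        using a X cont unfolding continuous_on_sequentially by blast
      then show "(\<lambda>n. f (X (n + N)) x) \<longlonglongrightarrow> f a x" by (intro LIMSEQ_ignore_initial_segment) (simp add: o_def)
    qed
    show "AE x in M. norm (f (X (n + N)) x) \<le> g x" for n
      using g(2) by eventually_elim (use X N in auto)
  qed (use meas a X in auto)
  then show "((\<lambda>z. \<integral>x. f z x \<partial>M) \<circ> X) \<longlonglongrightarrow> (\<integral>x. f a x \<partial>M)"
    unfolding o_def by (rule LIMSEQ_offset)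
qed

text \<open>A locally uniform integrable bound on the integrand itself is the only domination
  required: Cauchy's inequality on small discs turns it into a bound \<open>g x / q\<close> on the
  derivative, hence on the difference quotients.\<close>

lemma has_field_derivative_integral_dominated:
  fixes f :: "complex \<Rightarrow> 'a \<Rightarrow> complex"
  assumes "open S" and meas: "\<And>z. z \<in> S \<Longrightarrow> f z \<in> borel_measurable M"
    and hol: "\<And>x. x \<in> space M \<Longrightarrow> (\<lambda>z. f z x) holomorphic_on S"
    and dom: "\<And>z0. z0 \<in> S \<Longrightarrow> \<exists>r>0. ball z0 r \<subseteq> S \<and>
        (\<exists>g. integrable M g \<and> (AE x in M. \<forall>z\<in>ball z0 r. norm (f z x) \<le> g x))"
    and z0: "z0 \<in> S"
  shows "((\<lambda>z. \<integral>x. f z x \<partial>M) has_field_derivative (\<integral>x. deriv (\<lambda>z. f z x) z0 \<partial>M)) (at z0)"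
proof -
  obtain r g where r: "r > 0" "ball z0 r \<subseteq> S"
    and g: "integrable M g" "AE x in M. \<forall>z\<in>ball z0 r. norm (f z x) \<le> g x"
    using dom[OF z0] by blast
  have fint: "integrable M (f z)" if "z \<in> ball z0 r" for z
    using g(2) by (intro Bochner_Integration.integrable_bound[OF g(1)] meas)
      (use r that in \<open>auto elim!: eventually_mono intro: order_trans[OF _ abs_ge_self]\<close>)
  \<comment> \<open>A disc of radius \<open>q\<close> around a point at distance less than
    \<open>q\<close> from \<open>z0\<close> must stay inside \<open>ball z0 r\<close>.\<close>
  define q where "q = r / 4"
  have q: "q > 0" "2 * q < r" using r by (auto simp: q_def)
  have quot: "norm ((f z x - f z0 x) / (z - z0)) \<le> g x / q"
    if x: "(\<lambda>z. f z x) holomorphic_on S" "\<forall>z\<in>ball z0 r. norm (f z x) \<le> g x"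
      and z: "z \<in> ball z0 q" "z \<noteq> z0" for x z
  proof -
    have "norm (f z x - f z0 x) \<le> g x / q * norm (z - z0)"
    proof (rule field_differentiable_bound[of "ball z0 q" "\<lambda>z. f z x" "\<lambda>w. deriv (\<lambda>z. f z x) w"])
      fix w assume w: "w \<in> ball z0 q"
      have wS: "w \<in> S" using w q r by (auto simp: subset_iff)
      show "((\<lambda>z. f z x) has_field_derivative deriv (\<lambda>z. f z x) w) (at w within ball z0 q)"
        by (rule holomorphic_derivI[OF x(1) \<open>open S\<close> wS])
      have cb: "cball w q \<subseteq> ball z0 r"
      proof
        fix y assume "y \<in> cball w q"
        then show "y \<in> ball z0 r" using w q dist_triangle[of z0 y w] by auto
      qed
      have "norm ((deriv ^^ 1) (\<lambda>z. f z x) w) \<le> fact 1 * g x / q ^ 1"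
      proof (rule Cauchy_inequality)
        show "(\<lambda>z. f z x) holomorphic_on ball w q"
          using cb r ball_subset_cball[of w q] by (intro holomorphic_on_subset[OF x(1)]) blast
        show "continuous_on (cball w q) (\<lambda>z. f z x)"
          using cb r by (intro holomorphic_on_imp_continuous_on holomorphic_on_subset[OF x(1)]) auto
        show "norm (f y x) \<le> g x" if "norm (w - y) = q" for y
          using x(2) cb that by (auto simp: dist_norm subset_iff)
      qed (use q in auto)
      then show "norm (deriv (\<lambda>z. f z x) w) \<le> g x / q" by simp
    qed (use z q in auto)
    then show ?thesis using z by (simp add: norm_divide field_simps)
  qed
  have lim: "((\<lambda>z. \<integral>x. (f z x - f z0 x) / (z - z0) \<partial>M) \<longlongrightarrow> (\<integral>x. deriv (\<lambda>z. f z x) z0 \<partial>M)) (at z0)"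
    unfolding tendsto_at_iff_sequentially
  proof (intro allI impI)
    fix X assume X: "\<forall>i. X i \<in> UNIV - {z0}" "X \<longlonglongrightarrow> z0"
    have "\<forall>\<^sub>F n in sequentially. X n \<in> ball z0 q"
      using X q by (auto dest!: tendstoD simp: dist_commute)
    then obtain N where N: "\<And>n. n \<ge> N \<Longrightarrow> X n \<in> ball z0 q" by (auto simp: eventually_sequentially)
    have dl: "(\<lambda>n. (f (X (n + N)) x - f z0 x) / (X (n + N) - z0)) \<longlonglongrightarrow> deriv (\<lambda>z. f z x) z0"
      if "(\<lambda>z. f z x) holomorphic_on S" for x
    proof -
      have "((\<lambda>z. f z x) has_field_derivative deriv (\<lambda>z. f z x) z0) (at z0)"
        by (rule holomorphic_derivI[OF that \<open>open S\<close> z0])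
      then have "((\<lambda>z. (f z x - f z0 x) / (z - z0)) \<longlongrightarrow> deriv (\<lambda>z. f z x) z0) (at z0)"
        by (simp add: has_field_derivative_iff)
      then have "((\<lambda>z. (f z x - f z0 x) / (z - z0)) \<circ> X) \<longlonglongrightarrow> deriv (\<lambda>z. f z x) z0"
        using X unfolding tendsto_at_iff_sequentially by blast
      then show ?thesis by (intro LIMSEQ_ignore_initial_segment) (simp add: o_def)
    qed
    have mq: "(\<lambda>x. (f (X (n + N)) x - f z0 x) / (X (n + N) - z0)) \<in> borel_measurable M" for n
      using meas[OF z0] meas[of "X (n + N)"] N[of "n + N"] r q by (auto simp: subset_iff)
    have "(\<lambda>n. \<integral>x. (f (X (n + N)) x - f z0 x) / (X (n + N) - z0) \<partial>M) \<longlonglongrightarrow> (\<integral>x. deriv (\<lambda>z. f z x) z0 \<partial>M)"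
    proof (rule integral_dominated_convergence)
      show "integrable M (\<lambda>x. g x / q)" using g by simp
      show "(\<lambda>x. deriv (\<lambda>z. f z x) z0) \<in> borel_measurable M"
        by (rule borel_measurable_LIMSEQ_metric[OF mq dl[OF hol]])
      show "AE x in M. (\<lambda>n. (f (X (n + N)) x - f z0 x) / (X (n + N) - z0)) \<longlonglongrightarrow> deriv (\<lambda>z. f z x) z0"
        by (rule AE_I2[OF dl[OF hol]])
      show "AE x in M. norm ((f (X (n + N)) x - f z0 x) / (X (n + N) - z0)) \<le> g x / q" for n
        using g(2) AE_space by eventually_elim (rule quot[OF hol], use X N in auto)
    qed (rule mq)
    then have "(\<lambda>n. \<integral>x. (f (X n) x - f z0 x) / (X n - z0) \<partial>M) \<longlonglongrightarrow> (\<integral>x. deriv (\<lambda>z. f z x) z0 \<partial>M)"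
      by (rule LIMSEQ_offset)
    then show "((\<lambda>z. \<integral>x. (f z x - f z0 x) / (z - z0) \<partial>M) \<circ> X) \<longlonglongrightarrow> (\<integral>x. deriv (\<lambda>z. f z x) z0 \<partial>M)"
      by (simp add: o_def)
  qed
  have "\<forall>\<^sub>F z in at z0. (\<integral>x. (f z x - f z0 x) / (z - z0) \<partial>M) = ((\<integral>x. f z x \<partial>M) - (\<integral>x. f z0 x \<partial>M)) / (z - z0)"
    unfolding eventually_at
    by (intro exI[of _ r]) (use r fint in \<open>auto simp: dist_commute\<close>)
  then show ?thesis
    unfolding has_field_derivative_iff by (rule Lim_transform_eventually[OF lim])
qed

lemma holomorphic_on_integral_dominated:
  fixes f :: "complex \<Rightarrow> 'a \<Rightarrow> complex"
  assumes "open S" "\<And>z. z \<in> S \<Longrightarrow> f z \<in> borel_measurable M"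
    "\<And>x. x \<in> space M \<Longrightarrow> (\<lambda>z. f z x) holomorphic_on S"
    "\<And>z0. z0 \<in> S \<Longrightarrow> \<exists>r>0. ball z0 r \<subseteq> S \<and>
        (\<exists>g. integrable M g \<and> (AE x in M. \<forall>z\<in>ball z0 r. norm (f z x) \<le> g x))"
  shows "(\<lambda>z. \<integral>x. f z x \<partial>M) holomorphic_on S"
  unfolding holomorphic_on_open[OF assms(1)]
  using has_field_derivative_integral_dominated[OF assms] by blast

lemma open_strip: "open {w. 0 < Re w \<and> Re w < g}"
  by (intro open_Collect_conj open_halfspace_Re_gt open_halfspace_Re_lt)

text \<open>The bound may grow with \<open>norm w\<close>, since domination is needed only near each
  point. The lemma serves both the integral over the jumps and the integral over time.\<close>

lemma integral_over_strip:
  fixes f :: "complex \<Rightarrow> 'a \<Rightarrow> complex" and \<beta> :: "real \<Rightarrow> real"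
  assumes meas: "\<And>w. f w \<in> borel_measurable M" and \<rho>: "integrable M \<rho>"
    and cont: "\<And>x. x \<in> space M \<Longrightarrow> continuous_on {w. 0 \<le> Re w \<and> Re w \<le> g} (\<lambda>w. f w x)"
    and hol: "\<And>x. x \<in> space M \<Longrightarrow> (\<lambda>w. f w x) holomorphic_on {w. 0 < Re w \<and> Re w < g}"
    and bound: "\<And>w m x. 0 \<le> Re w \<Longrightarrow> Re w \<le> g \<Longrightarrow> norm w \<le> m \<Longrightarrow> norm (f w x) \<le> \<beta> m * \<rho> x"
  shows "continuous_on {w. 0 \<le> Re w \<and> Re w \<le> g} (\<lambda>w. \<integral>x. f w x \<partial>M)"
    and "(\<lambda>w. \<integral>x. f w x \<partial>M) holomorphic_on {w. 0 < Re w \<and> Re w < g}"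
proof -
  have ball: "norm (f z x) \<le> \<beta> (norm z0 + r) * \<rho> x" if "0 \<le> Re z" "Re z \<le> g" "z \<in> ball z0 r" for z z0 r x
    using that norm_triangle_ineq2[of z z0] by (intro bound) (auto simp: dist_norm norm_minus_commute)
  show "continuous_on {w. 0 \<le> Re w \<and> Re w \<le> g} (\<lambda>w. \<integral>x. f w x \<partial>M)"
  proof (rule continuous_on_integral_dominated[OF meas cont])
    fix z0
    show "\<exists>r>0. \<exists>h. integrable M h \<and>
        (AE x in M. \<forall>z\<in>{w. 0 \<le> Re w \<and> Re w \<le> g} \<inter> ball z0 r. norm (f z x) \<le> h x)"
      using ball by (intro exI[of _ 1] exI[of _ "\<lambda>x. \<beta> (norm z0 + 1) * \<rho> x"] conjI AE_I2 integrable_mult_right \<rho>) auto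
  qed
  show "(\<lambda>w. \<integral>x. f w x \<partial>M) holomorphic_on {w. 0 < Re w \<and> Re w < g}"
  proof (rule holomorphic_on_integral_dominated[OF open_strip meas hol])
    fix z0 assume "z0 \<in> {w. 0 < Re w \<and> Re w < g}"
    then obtain r where r: "r > 0" "ball z0 r \<subseteq> {w. 0 < Re w \<and> Re w < g}"
      using open_strip open_contains_ball by blast
    then have "0 \<le> Re z" "Re z \<le> g" if "z \<in> ball z0 r" for z using that by force+
    then show "\<exists>r>0. ball z0 r \<subseteq> {w. 0 < Re w \<and> Re w < g} \<and>
        (\<exists>h. integrable M h \<and> (AE x in M. \<forall>z\<in>ball z0 r. norm (f z x) \<le> h x))"
      using r ball
      by (intro exI[of _ r] exI[of _ "\<lambda>x. \<beta> (norm z0 + r) * \<rho> x"] conjI AE_I2 ballI integrable_mult_right \<rho>) auto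
  qed
qed

section \<open>Laplace transforms of half lines and of the whole line\<close>

lemma power_mult_exp_minus_le:
  fixes x d :: real
  assumes "x \<ge> 0" "d > 0"
  shows "x ^ n * exp (- d * x) \<le> fact n / d ^ n"
proof -
  have "(d * x) ^ n / fact n = (\<Sum>k\<in>{n}. inverse (fact k) *\<^sub>R (d * x) ^ k)"
    by (simp add: field_simps)
  also have "\<dots> \<le> exp (d * x)"
    unfolding exp_def using assms by (intro sum_le_suminf summable_exp_generic) auto
  finally have "x ^ n * d ^ n \<le> fact n * exp (d * x)"
    by (simp add: field_simps power_mult_distrib)
  then show ?thesis using assms by (simp add: exp_minus field_simps)
qed

text \<open>Differentiation brings down one factor \<open>x\<close>, so \<open>P n\<close> is the
  \<open>n\<close>-th derivative of \<open>P 0\<close>. For \<open>Re w < 0\<close> the exponential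
  decay absorbs the power of \<open>x\<close>, uniformly near each point.\<close>

lemma has_field_derivative_half_line_laplace:
  fixes \<mu> :: "real measure"
  assumes \<mu>: "finite_measure \<mu>" "sets \<mu> = sets borel" and w: "Re w < 0"
  defines "P \<equiv> \<lambda>n w. \<integral>x. indicator {0..} x * of_real (x ^ n) * exp (w * of_real x) \<partial>\<mu>"
  shows "(P n has_field_derivative P (Suc n) w) (at w)"
proof -
  interpret finite_measure \<mu> by fact
  note [measurable_cong] = \<mu>(2)
  define f where "f = (\<lambda>n (w::complex) x. indicator {0..} x * of_real (x ^ n) * exp (w * of_real x) :: complex)"
  have d: "((\<lambda>z. f n z x) has_field_derivative f (Suc n) z x) (at z)" for n z x
    unfolding f_def by (auto intro!: derivative_eq_intros simp: algebra_simps)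
  have "((\<lambda>z. \<integral>x. f n z x \<partial>\<mu>) has_field_derivative (\<integral>x. deriv (\<lambda>z. f n z x) w \<partial>\<mu>)) (at w)"
  proof (rule has_field_derivative_integral_dominated[of "{w. Re w < 0}"])
    show "open {w. Re w < 0}" by (rule open_halfspace_Re_lt)
    show "f n z \<in> borel_measurable \<mu>" for z unfolding f_def by measurable
    show "(\<lambda>z. f n z x) holomorphic_on {w. Re w < 0}" for x
      unfolding f_def by (intro holomorphic_intros)
    fix z0 :: complex assume z0: "z0 \<in> {w. Re w < 0}"
    \<comment> \<open>Half of the distance to the imaginary axis keeps
      \<open>Re z \<le> - \<delta>\<close> on the whole ball.\<close>
    define \<delta> where "\<delta> = - Re z0 / 2"
    have \<delta>: "\<delta> > 0" using z0 by (simp add: \<delta>_def)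
    have Re: "Re z \<le> - \<delta>" if "z \<in> ball z0 \<delta>" for z
      using that abs_Re_le_cmod[of "z - z0"] by (simp add: \<delta>_def dist_norm norm_minus_commute)
    show "\<exists>r>0. ball z0 r \<subseteq> {w. Re w < 0} \<and>
        (\<exists>g. integrable \<mu> g \<and> (AE x in \<mu>. \<forall>z\<in>ball z0 r. norm (f n z x) \<le> g x))"
    proof (intro exI[of _ \<delta>] exI[of _ "\<lambda>_. fact n / \<delta> ^ n"] conjI AE_I2 ballI)
      fix x z assume z: "z \<in> ball z0 \<delta>"
      show "norm (f n z x) \<le> fact n / \<delta> ^ n"
      proof (cases "x \<ge> 0")
        case True
        have "norm (f n z x) = x ^ n * exp (Re z * x)"
          using True by (simp add: f_def norm_mult norm_power)
        also have "\<dots> \<le> x ^ n * exp (- \<delta> * x)"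
          using True mult_right_mono[OF Re[OF z] True] by (intro mult_left_mono) auto
        also have "\<dots> \<le> fact n / \<delta> ^ n" by (rule power_mult_exp_minus_le[OF True \<delta>])
        finally show ?thesis .
      next
        case False
        then show ?thesis using \<delta> by (simp add: f_def)
      qed
    qed (use \<delta> Re in force)+
  qed (use w in simp)
  moreover have "(\<integral>x. deriv (\<lambda>z. f n z x) w \<partial>\<mu>) = (\<integral>x. f (Suc n) w x \<partial>\<mu>)"
    by (intro Bochner_Integration.integral_cong refl DERIV_imp_deriv d)
  ultimately show ?thesis unfolding P_def f_def by simp
qed

lemma (in finite_measure) continuous_on_integral_bounded_by_1:
  fixes f :: "complex \<Rightarrow> 'a \<Rightarrow> complex"
  assumes "\<And>z. z \<in> S \<Longrightarrow> f z \<in> borel_measurable M"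
    and "\<And>x. x \<in> space M \<Longrightarrow> continuous_on S (\<lambda>z. f z x)"
    and "\<And>z x. z \<in> S \<Longrightarrow> norm (f z x) \<le> 1"
  shows "continuous_on S (\<lambda>z. \<integral>x. f z x \<partial>M)"
  using assms(3) by (intro continuous_on_integral_dominated assms exI[of _ 1] exI[of _ "\<lambda>_. 1"]) auto

text \<open>The transform of the negative half line exists on the right half plane, that of the positive
  half line \<open>P\<close> on the left one. By the identity on the imaginary axis, \<open>P\<close> continues
  analytically to \<open>Re w < g\<close>. Its Taylor coefficients at \<open>-1\<close> are nonnegative, so by
  monotone convergence the integral defining \<open>P\<close> converges as far as the Taylor series does.\<close>

lemma laplace_transform_of_analytic_extension:
  fixes \<mu> :: "real measure" and \<Lambda> :: "complex \<Rightarrow> complex"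
  assumes \<mu>: "finite_measure \<mu>" "sets \<mu> = sets borel"
    and cont: "continuous_on {w. 0 \<le> Re w \<and> Re w < g} \<Lambda>"
    and hol: "\<Lambda> holomorphic_on {w. 0 < Re w \<and> Re w < g}"
    and eq: "\<And>w. Re w = 0 \<Longrightarrow> (\<integral>x. exp (w * of_real x) \<partial>\<mu>) = \<Lambda> w"
    and c: "0 < c" "c < g"
  shows "integrable \<mu> (\<lambda>x. exp (c * x))" "complex_of_real (\<integral>x. exp (c * x) \<partial>\<mu>) = \<Lambda> (of_real c)"
proof -
  interpret finite_measure \<mu> by fact
  note [measurable_cong] = \<mu>(2)
  define P where "P = (\<lambda>n w. \<integral>x. indicator {0..} x * of_real (x ^ n) * exp (w * of_real x) \<partial>\<mu> :: complex)"
  define N where "N = (\<lambda>w. \<integral>x. indicator {..<0} x * exp (w * of_real x) \<partial>\<mu> :: complex)"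
  \<comment> \<open>\<open>P 0\<close> and \<open>N\<close> are the transforms of the two halves of
    \<open>\<mu>\<close>; removing \<open>N\<close> from \<open>\<Lambda>\<close> leaves the
    candidate for the continuation of \<open>P 0\<close> to the right.\<close>
  define F where "F = (\<lambda>w. if Re w \<le> 0 then P 0 w else \<Lambda> w - N w)"
  have Pd: "(P n has_field_derivative P (Suc n) w) (at w)" if "Re w < 0" for n w
    unfolding P_def by (rule has_field_derivative_half_line_laplace[OF \<mu> that])
  have Pcont: "continuous_on {w. Re w \<le> 0} (P 0)"
    unfolding P_def
    by (intro continuous_on_integral_bounded_by_1 continuous_intros)
      (auto simp: norm_mult indicator_def mult_nonpos_nonneg)
  have Nbound: "norm (indicator {..<0} x * exp (w * of_real x) :: complex) \<le> 1" if "0 \<le> Re w" for w x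
    using that by (auto simp: norm_mult indicator_def mult_nonneg_nonpos)
  have Ncont: "continuous_on {w. 0 \<le> Re w} N"
    unfolding N_def by (intro continuous_on_integral_bounded_by_1 continuous_intros Nbound) auto
  have Nhol: "N holomorphic_on {w. 0 < Re w}"
    unfolding N_def
  proof (rule holomorphic_on_integral_dominated[OF open_halfspace_Re_gt])
    show "(\<lambda>z. indicator {..<0} x * exp (z * of_real x) :: complex) holomorphic_on {w. 0 < Re w}" for x :: real
      by (intro holomorphic_intros)
    fix z0 :: complex assume "z0 \<in> {w. 0 < Re w}"
    then obtain r where r: "r > 0" "ball z0 r \<subseteq> {w. 0 < Re w}"
      using open_halfspace_Re_gt[of 0] open_contains_ball by blast
    then have "Re z \<ge> 0" if "z \<in> ball z0 r" for z using that by force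
    then show "\<exists>r>0. ball z0 r \<subseteq> {w. 0 < Re w} \<and> (\<exists>g. integrable \<mu> g \<and>
       (AE x in \<mu>. \<forall>z\<in>ball z0 r. norm (indicator {..<0} x * exp (z * of_real x) :: complex) \<le> g x))"
      using r Nbound by (intro exI[of _ r] conjI exI[of _ "\<lambda>_. 1"] AE_I2) auto
  qed measurable
  have split: "P 0 w + N w = \<Lambda> w" if w: "Re w = 0" for w
  proof -
    have i: "integrable \<mu> (\<lambda>x. indicator A x * exp (w * of_real x) :: complex)" if "A \<in> sets borel" for A
      using that w by (intro integrable_const_bound[of _ 1]) (auto simp: norm_mult indicator_def)
    have "P 0 w + N w = (\<integral>x. indicator {0..} x * exp (w * of_real x) + indicator {..<0} x * exp (w * of_real x) \<partial>\<mu>)"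
      unfolding P_def N_def using i[of "{0..}"] i[of "{..<0}"] by simp
    also have "\<dots> = (\<integral>x. exp (w * of_real x) \<partial>\<mu>)"
      by (intro Bochner_Integration.integral_cong) (auto simp: indicator_def)
    finally show ?thesis using eq[OF w] by simp
  qed
  have opS: "open {w. Re w < g}" by (rule open_halfspace_Re_lt)
  have Fhol: "F holomorphic_on {w. Re w < g}"
  \<comment> \<open>Across the line \<open>Re w = 0\<close> continuity suffices, given holomorphy on
    both sides. The functional \<open>1 \<bullet> w\<close> is the real part of
    \<open>w\<close>.\<close>
  proof (rule holomorphic_on_paste_across_line[OF opS, of 1 _ 0])
    have "P 0 holomorphic_on {w. Re w < 0}"
      unfolding holomorphic_on_def field_differentiable_def
      using Pd by (auto intro: has_field_derivative_at_within)
    then show "F holomorphic_on {w. Re w < g} \<inter> {z. 1 \<bullet> z < 0}"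
      by (rule holomorphic_transform[OF holomorphic_on_subset]) (auto simp: F_def)
    have "(\<lambda>w. \<Lambda> w - N w) holomorphic_on {w. 0 < Re w \<and> Re w < g}"
      by (intro holomorphic_on_diff hol holomorphic_on_subset[OF Nhol]) auto
    then show "F holomorphic_on {w. Re w < g} \<inter> {z. 0 < 1 \<bullet> z}"
      by (rule holomorphic_transform[OF holomorphic_on_subset]) (auto simp: F_def)
    have eqS: "{w. Re w < g} = {w. Re w \<le> 0} \<union> {w. 0 \<le> Re w \<and> Re w < g}" using c by auto
    have "closedin (top_of_set {w. Re w < g}) ({w. Re w < g} \<inter> {w. Re w \<le> 0})"
      by (intro closedin_closed_Int closed_halfspace_Re_le)
    moreover have "closedin (top_of_set {w. Re w < g}) ({w. Re w < g} \<inter> {w. Re w \<ge> 0})"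
      by (intro closedin_closed_Int closed_halfspace_Re_ge)
    moreover have "{w. Re w < g} \<inter> {w. Re w \<le> 0} = {w. Re w \<le> 0}"
        "{w. Re w < g} \<inter> {w. Re w \<ge> 0} = {w. 0 \<le> Re w \<and> Re w < g}" using c by auto
    ultimately have cl: "closedin (top_of_set {w. Re w < g}) {w. Re w \<le> 0}"
      "closedin (top_of_set {w. Re w < g}) {w. 0 \<le> Re w \<and> Re w < g}" by simp_all
    show "continuous_on {w. Re w < g} F"
      unfolding F_def eqS
    proof (rule continuous_on_cases_local)
      show "continuous_on {w. 0 \<le> Re w \<and> Re w < g} (\<lambda>w. \<Lambda> w - N w)"
        by (intro continuous_on_diff cont continuous_on_subset[OF Ncont]) auto
      show "P 0 x = \<Lambda> x - N x"
        if "x \<in> {w. Re w \<le> 0} \<and> \<not> Re x \<le> 0 \<or> x \<in> {w. 0 \<le> Re w \<and> Re w < g} \<and> Re x \<le> 0" for x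
        using that split[of x] by (auto simp: algebra_simps)
    qed (use cl eqS Pcont in auto)
  qed simp
  \<comment> \<open>Left of the axis \<open>F\<close> is \<open>P 0\<close>, so its derivatives at
    \<open>-1\<close> are integrals of nonnegative functions.\<close>
  have derivF: "Re w < 0 \<Longrightarrow> (deriv ^^ n) F w = P n w" for n w
  proof (induction n arbitrary: w)
    case 0
    then show ?case by (simp add: F_def)
  next
    case (Suc n)
    have "deriv ((deriv ^^ n) F) w = P (Suc n) w"
    proof (rule DERIV_imp_deriv, rule DERIV_cong_ev[THEN iffD1, OF refl _ refl Pd[OF Suc.prems]])
      have "\<forall>\<^sub>F x in nhds w. x \<in> {w. Re w < 0}"
        by (rule eventually_nhds_in_open[OF open_halfspace_Re_lt]) (use Suc.prems in simp)
      then show "\<forall>\<^sub>F x in nhds w. P n x = (deriv ^^ n) F x"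
        by eventually_elim (simp add: Suc.IH)
    qed
    then show ?case by simp
  qed
  define a where "a = (\<lambda>n. \<integral>x. indicator {0..} x * x ^ n * exp (- x) \<partial>\<mu>)"
  have ai: "integrable \<mu> (\<lambda>x. indicator {0..} x * x ^ n * exp (- x))" for n
    using power_mult_exp_minus_le[of _ 1 n]
    by (intro integrable_const_bound[of _ "fact n"]) (auto simp: indicator_def)
  have Pa: "P n (-1) = of_real (a n)" for n
  proof -
    have "P n (-1) = (\<integral>x. complex_of_real (indicator {0..} x * x ^ n * exp (- x)) \<partial>\<mu>)"
      unfolding P_def by (intro Bochner_Integration.integral_cong refl) (auto simp: indicator_def exp_of_real[symmetric])
    then show ?thesis unfolding a_def by (simp only: integral_complex_of_real)
  qed
  \<comment> \<open>\<open>h\<close> is the distance from the centre \<open>-1\<close> to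
    \<open>c\<close>, and it satisfies \<open>exp (c * x) = exp (- x) * exp (h * x)\<close>.\<close>
  define h where "h = 1 + c"
  \<comment> \<open>The disc of radius \<open>1 + g\<close> around \<open>-1\<close> is the largest
    one inside the half plane \<open>Re w < g\<close>, and it contains \<open>c\<close>.\<close>
  have "(\<lambda>n. (deriv ^^ n) F (-1) / fact n * (of_real c - (-1)) ^ n) sums F (of_real c)"
  proof (rule holomorphic_power_series)
    have "ball (- 1) (1 + g) \<subseteq> {w. Re w < g}"
    proof
      fix w :: complex assume "w \<in> ball (- 1) (1 + g)"
      then show "w \<in> {w. Re w < g}" using abs_Re_le_cmod[of "w + 1"]
        by (simp add: dist_norm norm_minus_commute)
    qed
    then show "F holomorphic_on ball (- 1) (1 + g)" by (rule holomorphic_on_subset[OF Fhol])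
    have "dist (- 1) (complex_of_real c) = \<bar>1 + c\<bar>"
      by (metis dist_commute dist_norm diff_minus_eq_add norm_of_real of_real_1 of_real_add add.commute)
    then show "complex_of_real c \<in> ball (- 1) (1 + g)" using c by simp
  qed
  also have "(\<lambda>n. (deriv ^^ n) F (-1) / fact n * (of_real c - (-1)) ^ n) = (\<lambda>n. of_real (a n / fact n * h ^ n))"
    by (simp add: derivF Pa h_def add.commute)
  finally have s1: "(\<lambda>n. complex_of_real (a n / fact n * h ^ n)) sums F (of_real c)" .
  have s2: "(\<lambda>n. a n / fact n * h ^ n) sums Re (F (of_real c))"
    by (rule sums_Re[OF s1, unfolded Re_complex_of_real])
  have s3: "F (of_real c) = of_real (Re (F (of_real c)))"
    using sums_unique2[OF s1 sums_of_real[OF s2]] .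
  have a0: "a n \<ge> 0" for n unfolding a_def by (intro Bochner_Integration.integral_nonneg) (auto simp: indicator_def)
  \<comment> \<open>The same series is read backwards: all terms are nonnegative, so sum and
    integral may be exchanged before integrability is known, and convergence of the Taylor series
    makes the value finite.\<close>
  have "(\<integral>\<^sup>+x. ennreal (indicator {0..} x * exp (c * x)) \<partial>\<mu>)
      = (\<integral>\<^sup>+x. (\<Sum>n. ennreal (indicator {0..} x * x ^ n * exp (- x) * (h ^ n / fact n))) \<partial>\<mu>)"
  proof (intro nn_integral_cong)
    fix x
    have "(\<lambda>n. indicator {0..} x * exp (- x) * ((h * x) ^ n /\<^sub>R fact n)) sums (indicator {0..} x * exp (- x) * exp (h * x))"
      by (intro sums_mult exp_converges)
    also have "indicator {0..} x * exp (- x) * exp (h * x) = indicator {0..} x * exp (c * x)"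
      by (simp add: h_def exp_add[symmetric] algebra_simps)
    also have "(\<lambda>n. indicator {0..} x * exp (- x) * ((h * x) ^ n /\<^sub>R fact n)) =
        (\<lambda>n. indicator {0..} x * x ^ n * exp (- x) * (h ^ n / fact n))"
      by (simp add: field_simps power_mult_distrib)
    finally have s: "(\<lambda>n. indicator {0..} x * x ^ n * exp (- x) * (h ^ n / fact n)) sums (indicator {0..} x * exp (c * x))" .
    have "(\<Sum>n. ennreal (indicator {0..} x * x ^ n * exp (- x) * (h ^ n / fact n)))
        = ennreal (\<Sum>n. indicator {0..} x * x ^ n * exp (- x) * (h ^ n / fact n))"
      using sums_summable[OF s] c by (intro suminf_ennreal2) (auto simp: indicator_def h_def)
    then show "ennreal (indicator {0..} x * exp (c * x)) = (\<Sum>n. ennreal (indicator {0..} x * x ^ n * exp (- x) * (h ^ n / fact n)))"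
      using sums_unique[OF s] by simp
  qed
  also have "\<dots> = (\<Sum>n. \<integral>\<^sup>+x. ennreal (indicator {0..} x * x ^ n * exp (- x) * (h ^ n / fact n)) \<partial>\<mu>)"
    by (intro nn_integral_suminf) measurable
  also have "\<dots> = (\<Sum>n. ennreal (a n / fact n * h ^ n))"
  proof (intro suminf_cong)
    fix n
    have "(\<integral>\<^sup>+x. ennreal (indicator {0..} x * x ^ n * exp (- x) * (h ^ n / fact n)) \<partial>\<mu>) =
        ennreal (\<integral>x. indicator {0..} x * x ^ n * exp (- x) * (h ^ n / fact n) \<partial>\<mu>)"
      using c ai[of n] by (intro nn_integral_eq_integral AE_I2 integrable_mult_left) (auto simp: indicator_def h_def)
    then show "(\<integral>\<^sup>+x. ennreal (indicator {0..} x * x ^ n * exp (- x) * (h ^ n / fact n)) \<partial>\<mu>) = ennreal (a n / fact n * h ^ n)"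
      by (simp add: a_def)
  qed
  also have "\<dots> = ennreal (Re (F (of_real c)))"
    using sums_summable[OF s2] a0 c unfolding sums_unique[OF s2]
    by (intro suminf_ennreal2) (auto simp: h_def)
  finally have nn: "(\<integral>\<^sup>+x. ennreal (indicator {0..} x * exp (c * x)) \<partial>\<mu>) = ennreal (Re (F (of_real c)))" .
  have r0: "0 \<le> Re (F (of_real c))"
    unfolding sums_unique[OF s2] using sums_summable[OF s2] a0 c by (intro suminf_nonneg) (auto simp: h_def)
  have pos: "has_bochner_integral \<mu> (\<lambda>x. indicator {0..} x * exp (c * x)) (Re (F (of_real c)))"
    by (rule has_bochner_integral_nn_integral[OF _ _ r0 nn]) auto
  have ni: "integrable \<mu> (\<lambda>x. indicator {..<0} x * exp (c * x))"
    using c by (intro integrable_const_bound[of _ 1]) (auto simp: indicator_def mult_nonneg_nonpos)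
  have Nc: "N (of_real c) = of_real (\<integral>x. indicator {..<0} x * exp (c * x) \<partial>\<mu>)"
  proof -
    have "N (of_real c) = (\<integral>x. complex_of_real (indicator {..<0} x * exp (c * x)) \<partial>\<mu>)"
      unfolding N_def by (intro Bochner_Integration.integral_cong refl) (auto simp: indicator_def exp_of_real[symmetric])
    then show ?thesis by (simp only: integral_complex_of_real)
  qed
  have sum_eq: "(\<lambda>x. exp (c * x)) = (\<lambda>x. indicator {0..} x * exp (c * x) + indicator {..<0} x * exp (c * x))"
    by (auto simp: indicator_def)
  have pi: "integrable \<mu> (\<lambda>x. indicator {0..} x * exp (c * x))"
    using pos by (simp add: has_bochner_integral_iff)
  show "integrable \<mu> (\<lambda>x. exp (c * x))"
    by (subst sum_eq) (intro Bochner_Integration.integrable_add pi ni)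
  have "(\<integral>x. exp (c * x) \<partial>\<mu>) = Re (F (of_real c)) + (\<integral>x. indicator {..<0} x * exp (c * x) \<partial>\<mu>)"
    by (subst sum_eq) (use pos ni in \<open>simp add: has_bochner_integral_iff\<close>)
  then have "complex_of_real (\<integral>x. exp (c * x) \<partial>\<mu>) = F (of_real c) + N (of_real c)"
    using s3 Nc by simp
  then show "complex_of_real (\<integral>x. exp (c * x) \<partial>\<mu>) = \<Lambda> (of_real c)"
    using c by (simp add: F_def)
qed

subsection \<open>Exponential moments from the triplet\<close>

abbreviation (input) pos_time :: "real measure" where "pos_time \<equiv> restrict_space borel {0..}"

lemma jump_kernel_sets: "jump_kernel K \<Longrightarrow> s \<ge> 0 \<Longrightarrow> sets (K s) = sets (restrict_space borel (- {0}))"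
  by (simp add: jump_kernel_def)

lemma jump_kernel_space: "jump_kernel K \<Longrightarrow> s \<ge> 0 \<Longrightarrow> space (K s) = - {0}"
  using sets_eq_imp_space_eq[OF jump_kernel_sets] by (simp add: space_restrict_space)

lemma jump_kernel_measurable:
  assumes "jump_kernel K" "s \<ge> 0" "f \<in> borel_measurable borel"
  shows "f \<in> borel_measurable (K s)"
  using measurable_restrict_space1[OF assms(3), of "- {0}"]
  by (subst measurable_cong_sets[OF jump_kernel_sets[OF assms(1,2)] refl])

text \<open>Jump measures may have infinite mass near 0, so measurability is built from that of
  \<open>emeasure (K s) A\<close> for single sets, by linear combinations and monotone limits. Only
  times \<open>s \<ge> 0\<close> carry information about \<open>K\<close>, hence the restricted
  space.\<close>

lemma measurable_nn_integral_jump_kernel: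
  assumes K: "jump_kernel K" and f: "f \<in> borel_measurable (restrict_space borel (- {0}))"
  shows "(\<lambda>s. \<integral>\<^sup>+x. f x \<partial>K s) \<in> borel_measurable pos_time"
  using f
proof (induction f rule: borel_measurable_induct)
  case (cong f g)
  have "(\<integral>\<^sup>+x. f x \<partial>K s) = (\<integral>\<^sup>+x. g x \<partial>K s)" if "s \<in> space pos_time" for s
    using that cong(3) jump_kernel_space[OF K, of s] by (intro nn_integral_cong) (auto simp: space_restrict_space)
  from iffD2[OF measurable_cong[OF this] cong(4)] show ?case .
next
  case (set A)
  have "(\<integral>\<^sup>+x. indicator A x \<partial>K s) = emeasure (K s) A" if "s \<in> space pos_time" for s
    using that set jump_kernel_sets[OF K, of s] by (auto simp: space_restrict_space)
  then show ?case
    by (rule measurable_cong[THEN iffD2]) (use K set in \<open>simp_all add: jump_kernel_def\<close>)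
next
  case (mult u c)
  have "(\<integral>\<^sup>+x. c * u x \<partial>K s) = c * (\<integral>\<^sup>+x. u x \<partial>K s)" if "s \<in> space pos_time" for s
    using that mult measurable_cong_sets[OF jump_kernel_sets[OF K, of s] refl, of borel]
    by (intro nn_integral_cmult) (auto simp: space_restrict_space)
  then show ?case by (rule measurable_cong[THEN iffD2]) (use mult in simp_all)
next
  case (add u v)
  have "(\<integral>\<^sup>+x. v x + u x \<partial>K s) = (\<integral>\<^sup>+x. v x \<partial>K s) + (\<integral>\<^sup>+x. u x \<partial>K s)" if "s \<in> space pos_time" for s
    using that add measurable_cong_sets[OF jump_kernel_sets[OF K, of s] refl, of borel]
    by (intro nn_integral_add) (auto simp: space_restrict_space)
  then show ?case by (rule measurable_cong[THEN iffD2]) (use add in simp_all)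
next
  case (seq U)
  have "(\<integral>\<^sup>+x. (SUP i. U i) x \<partial>K s) = (SUP i. \<integral>\<^sup>+x. U i x \<partial>K s)" if "s \<in> space pos_time" for s
    using that seq measurable_cong_sets[OF jump_kernel_sets[OF K, of s] refl, of borel]
    unfolding SUP_apply by (intro nn_integral_monotone_convergence_SUP) (auto simp: space_restrict_space)
  then show ?case by (rule measurable_cong[THEN iffD2]) (use seq in simp_all)
qed

lemma measurable_integral_jump_kernel_real:
  fixes f :: "real \<Rightarrow> real"
  assumes K: "jump_kernel K" and f: "f \<in> borel_measurable borel"
  shows "(\<lambda>s. \<integral>x. f x \<partial>K s) \<in> borel_measurable pos_time"
proof -
  have fr: "f \<in> borel_measurable (restrict_space borel (- {0}))"
    by (rule measurable_restrict_space1[OF f])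
  note [measurable] = measurable_nn_integral_jump_kernel[OF K]
  \<comment> \<open>A Bochner integral that fails to exist has the value 0; \<open>J\<close>
    reproduces this default, so that the equality holds at every time.\<close>
  define J where "J = (\<lambda>s. if (\<integral>\<^sup>+x. ennreal (norm (f x)) \<partial>K s) < \<infinity>
     then enn2real (\<integral>\<^sup>+x. ennreal (f x) \<partial>K s) - enn2real (\<integral>\<^sup>+x. ennreal (- f x) \<partial>K s) else 0)"
  have "(\<integral>x. f x \<partial>K s) = J s" if "s \<in> space pos_time" for s
  proof -
    have "f \<in> borel_measurable (K s)"
      using that by (intro jump_kernel_measurable[OF K _ f]) (auto simp: space_restrict_space)
    then show ?thesis
      unfolding J_def by (auto simp: integrable_iff_bounded real_lebesgue_integral_def not_integrable_integral_eq)
  qed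
  note eq = this
  have J: "J \<in> borel_measurable pos_time"
    unfolding J_def using fr by measurable
  show ?thesis by (rule iffD2[OF measurable_cong[OF eq] J])
qed

lemma measurable_integral_jump_kernel_complex:
  fixes f :: "real \<Rightarrow> complex"
  assumes K: "jump_kernel K" and f: "f \<in> borel_measurable borel"
  shows "(\<lambda>s. \<integral>x. f x \<partial>K s) \<in> borel_measurable pos_time"
proof -
  have fr: "f \<in> borel_measurable (restrict_space borel (- {0}))"
    by (rule measurable_restrict_space1[OF f])
  note [measurable] = measurable_nn_integral_jump_kernel[OF K] measurable_integral_jump_kernel_real[OF K]
  define J where "J = (\<lambda>s. if (\<integral>\<^sup>+x. ennreal (norm (f x)) \<partial>K s) < \<infinity>
     then complex_of_real (\<integral>x. Re (f x) \<partial>K s) + \<i> * complex_of_real (\<integral>x. Im (f x) \<partial>K s) else 0)"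
  have "(\<integral>x. f x \<partial>K s) = J s" if "s \<in> space pos_time" for s
  proof -
    have fs: "f \<in> borel_measurable (K s)"
      using that by (intro jump_kernel_measurable[OF K _ f]) (auto simp: space_restrict_space)
    show ?thesis
    proof (cases "integrable (K s) f")
      case True
      then have "(\<integral>\<^sup>+x. ennreal (norm (f x)) \<partial>K s) < \<infinity>" by (simp add: integrable_iff_bounded)
      with True show ?thesis unfolding J_def by (intro complex_eqI) auto
    next
      case False
      then have "\<not> (\<integral>\<^sup>+x. ennreal (norm (f x)) \<partial>K s) < \<infinity>" using fs by (simp add: integrable_iff_bounded)
      with False show ?thesis unfolding J_def by (simp add: not_integrable_integral_eq)
    qed
  qed
  note eq = this
  have J: "J \<in> borel_measurable pos_time"
    unfolding J_def using f fr by measurable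
  show ?thesis by (rule iffD2[OF measurable_cong[OF eq] J])
qed

text \<open>Three regions: a second-order Taylor bound for \<open>\<bar>x\<bar> \<le> 1\<close>,
  growth at most \<open>exp (g * x)\<close> for \<open>x > 1\<close>, and boundedness of the
  exponential for \<open>x < -1\<close>, because \<open>Re w \<ge> 0\<close>. The bound is shaped
  after the two integrability hypotheses on the jumps.\<close>

lemma norm_exp_minus_1_minus_le:
  fixes w :: complex and x g :: real
  assumes w: "0 \<le> Re w" "Re w \<le> g" "norm w \<le> m"
  shows "norm (exp (w * of_real x) - 1 - w * of_real x) \<le>
    (exp g * m\<^sup>2 + m + 2) * (min (x\<^sup>2) \<bar>x\<bar> + indicator {1<..} x * exp (g * x))"
proof -
  have m: "m \<ge> 0" using w(3) norm_ge_zero[of w] by linarith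
  have g: "g \<ge> 0" using w by simp
  define C where "C = exp g * m\<^sup>2 + m + 2"
  have C: "C \<ge> exp g * m\<^sup>2" "C \<ge> m + 2" "C \<ge> 1" using m by (auto simp: C_def add_nonneg_nonneg)
  consider "\<bar>x\<bar> \<le> 1" | "x > 1" | "x < -1" by linarith
  then have "norm (exp (w * of_real x) - 1 - w * of_real x) \<le> C * (min (x\<^sup>2) \<bar>x\<bar> + indicator {1<..} x * exp (g * x))"
  proof cases
    case 1
    have "norm (exp (w * of_real x) - (\<Sum>k\<le>1. (w * of_real x) ^ k / fact k)) \<le>
        exp \<bar>Re (w * of_real x)\<bar> * norm (w * of_real x) ^ Suc 1 / fact 1"
      by (rule Taylor_exp)
    then have "norm (exp (w * of_real x) - 1 - w * of_real x) \<le> exp \<bar>Re w * x\<bar> * (norm w * \<bar>x\<bar>)\<^sup>2"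
      by (simp add: norm_mult diff_diff_eq power2_eq_square)
    also have "\<dots> \<le> exp g * (m * \<bar>x\<bar>)\<^sup>2"
    proof (intro mult_mono power_mono)
      have "\<bar>Re w * x\<bar> \<le> g * 1" unfolding abs_mult using 1 w by (intro mult_mono) auto
      then show "exp \<bar>Re w * x\<bar> \<le> exp g" by simp
    qed (use w m in auto)
    also have "\<dots> = exp g * m\<^sup>2 * x\<^sup>2" by (simp add: power_mult_distrib)
    also have "\<dots> \<le> C * x\<^sup>2" by (intro mult_right_mono C) auto
    also have "x\<^sup>2 = min (x\<^sup>2) \<bar>x\<bar>"
      using 1 mult_left_le_one_le[of "\<bar>x\<bar>" "\<bar>x\<bar>"] by (simp add: min_def power2_eq_square)
    finally show ?thesis using 1 by (cases "1 < x") auto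
  next
    case 2
    have "norm (exp (w * of_real x) - 1 - w * of_real x) \<le> norm (exp (w * of_real x)) + norm (1::complex) + norm (w * of_real x)"
      using norm_triangle_ineq4[of "exp (w * of_real x) - 1" "w * of_real x"] norm_triangle_ineq4[of "exp (w * of_real x)" 1]
      by linarith
    also have "\<dots> \<le> exp (g * x) + x + m * x"
      using 2 w m by (intro add_mono) (auto simp: norm_mult intro!: mult_right_mono)
    also have "\<dots> \<le> C * exp (g * x) + C * x"
    proof -
      have "exp (g * x) \<le> C * exp (g * x)" using C by simp
      moreover have "(1 + m) * x \<le> C * x" using C 2 by (intro mult_right_mono) auto
      moreover have "(1 + m) * x = x + m * x" by (simp add: algebra_simps)
      ultimately show ?thesis by linarith
    qed
    finally have le: "norm (exp (w * of_real x) - 1 - w * of_real x) \<le> C * exp (g * x) + C * x" .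
    have "min (x\<^sup>2) \<bar>x\<bar> = x"
      using 2 mult_left_mono[of 1 x x] by (simp add: min_def power2_eq_square)
    then show ?thesis using 2 le by (simp add: algebra_simps)
  next
    case 3
    have "norm (exp (w * of_real x) - 1 - w * of_real x) \<le> norm (exp (w * of_real x)) + norm (1::complex) + norm (w * of_real x)"
      using norm_triangle_ineq4[of "exp (w * of_real x) - 1" "w * of_real x"] norm_triangle_ineq4[of "exp (w * of_real x)" 1]
      by linarith
    also have "\<dots> \<le> \<bar>x\<bar> + \<bar>x\<bar> + m * \<bar>x\<bar>"
    proof (intro add_mono)
      have "norm (exp (w * of_real x)) \<le> 1" using 3 w by (simp add: mult_nonneg_nonpos)
      then show "norm (exp (w * of_real x)) \<le> \<bar>x\<bar>" using 3 by linarith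
    qed (use 3 w m in \<open>auto simp: norm_mult intro!: mult_right_mono\<close>)
    also have "\<dots> = (m + 2) * \<bar>x\<bar>" by (simp add: algebra_simps)
    also have "\<dots> \<le> C * \<bar>x\<bar>" by (intro mult_right_mono C) auto
    also have "\<bar>x\<bar> = min (x\<^sup>2) \<bar>x\<bar>"
      using 3 mult_left_mono[of 1 "\<bar>x\<bar>" "\<bar>x\<bar>"] by (simp add: min_def power2_eq_square)
    finally show ?thesis using 3 by (simp add: indicator_def)
  qed
  then show ?thesis by (simp add: C_def)
qed

section \<open>Complex jump integrals and their time integrals on the closed strip\<close>

locale exp_jump_kernel =
  fixes K :: "real \<Rightarrow> real measure" and t g :: real
  assumes K: "jump_kernel K" and g: "g > 0"
    and small_jumps: "(\<integral>\<^sup>+s\<in>{0..t}. (\<integral>\<^sup>+x. ennreal (min (x\<^sup>2) \<bar>x\<bar>) \<partial>K s) \<partial>lborel) < \<infinity>"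
    and big_jumps: "(\<integral>\<^sup>+s\<in>{0..t}. (\<integral>\<^sup>+x\<in>{1<..}. ennreal (exp (g * x)) \<partial>K s) \<partial>lborel) < \<infinity>"
begin

definition weight :: "real \<Rightarrow> real" where
  "weight x = min (x\<^sup>2) \<bar>x\<bar> + indicator {1<..} x * exp (g * x)"

definition mass :: "real \<Rightarrow> ennreal" where
  "mass s = (\<integral>\<^sup>+x. ennreal (weight x) \<partial>K s)"

text \<open>At a time of infinite mass the jump integral may drop to its default value 0 for some
  \<open>w\<close>, which would spoil continuity in \<open>w\<close>. Such times form a null set and
  are cut out.\<close>

definition good :: "real set" where
  "good = {s\<in>{0..t}. mass s < \<infinity>}"

text \<open>A real-valued majorant in time; up to the factor \<open>bnd m\<close> it serves all
  \<open>w\<close> in the strip with \<open>norm w \<le> m\<close>.\<close>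

definition dom :: "real \<Rightarrow> real" where
  "dom s = indicator good s * enn2real (mass s)"

lemma weight_nonneg: "weight x \<ge> 0"
  by (simp add: weight_def)

lemma weight_measurable [measurable]: "weight \<in> borel_measurable borel"
  unfolding weight_def by measurable

lemma measurable_K: "s \<ge> 0 \<Longrightarrow> f \<in> borel_measurable borel \<Longrightarrow> f \<in> borel_measurable (K s)"
  by (rule jump_kernel_measurable[OF K])

lemma indicator_measurable_from_pos_time:
  fixes f :: "real \<Rightarrow> 'b::{real_normed_vector, second_countable_topology}"
  assumes "f \<in> borel_measurable pos_time" "A \<in> sets borel" "A \<subseteq> {0..}"
  shows "(\<lambda>s. indicator A s *\<^sub>R f s) \<in> borel_measurable borel"
proof -
  have "(\<lambda>s. indicator {0..} s *\<^sub>R f s) \<in> borel_measurable borel"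
    using assms(1) by (subst (asm) borel_measurable_restrict_space_iff) auto
  then have "(\<lambda>s. indicator A s *\<^sub>R (indicator {0..} s *\<^sub>R f s)) \<in> borel_measurable borel"
    by (intro borel_measurable_scaleR[OF borel_measurable_indicator[OF assms(2)]])
  also have "(\<lambda>s. indicator A s *\<^sub>R (indicator {0..} s *\<^sub>R f s)) = (\<lambda>s. indicator A s *\<^sub>R f s)"
    using assms(3) by (intro ext) (auto split: split_indicator)
  finally show ?thesis .
qed

lemma indicator_measurable_from_pos_time_ennreal:
  fixes f :: "real \<Rightarrow> ennreal"
  assumes "f \<in> borel_measurable pos_time" "A \<in> sets borel" "A \<subseteq> {0..}"
  shows "(\<lambda>s. f s * indicator A s) \<in> borel_measurable borel"
proof -
  have "(\<lambda>s. f s * indicator {0..} s) \<in> borel_measurable borel"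
    using assms(1) by (subst (asm) borel_measurable_restrict_space_iff_ennreal) auto
  then have "(\<lambda>s. (f s * indicator {0..} s) * indicator A s) \<in> borel_measurable borel"
    by (rule borel_measurable_times_ennreal[OF _ borel_measurable_indicator[OF assms(2)]])
  also have "(\<lambda>s. (f s * indicator {0..} s) * indicator A s) = (\<lambda>s. f s * indicator A s)"
    using assms(3) by (intro ext) (auto split: split_indicator)
  finally show ?thesis .
qed

lemma mass_measurable [measurable]: "mass \<in> borel_measurable pos_time"
  unfolding mass_def[abs_def]
  by (intro measurable_nn_integral_jump_kernel[OF K] measurable_restrict_space1) measurable

lemma mass_integral_finite: "(\<integral>\<^sup>+s. mass s * indicator {0..t} s \<partial>lborel) < \<infinity>"
proof -
  define a where "a = (\<lambda>s. \<integral>\<^sup>+x. ennreal (min (x\<^sup>2) \<bar>x\<bar>) \<partial>K s)"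
  define b where "b = (\<lambda>s. \<integral>\<^sup>+x\<in>{1<..}. ennreal (exp (g * x)) \<partial>K s)"
  have m: "a \<in> borel_measurable pos_time" "b \<in> borel_measurable pos_time"
    unfolding a_def b_def
    by (intro measurable_nn_integral_jump_kernel[OF K] measurable_restrict_space1; measurable)+
  have "mass s * indicator {0..t} s = a s * indicator {0..t} s + b s * indicator {0..t} s" for s
  proof (cases "s \<in> {0..t}")
    case True
    then have s: "s \<ge> 0" by simp
    have "mass s = (\<integral>\<^sup>+x. ennreal (min (x\<^sup>2) \<bar>x\<bar>) + ennreal (exp (g * x)) * indicator {1<..} x \<partial>K s)"
      unfolding mass_def weight_def
      by (intro nn_integral_cong) (auto simp: indicator_def ennreal_plus[symmetric] simp del: ennreal_plus)
    also have "\<dots> = a s + b s"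
      unfolding a_def b_def by (intro nn_integral_add measurable_K s) measurable
    finally show ?thesis using True by simp
  qed simp
  then have "(\<integral>\<^sup>+s. mass s * indicator {0..t} s \<partial>lborel) =
      (\<integral>\<^sup>+s. a s * indicator {0..t} s + b s * indicator {0..t} s \<partial>lborel)" by simp
  also have "\<dots> = (\<integral>\<^sup>+s. a s * indicator {0..t} s \<partial>lborel) + (\<integral>\<^sup>+s. b s * indicator {0..t} s \<partial>lborel)"
    using m by (intro nn_integral_add) (auto intro!: indicator_measurable_from_pos_time_ennreal)
  also have "\<dots> < \<infinity>"
    using small_jumps big_jumps unfolding a_def b_def by simp
  finally show ?thesis .
qed

lemma good_sets [measurable]: "good \<in> sets borel"
proof -
  have "(\<lambda>s. mass s * indicator {0..t} s) \<in> borel_measurable borel"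
    by (intro indicator_measurable_from_pos_time_ennreal) auto
  then have "{s\<in>space borel. mass s * indicator {0..t} s < \<infinity>} \<inter> {0..t} \<in> sets borel"
    by measurable
  also have "{s\<in>space borel. mass s * indicator {0..t} s < \<infinity>} \<inter> {0..t} = good"
    by (auto simp: good_def indicator_def)
  finally show ?thesis .
qed

lemma good_sub: "good \<subseteq> {0..t}" "good \<subseteq> {0..}"
  by (auto simp: good_def)

lemma AE_good: "AE s in lborel. s \<in> {0..t} \<longrightarrow> s \<in> good"
proof -
  have "AE s in lborel. mass s * indicator {0..t} s \<noteq> \<infinity>"
    using mass_integral_finite
    by (intro nn_integral_noteq_infinite) (auto intro!: indicator_measurable_from_pos_time_ennreal)
  then show ?thesis
    by eventually_elim (auto simp: good_def less_top)
qed

lemma integrable_dom: "integrable lborel dom"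
proof -
  have "(\<lambda>s. indicator good s *\<^sub>R enn2real (mass s)) \<in> borel_measurable borel"
    by (intro indicator_measurable_from_pos_time good_sets good_sub) measurable
  then have m: "dom \<in> borel_measurable lborel" by (simp add: dom_def[abs_def])
  have "(\<integral>\<^sup>+s. ennreal (norm (dom s)) \<partial>lborel) \<le> (\<integral>\<^sup>+s. mass s * indicator {0..t} s \<partial>lborel)"
    by (intro nn_integral_mono) (auto simp: dom_def good_def indicator_def)
  with m show ?thesis using mass_integral_finite by (auto simp: integrable_iff_bounded)
qed

lemma integrable_weight: "s \<in> good \<Longrightarrow> integrable (K s) weight"
  unfolding integrable_iff_bounded
  by (auto simp: good_def mass_def weight_nonneg intro!: measurable_K)

lemma integral_weight: "s \<in> good \<Longrightarrow> (\<integral>x. weight x \<partial>K s) = dom s"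
  unfolding dom_def mass_def
  by (subst integral_eq_nn_integral) (auto simp: good_def weight_nonneg intro!: measurable_K)

definition kint :: "real \<Rightarrow> complex \<Rightarrow> complex" where
  "kint s w = (\<integral>x. exp (w * of_real x) - 1 - w * of_real x \<partial>K s)"

definition bnd :: "real \<Rightarrow> real" where "bnd m = exp g * m\<^sup>2 + m + 2"

lemma integrand_le:
  assumes "0 \<le> Re w" "Re w \<le> g" "norm w \<le> m"
  shows "norm (exp (w * of_real x) - 1 - w * of_real x) \<le> bnd m * weight x"
  using norm_exp_minus_1_minus_le[OF assms] by (simp add: bnd_def weight_def)

lemma integrand_measurable: "s \<ge> 0 \<Longrightarrow> (\<lambda>x. exp (w * of_real x) - 1 - w * of_real x :: complex) \<in> borel_measurable (K s)"
  by (rule measurable_K) measurable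

lemma integrable_integrand:
  assumes "s \<in> good" "0 \<le> Re w" "Re w \<le> g"
  shows "integrable (K s) (\<lambda>x. exp (w * of_real x) - 1 - w * of_real x :: complex)"
  using assms integrand_le[of w "norm w"] good_sub
  by (intro Bochner_Integration.integrable_bound[OF integrable_mult_right[OF integrable_weight[OF assms(1)], of "bnd (norm w)"]]
      integrand_measurable AE_I2) (auto intro: order_trans[OF _ abs_ge_self])

lemma kint_le:
  assumes "s \<in> good" "0 \<le> Re w" "Re w \<le> g" "norm w \<le> m"
  shows "norm (kint s w) \<le> bnd m * dom s"
proof -
  have "norm (kint s w) \<le> (\<integral>x. norm (exp (w * of_real x) - 1 - w * of_real x :: complex) \<partial>K s)"
    unfolding kint_def by (rule integral_norm_bound)
  also have "\<dots> \<le> (\<integral>x. bnd m * weight x \<partial>K s)"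
    using assms by (intro integral_mono integrable_norm integrable_integrand integrable_mult_right integrable_weight integrand_le)
  also have "\<dots> = bnd m * dom s" using assms integral_weight by simp
  finally show ?thesis .
qed

lemma kint_analytic:
  assumes s: "s \<in> good"
  shows "continuous_on {w. 0 \<le> Re w \<and> Re w \<le> g} (kint s)" "kint s holomorphic_on {w. 0 < Re w \<and> Re w < g}"
proof -
  note strip = integral_over_strip[of "\<lambda>w x. exp (w * of_real x) - 1 - w * of_real x" "K s" weight g bnd,
      OF integrand_measurable integrable_weight[OF s] _ _ integrand_le]
  show "continuous_on {w. 0 \<le> Re w \<and> Re w \<le> g} (kint s)"
    unfolding kint_def by (rule strip(1)) (use s good_sub in \<open>auto intro!: continuous_intros holomorphic_intros\<close>)
  show "kint s holomorphic_on {w. 0 < Re w \<and> Re w < g}"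
    unfolding kint_def by (rule strip(2)) (use s good_sub in \<open>auto intro!: continuous_intros holomorphic_intros\<close>)
qed

text \<open>At \<open>w = \<i> * z\<close> this is the jump part of the characteristic exponent; the
  other values continue it to real parts up to \<open>g\<close>.\<close>

definition Psi :: "real \<Rightarrow> complex \<Rightarrow> complex" where
  "Psi u w = (\<integral>s. indicator (good \<inter> {0..u}) s *\<^sub>R kint s w \<partial>lborel)"

lemma kint_measurable: "(\<lambda>s. kint s w) \<in> borel_measurable pos_time"
  unfolding kint_def by (intro measurable_integral_jump_kernel_complex[OF K]) measurable

lemma Psi_integrand_measurable: "(\<lambda>s. indicator (good \<inter> {0..u}) s *\<^sub>R kint s w) \<in> borel_measurable lborel"
  using indicator_measurable_from_pos_time[OF kint_measurable, of "good \<inter> {0..u}"] good_sub by auto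

lemma Psi_integrand_le:
  assumes "0 \<le> Re w" "Re w \<le> g" "norm w \<le> m"
  shows "norm (indicator (good \<inter> {0..u}) s *\<^sub>R kint s w) \<le> bnd m * dom s"
proof -
  have "bnd m \<ge> 0" using order_trans[OF norm_ge_zero assms(3)] by (simp add: bnd_def add_nonneg_nonneg)
  then show ?thesis
    using kint_le[OF _ assms, of s] by (auto simp: indicator_def dom_def)
qed

lemma Psi_continuous: "continuous_on {w. 0 \<le> Re w \<and> Re w \<le> g} (Psi u)"
  and Psi_holomorphic: "Psi u holomorphic_on {w. 0 < Re w \<and> Re w < g}"
proof -
  have cont: "continuous_on {w. 0 \<le> Re w \<and> Re w \<le> g} (\<lambda>z. indicator (good \<inter> {0..u}) s *\<^sub>R kint s z)"
    and hol: "(\<lambda>z. indicator (good \<inter> {0..u}) s *\<^sub>R kint s z) holomorphic_on {w. 0 < Re w \<and> Re w < g}" for s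
    by (cases "s \<in> good"; auto intro!: continuous_intros holomorphic_intros kint_analytic simp: scaleR_conv_of_real)+
  note strip = integral_over_strip[OF Psi_integrand_measurable integrable_dom cont hol Psi_integrand_le]
  show "continuous_on {w. 0 \<le> Re w \<and> Re w \<le> g} (Psi u)" unfolding Psi_def by (rule strip(1)) auto
  show "Psi u holomorphic_on {w. 0 < Re w \<and> Re w < g}" unfolding Psi_def by (rule strip(2)) auto
qed

end

section \<open>Real arguments and exponential moments\<close>

context exp_jump_kernel
begin

definition cumulant :: "real \<Rightarrow> real \<Rightarrow> real" where
  "cumulant c s = (\<integral>x. exp (c * x) - 1 - c * x \<partial>K s)"

lemma kint_of_real: "kint s (of_real c) = of_real (cumulant c s)"
proof -
  have "kint s (of_real c) = (\<integral>x. complex_of_real (exp (c * x) - 1 - c * x) \<partial>K s)"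
    unfolding kint_def by (intro Bochner_Integration.integral_cong refl) (simp add: exp_of_real[symmetric])
  then show ?thesis unfolding cumulant_def by (simp only: integral_complex_of_real)
qed

lemma set_integrable_cumulant:
  assumes c: "0 \<le> c" "c \<le> g"
  shows "set_integrable lborel {0..t} (cumulant c)"
proof -
  have m: "(\<lambda>s. indicator {0..t} s *\<^sub>R cumulant c s) \<in> borel_measurable lborel"
    using indicator_measurable_from_pos_time[of "cumulant c" "{0..t}"]
    unfolding cumulant_def[abs_def] by (simp add: measurable_integral_jump_kernel_real[OF K])
  show ?thesis
    unfolding set_integrable_def
  proof (rule Bochner_Integration.integrable_bound[OF integrable_mult_right[OF integrable_dom, of "bnd c"] m])
    show "AE s in lborel. norm (indicator {0..t} s *\<^sub>R cumulant c s) \<le> norm (bnd c * local.dom s)"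
      using AE_good
    proof eventually_elim
      case (elim s)
      show ?case
      proof (cases "s \<in> {0..t}")
        case True
        with elim have "norm (kint s (of_real c)) \<le> bnd c * local.dom s" using c by (intro kint_le) auto
        then show ?thesis using True by (auto simp: kint_of_real intro: order_trans[OF _ abs_ge_self])
      qed auto
    qed
  qed
qed

lemma Psi_eq_set_integral:
  assumes "u \<le> t"
  shows "Psi u w = (CLINT s:{0..u}|lborel. kint s w)"
  unfolding Psi_def set_lebesgue_integral_def
proof (rule integral_cong_AE[OF Psi_integrand_measurable])
  show "(\<lambda>s. indicat_real {0..u} s *\<^sub>R kint s w) \<in> borel_measurable lborel"
    using indicator_measurable_from_pos_time[OF kint_measurable, of "{0..u}"] by auto
  show "AE s in lborel. indicat_real (good \<inter> {0..u}) s *\<^sub>R kint s w = indicat_real {0..u} s *\<^sub>R kint s w"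
    using AE_good by eventually_elim (use assms in \<open>auto simp: indicator_def\<close>)
qed

lemma Psi_of_real:
  assumes "u \<le> t"
  shows "Psi u (of_real c) = of_real (LBINT s:{0..u}. cumulant c s)"
proof -
  have "Psi u (of_real c) = (\<integral>s. complex_of_real (indicator {0..u} s *\<^sub>R cumulant c s) \<partial>lborel)"
    unfolding Psi_eq_set_integral[OF assms] set_lebesgue_integral_def kint_of_real
    by (intro Bochner_Integration.integral_cong refl) (simp add: scaleR_conv_of_real)
  then show ?thesis unfolding set_lebesgue_integral_def by (simp only: integral_complex_of_real)
qed

text \<open>\<open>L\<close> continues the characteristic function, so
  \<open>laplace_transform_of_analytic_extension\<close> gives the moments of order below
  \<open>g\<close>. At \<open>g\<close> itself, Fatou's lemma yields integrability and dominated
  convergence the value.\<close>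

lemma exponential_moment:
  fixes M :: "'a measure" and Z :: "'a \<Rightarrow> real" and B' C' :: real
  assumes M: "prob_space M" and Z: "Z \<in> borel_measurable M" and u: "u \<le> t"
    and char: "\<And>z::real. (CLINT \<omega>|M. iexp (z * Z \<omega>)) =
        exp (\<i> * z * B' - z\<^sup>2 * C' / 2 +
             (CLINT s:{0..u}|lborel. (CLINT x|K s. iexp (z * x) - 1 - \<i> * z * x)))"
    and c: "0 \<le> c" "c \<le> g"
  shows "integrable M (\<lambda>\<omega>. exp (c * Z \<omega>))" (is ?int)
    and "(\<integral>\<omega>. exp (c * Z \<omega>) \<partial>M) = exp (c * B' + c\<^sup>2 * C' / 2 + (LBINT s:{0..u}. cumulant c s))" (is ?eq)
proof -
  interpret prob_space M by fact
  \<comment> \<open>The Gaussian term has a plus sign because \<open>w\<close> stands for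
    \<open>\<i> * z\<close>, whose square is negative.\<close>
  define L where "L = (\<lambda>w::complex. exp (w * of_real B' + w\<^sup>2 * of_real C' / 2 + Psi u w))"
  define l where "l = (\<lambda>c. exp (c * B' + c\<^sup>2 * C' / 2 + (LBINT s:{0..u}. cumulant c s)))"
  have Ll: "L (of_real c) = of_real (l c)" for c
    unfolding L_def l_def Psi_of_real[OF u] by (simp add: exp_of_real[symmetric])
  have Lcont: "continuous_on {w. 0 \<le> Re w \<and> Re w \<le> g} L"
    unfolding L_def by (intro continuous_intros Psi_continuous) auto
  have Lhol: "L holomorphic_on {w. 0 < Re w \<and> Re w < g}"
    unfolding L_def by (intro holomorphic_intros Psi_holomorphic) auto
  have "prob_space (distr M borel Z)" by (rule prob_space_distr[OF Z])
  then have D: "finite_measure (distr M borel Z)" by (simp add: prob_space_def)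
  have ch: "(\<integral>x. exp (w * of_real x) \<partial>distr M borel Z) = L w" if "Re w = 0" for w
  proof -
    define z where "z = Im w"
    have w: "w = \<i> * of_real z" using that by (auto simp: z_def complex_eq_iff)
    have "(\<integral>x. exp (w * of_real x) \<partial>distr M borel Z) = (CLINT \<omega>|M. iexp (z * Z \<omega>))"
      using Z by (subst integral_distr) (auto simp: w mult.assoc)
    also have "\<dots> = exp (\<i> * z * B' - z\<^sup>2 * C' / 2 + Psi u w)"
      unfolding char Psi_eq_set_integral[OF u] kint_def by (simp add: w mult.assoc)
    also have "\<dots> = L w" by (simp add: L_def w power_mult_distrib)
    finally show ?thesis .
  qed
  have lt: "integrable M (\<lambda>\<omega>. exp (c * Z \<omega>)) \<and> (\<integral>\<omega>. exp (c * Z \<omega>) \<partial>M) = l c" if "0 < c" "c < g" for c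
  proof -
    note ext = laplace_transform_of_analytic_extension[OF D _ _ Lhol ch that]
    have "continuous_on {w. 0 \<le> Re w \<and> Re w < g} L"
      by (rule continuous_on_subset[OF Lcont]) auto
    note ext = ext[OF _ this]
    have "integrable (distr M borel Z) (\<lambda>x. exp (c * x))" by (rule ext(1)) simp
    then have 1: "integrable M (\<lambda>\<omega>. exp (c * Z \<omega>))" using Z by (subst (asm) integrable_distr_eq) auto
    have "complex_of_real (\<integral>x. exp (c * x) \<partial>distr M borel Z) = of_real (l c)"
      unfolding Ll[symmetric] by (rule ext(2)) simp
    then have "(\<integral>x. exp (c * x) \<partial>distr M borel Z) = l c" by (simp only: of_real_eq_iff)
    then have "(\<integral>\<omega>. exp (c * Z \<omega>) \<partial>M) = l c" using Z by (subst (asm) integral_distr) auto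
    with 1 show ?thesis by blast
  qed
  \<comment> \<open>The shift by 2 makes \<open>d 0 = g / 2\<close> positive, so that all
    \<open>d n\<close> lie in the open strip.\<close>
  define d where "d = (\<lambda>n. g * (1 - 1 / real (n + 2)))"
  have d: "0 < d n" "d n < g" for n
  proof -
    have "0 < 1 / real (n + 2)" "1 / real (n + 2) < 1" by simp_all
    then show "0 < d n" "d n < g" unfolding d_def using g by (simp_all only: zero_less_mult_iff mult_less_cancel_left1) auto
  qed
  have "(\<lambda>n. 1 / real (n + 2)) \<longlonglongrightarrow> 0"
    using LIMSEQ_ignore_initial_segment[OF lim_1_over_n, of 2] by simp
  then have "d \<longlonglongrightarrow> g * (1 - 0)" unfolding d_def by (intro tendsto_intros)
  then have dlim: "d \<longlonglongrightarrow> g" by simp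
  have llim: "(\<lambda>n. l (d n)) \<longlonglongrightarrow> l g"
  proof -
    have "(\<lambda>n. complex_of_real (d n)) \<longlonglongrightarrow> of_real g" by (intro tendsto_of_real dlim)
    then have "(L \<circ> (\<lambda>n. complex_of_real (d n))) \<longlonglongrightarrow> L (of_real g)"
      using Lcont d g unfolding continuous_on_sequentially by (auto simp: less_imp_le)
    then have "(\<lambda>n. complex_of_real (l (d n))) \<longlonglongrightarrow> of_real (l g)" by (simp add: o_def Ll)
    then show ?thesis by (simp only: tendsto_of_real_iff)
  qed
  have elim: "(\<lambda>n. exp (d n * Z \<omega>)) \<longlonglongrightarrow> exp (g * Z \<omega>)" for \<omega>
    by (intro tendsto_intros dlim)
  \<comment> \<open>Fatou's lemma along \<open>d n\<close>: the integrals are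
    \<open>l (d n)\<close>, and they converge to the finite number \<open>l g\<close> since
    \<open>L\<close> is continuous on the closed strip.\<close>
  have gint: "integrable M (\<lambda>\<omega>. exp (g * Z \<omega>))"
  proof -
    have "(\<integral>\<^sup>+\<omega>. ennreal (exp (g * Z \<omega>)) \<partial>M) = (\<integral>\<^sup>+\<omega>. liminf (\<lambda>n. ennreal (exp (d n * Z \<omega>))) \<partial>M)"
    proof (intro nn_integral_cong)
      fix \<omega>
      have "(\<lambda>n. ennreal (exp (d n * Z \<omega>))) \<longlonglongrightarrow> ennreal (exp (g * Z \<omega>))" by (intro tendsto_ennrealI elim)
      then show "ennreal (exp (g * Z \<omega>)) = liminf (\<lambda>n. ennreal (exp (d n * Z \<omega>)))"
        by (rule lim_imp_Liminf[OF sequentially_bot, symmetric])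
    qed
    also have "\<dots> \<le> liminf (\<lambda>n. \<integral>\<^sup>+\<omega>. ennreal (exp (d n * Z \<omega>)) \<partial>M)"
      using Z by (intro nn_integral_liminf) measurable
    also have "(\<lambda>n. \<integral>\<^sup>+\<omega>. ennreal (exp (d n * Z \<omega>)) \<partial>M) = (\<lambda>n. ennreal (l (d n)))"
      using lt[OF d] by (auto simp: nn_integral_eq_integral)
    also have "liminf (\<lambda>n. ennreal (l (d n))) = ennreal (l g)"
      by (intro lim_imp_Liminf tendsto_ennrealI llim) simp
    finally have "(\<integral>\<^sup>+\<omega>. ennreal (exp (g * Z \<omega>)) \<partial>M) < \<infinity>" by (simp add: le_less_trans)
    then show ?thesis using Z by (auto simp: integrable_iff_bounded)
  qed
  have "(\<lambda>n. \<integral>\<omega>. exp (d n * Z \<omega>) \<partial>M) \<longlonglongrightarrow> (\<integral>\<omega>. exp (g * Z \<omega>) \<partial>M)"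
  proof (rule integral_dominated_convergence)
    \<comment> \<open>The constant 1 covers \<open>Z \<omega> < 0\<close>, where the smaller
      exponents \<open>d n\<close> give the larger values.\<close>
    show "integrable M (\<lambda>\<omega>. 1 + exp (g * Z \<omega>))" using gint by simp
    show "AE \<omega> in M. norm (exp (d n * Z \<omega>)) \<le> 1 + exp (g * Z \<omega>)" for n
    proof (rule AE_I2)
      fix \<omega>
      show "norm (exp (d n * Z \<omega>)) \<le> 1 + exp (g * Z \<omega>)"
      proof (cases "Z \<omega> \<ge> 0")
        case True
        then have "exp (d n * Z \<omega>) \<le> exp (g * Z \<omega>)" using d[of n] by (auto intro: mult_right_mono)
        then show ?thesis unfolding real_norm_def abs_exp_cancel by linarith
      next
        case False
        then have "exp (d n * Z \<omega>) \<le> 1" using d[of n] by (auto simp: mult_nonneg_nonpos)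
        then show ?thesis unfolding real_norm_def abs_exp_cancel by (simp add: add_increasing2)
      qed
    qed
  qed (use Z elim in auto)
  then have "(\<lambda>n. l (d n)) \<longlonglongrightarrow> (\<integral>\<omega>. exp (g * Z \<omega>) \<partial>M)" using lt[OF d] by simp
  then have gl: "(\<integral>\<omega>. exp (g * Z \<omega>) \<partial>M) = l g" using llim LIMSEQ_unique by blast
  have "integrable M (\<lambda>\<omega>. exp (c * Z \<omega>)) \<and> (\<integral>\<omega>. exp (c * Z \<omega>) \<partial>M) = l c"
  proof -
    consider "c = 0" | "0 < c" "c < g" | "c = g" using c by linarith
    then show ?thesis
    proof cases
      case 1
      then show ?thesis by (simp add: l_def cumulant_def prob_space)
    qed (use lt gint gl in auto)
  qed
  then show ?int ?eq by (auto simp: l_def)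
qed

end

subsection \<open>Processes with independent increments\<close>

lemma integrable_indicator_Icc: "integrable lborel (\<lambda>u. indicator {a..b} u *\<^sub>R c)" for a b c :: real
  by (intro integrable_scaleR_left impI integrable_real_indicator) (auto simp: emeasure_lborel_Icc_eq)

locale pii =
  fixes M :: "'a measure" and X :: "real \<Rightarrow> 'a \<Rightarrow> real"
  assumes pii: "independent_increments_process M X"
begin

sublocale prob_space M
  using pii by (simp add: independent_increments_process_def)

lemma rv [measurable]: "u \<ge> 0 \<Longrightarrow> X u \<in> borel_measurable M"
  using pii by (simp add: independent_increments_process_def)

lemma path: "\<omega> \<in> space M \<Longrightarrow> cadlag_path (\<lambda>u. X u \<omega>)"
  using pii by (simp add: independent_increments_process_def cadlag_process_def cadlag_path_def)

lemma X_0: "\<omega> \<in> space M \<Longrightarrow> X 0 \<omega> = 0"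
  using pii by (simp add: independent_increments_process_def)

lemma past_sets:
  assumes "0 \<le> u" "u \<le> s" "A \<in> sets borel"
  shows "X u -` A \<inter> space M \<in> sets (natural_filtration M X s)"
  unfolding natural_filtration_def using assms by (intro in_measure_of UN_I[of u]) auto

lemma space_natural_filtration: "space (natural_filtration M X s) = space M"
  unfolding natural_filtration_def by (rule space_measure_of) auto

lemma past_rv:
  assumes "0 \<le> u" "u \<le> s"
  shows "X u \<in> borel_measurable (natural_filtration M X s)"
proof (rule measurableI)
  show "X u -` A \<inter> space (natural_filtration M X s) \<in> sets (natural_filtration M X s)" if "A \<in> sets borel" for A
    unfolding space_natural_filtration using assms that by (rule past_sets)
qed simp

lemma prob_past_increment:
  assumes "0 \<le> s" "s \<le> u" "E \<in> sets (natural_filtration M X s)" "A \<in> sets borel"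
  shows "prob (E \<inter> ((\<lambda>\<omega>. X u \<omega> - X s \<omega>) -` A \<inter> space M)) =
    prob E * prob ((\<lambda>\<omega>. X u \<omega> - X s \<omega>) -` A \<inter> space M)"
proof (rule indep_setD)
  show "indep_set (sets (natural_filtration M X s)) (sets (vimage_algebra (space M) (\<lambda>\<omega>. X u \<omega> - X s \<omega>) borel))"
    using pii assms by (simp add: independent_increments_process_def)
  show "(\<lambda>\<omega>. X u \<omega> - X s \<omega>) -` A \<inter> space M \<in> sets (vimage_algebra (space M) (\<lambda>\<omega>. X u \<omega> - X s \<omega>) borel)"
    using assms(4) by (rule in_vimage_algebra)
qed (rule assms(3))

text \<open>By definition one increment is independent of its past; peeling off the increment with
  the largest index turns this into joint independence. Since \<open>mono\<close> admits repeated
  times, a finite list of times can be continued as a constant sequence.\<close>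

lemma indep_increments:
  fixes \<tau> :: "nat \<Rightarrow> real"
  assumes \<tau>: "mono \<tau>" "\<tau> 0 \<ge> 0"
  shows "indep_vars (\<lambda>_. borel) (\<lambda>j \<omega>. X (\<tau> (Suc j)) \<omega> - X (\<tau> j) \<omega>) UNIV"
proof -
  have pos: "\<tau> j \<ge> 0" for j using \<tau> by (meson le0 monoD order_trans)
  define d where "d = (\<lambda>j \<omega>. X (\<tau> (Suc j)) \<omega> - X (\<tau> j) \<omega>)"
  have d: "d j \<in> borel_measurable M" for j unfolding d_def using pos by measurable
  have "indep_sets (\<lambda>j. {d j -` A \<inter> space M |A. A \<in> sets borel}) UNIV"
  proof (rule indep_setsI)
    show "{d j -` A \<inter> space M |A. A \<in> sets borel} \<subseteq> events" for j
      using d by (auto intro: measurable_sets)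
    fix A and J :: "nat set"
    assume J: "J \<noteq> {}" "finite J" and A: "\<forall>j\<in>J. A j \<in> {d j -` A \<inter> space M |A. A \<in> sets borel}"
    \<comment> \<open>Intersecting with \<open>space M\<close> gives the empty family the value
      \<open>space M\<close> instead of \<open>UNIV\<close>, so that the induction can start
      there.\<close>
    have "prob (space M \<inter> (\<Inter>j\<in>J. A j)) = (\<Prod>j\<in>J. prob (A j))"
      using J(2) A
    proof (induction J rule: finite_linorder_max_induct)
      case empty
      then show ?case by (simp add: prob_space)
    next
      case (insert m J)
      from insert.prems obtain B where B: "B \<in> sets borel" "A m = d m -` B \<inter> space M" by auto
      have past: "A j \<in> sets (natural_filtration M X (\<tau> m))" if "j \<in> J" for j
      proof -
        have jJ: "j \<in> insert m J" using that by simp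
        have "j < m" using insert.hyps(2) that by auto
        then have "\<tau> j \<le> \<tau> m" "\<tau> (Suc j) \<le> \<tau> m" using \<tau>(1) by (auto intro: monoD)
        then have "d j \<in> borel_measurable (natural_filtration M X (\<tau> m))"
          unfolding d_def using pos by (intro borel_measurable_diff past_rv)
        moreover obtain B' where "B' \<in> sets borel" "A j = d j -` B' \<inter> space M"
          using bspec[OF insert.prems jJ] unfolding mem_Collect_eq by (elim exE conjE) (rule that)
        ultimately show ?thesis using measurable_sets[of "d j" "natural_filtration M X (\<tau> m)" borel B'] by (simp add: space_natural_filtration)
      qed
      have "space M \<in> sets (natural_filtration M X (\<tau> m))"
        using sets.top[of "natural_filtration M X (\<tau> m)"] by (simp add: space_natural_filtration)
      then have "space M \<inter> (\<Inter>j\<in>J. A j) \<in> sets (natural_filtration M X (\<tau> m))"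
        using insert.hyps(1) past
        by (cases "J = {}") (auto intro!: sets.Int sets.finite_INT)
      then have "prob ((space M \<inter> (\<Inter>j\<in>J. A j)) \<inter> A m) = prob (space M \<inter> (\<Inter>j\<in>J. A j)) * prob (A m)"
        unfolding B(2) d_def using pos B(1) \<tau>(1) by (intro prob_past_increment) (auto intro: monoD)
      also have "prob (space M \<inter> (\<Inter>j\<in>J. A j)) = (\<Prod>j\<in>J. prob (A j))"
        using insert.IH insert.prems by auto
      finally have "prob ((space M \<inter> (\<Inter>j\<in>J. A j)) \<inter> A m) = (\<Prod>j\<in>J. prob (A j)) * prob (A m)" .
      moreover have "(space M \<inter> (\<Inter>j\<in>J. A j)) \<inter> A m = space M \<inter> (\<Inter>j\<in>insert m J. A j)" by auto
      moreover have "m \<notin> J" using insert.hyps(2) by auto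
      ultimately show ?case using insert.hyps(1) by (simp add: mult.commute)
    qed
    moreover have "space M \<inter> (\<Inter>j\<in>J. A j) = (\<Inter>j\<in>J. A j)" using J A by fastforce
    ultimately show "prob (\<Inter>j\<in>J. A j) = (\<Prod>j\<in>J. prob (A j))" by simp
  qed
  then show ?thesis unfolding indep_vars_def2 using d by (simp add: d_def)
qed

section \<open>The integrand of the exponential functional and its tail integral\<close>

definition V :: "real \<Rightarrow> 'a \<Rightarrow> real" where
  "V u \<omega> = indicator {0..} u * exp (- X u \<omega>)"

text \<open>Right continuity makes the map a limit of functions that are constant in time between
  grid points; each of these is jointly measurable because there are only countably many cells. The
  indicator in \<open>V\<close> removes negative times, where nothing is assumed of
  \<open>X\<close>.\<close>

lemma V_measurable [measurable]: "(\<lambda>(\<omega>, u). V u \<omega>) \<in> borel_measurable (M \<Otimes>\<^sub>M lborel)"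
proof (rule borel_measurable_LIMSEQ_real)
  define f where "f = (\<lambda>n (i::int) \<omega>. indicator {0..} i * exp (- X ((of_int i + 1) / real (Suc n)) \<omega>))"
  define h where "h = (\<lambda>n (\<omega>::'a, u::real). indicator {0..} u * f n \<lfloor>u * real (Suc n)\<rfloor> \<omega>)"
  have f: "f n i \<in> borel_measurable M" for n i
    by (cases "i \<ge> 0") (auto simp: f_def intro!: borel_measurable_exp borel_measurable_uminus rv)
  have "(\<lambda>p. f n \<lfloor>snd p * real (Suc n)\<rfloor> (fst p)) \<in> borel_measurable (M \<Otimes>\<^sub>M lborel)" for n
    by (rule measurable_compose_countable[where g="\<lambda>p. \<lfloor>snd p * real (Suc n)\<rfloor>"])
      (auto intro!: measurable_compose[OF measurable_fst f], measurable)
  then show "h n \<in> borel_measurable (M \<Otimes>\<^sub>M lborel)" for n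
    unfolding h_def by (simp add: case_prod_beta)
  fix p :: "'a \<times> real" assume "p \<in> space (M \<Otimes>\<^sub>M lborel)"
  then obtain \<omega> u where p: "p = (\<omega>, u)" "\<omega> \<in> space M" by (auto simp: space_pair_measure)
  show "(\<lambda>n. h n p) \<longlonglongrightarrow> (case p of (\<omega>, u) \<Rightarrow> V u \<omega>)"
  proof (cases "u \<ge> 0")
    case True
    then have "h n p = exp (- X (grid_right 0 n u) \<omega>)" for n
      by (simp add: h_def p f_def grid_right_def)
    then show ?thesis
      using True cadlag_path_grid_tendsto[OF path[OF p(2)] True, of 0]
      by (simp add: p V_def tendsto_exp tendsto_minus)
  qed (simp add: p h_def V_def)
qed

lemma V_path_measurable [measurable]: "\<omega> \<in> space M \<Longrightarrow> (\<lambda>u. V u \<omega>) \<in> borel_measurable borel"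
  using measurable_compose[OF measurable_Pair1' V_measurable, of \<omega>] by simp

lemma V_pos: "u \<ge> 0 \<Longrightarrow> V u \<omega> > 0" and V_nonneg: "V u \<omega> \<ge> 0"
  by (auto simp: V_def)

lemma V_bounded:
  assumes "\<omega> \<in> space M"
  obtains B where "B > 0" "\<And>u. u \<in> {0..T} \<Longrightarrow> V u \<omega> \<le> B"
proof -
  obtain B where B: "B > 0" "\<And>u. u \<in> {0..T} \<Longrightarrow> \<bar>X u \<omega>\<bar> \<le> B"
    using cadlag_path_bounded[OF path[OF assms], of 0 T] by auto
  have "V u \<omega> \<le> exp B" if "u \<in> {0..T}" for u using B(2)[OF that] that by (auto simp: V_def)
  then show ?thesis using that[of "exp B"] by auto
qed

lemma V_set_integrable:
  assumes "\<omega> \<in> space M" "0 \<le> s"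
  shows "set_integrable lborel {s..T} (\<lambda>u. V u \<omega>)"
proof -
  obtain B where B: "\<And>u. u \<in> {0..T} \<Longrightarrow> V u \<omega> \<le> B" using V_bounded[OF assms(1)] by metis
  have "integrable lborel (\<lambda>u. indicator {s..T} u *\<^sub>R B)" by (rule integrable_indicator_Icc)
  then show ?thesis
    unfolding set_integrable_def
  proof (rule Bochner_Integration.integrable_bound)
    show "AE u in lborel. norm (indicator {s..T} u *\<^sub>R V u \<omega>) \<le> norm (indicator {s..T} u *\<^sub>R B)"
    proof (rule AE_I2)
      fix u
      show "norm (indicator {s..T} u *\<^sub>R V u \<omega>) \<le> norm (indicator {s..T} u *\<^sub>R B)"
        using B[of u] V_nonneg[of u \<omega>] assms(2) by (auto simp: indicator_def)
    qed
  qed (use assms in measurable)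
qed

definition Y :: "real \<Rightarrow> real \<Rightarrow> 'a \<Rightarrow> real" where
  "Y T s \<omega> = (LBINT u:{s..T}. V u \<omega>)"

lemma Y_measurable [measurable]: "Y T s \<in> borel_measurable M"
proof -
  have "(\<lambda>p. indicator {s..T} (snd p) *\<^sub>R (case p of (\<omega>, u) \<Rightarrow> V u \<omega>)) \<in> borel_measurable (M \<Otimes>\<^sub>M lborel)"
    by measurable
  then have "(\<lambda>(\<omega>, u). indicator {s..T} u *\<^sub>R V u \<omega>) \<in> borel_measurable (M \<Otimes>\<^sub>M lborel)"
    by (simp add: case_prod_beta)
  then show ?thesis
    unfolding Y_def set_lebesgue_integral_def by (rule lborel.borel_measurable_lebesgue_integral)
qed

lemma V_integrable_on: "\<omega> \<in> space M \<Longrightarrow> 0 \<le> s \<Longrightarrow> (\<lambda>u. V u \<omega>) integrable_on {s..T}"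
  by (rule set_borel_integral_eq_integral(1)[OF V_set_integrable])

lemma Y_eq_integral: "\<omega> \<in> space M \<Longrightarrow> 0 \<le> s \<Longrightarrow> Y T s \<omega> = integral {s..T} (\<lambda>u. V u \<omega>)"
  unfolding Y_def by (rule set_borel_integral_eq_integral(2)[OF V_set_integrable])

lemma Y_antimono:
  assumes "\<omega> \<in> space M" "0 \<le> s" "s \<le> r"
  shows "Y T r \<omega> \<le> Y T s \<omega>"
  using assms unfolding Y_eq_integral[OF assms(1,2)] Y_eq_integral[OF assms(1) order_trans[OF assms(2,3)]]
  by (intro integral_subset_le V_integrable_on) (auto simp: V_nonneg)

lemma Y_pos:
  assumes "\<omega> \<in> space M" "0 \<le> s" "s < T"
  shows "Y T s \<omega> > 0"
proof -
  have "Y T s \<omega> \<noteq> 0"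
  proof
    assume "Y T s \<omega> = 0"
    then have "AE u in lborel. indicator {s..T} u *\<^sub>R V u \<omega> = 0"
      using V_set_integrable[OF assms(1,2)] V_nonneg
      unfolding Y_def set_lebesgue_integral_def set_integrable_def
      by (subst (asm) integral_nonneg_eq_0_iff_AE) auto
    then have "AE u in lborel. u \<notin> {s..T}"
    proof eventually_elim
      case (elim u)
      show ?case
      proof
        assume u: "u \<in> {s..T}"
        then have "V u \<omega> > 0" using assms(2) by (intro V_pos) auto
        with elim u show False by simp
      qed
    qed
    then have "emeasure lborel {s..T} = 0"
      by (subst (asm) AE_iff_measurable[of "{s..T}"]) auto
    then show False using assms by simp
  qed
  moreover have "Y T s \<omega> \<ge> 0"
    unfolding Y_def set_lebesgue_integral_def using V_nonneg by (intro Bochner_Integration.integral_nonneg) auto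
  ultimately show ?thesis by simp
qed

end

text \<open>Right Riemann sum, with mesh \<open>1/(n+1)\<close>, of the exponential functional over a time interval of
  length \<open>L\<close>, as a function of the sequence of increments over the mesh.\<close>

definition step_functional :: "real \<Rightarrow> nat \<Rightarrow> (nat \<Rightarrow> real) \<Rightarrow> real" where
  "step_functional L n d = (LBINT v:{0..L}. exp (- (\<Sum>i\<le>nat \<lfloor>v * real (Suc n)\<rfloor>. d i)))"

lemma step_functional_measurable [measurable]:
  "step_functional L n \<in> borel_measurable (PiM UNIV (\<lambda>_. borel))"
proof -
  let ?P = "PiM UNIV (\<lambda>_. borel) :: (nat \<Rightarrow> real) measure"
  have "(\<lambda>p. (\<lambda>i p. exp (- (\<Sum>j\<le>i. fst p j))) (nat \<lfloor>snd p * real (Suc n)\<rfloor>) p) \<in> borel_measurable (?P \<Otimes>\<^sub>M lborel)"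
  proof (rule measurable_compose_countable[where g="\<lambda>p. nat \<lfloor>snd p * real (Suc n)\<rfloor>"])
    have "(\<lambda>d. d j) \<in> borel_measurable ?P" for j by (rule measurable_component_singleton) simp
    then have [measurable]: "(\<lambda>p. fst p j) \<in> borel_measurable (?P \<Otimes>\<^sub>M lborel)" for j
      using measurable_compose[OF measurable_fst] by blast
    show "(\<lambda>p. exp (- (\<Sum>j\<le>i. fst p j))) \<in> borel_measurable (?P \<Otimes>\<^sub>M lborel)" for i by measurable
  qed measurable
  then have "(\<lambda>p. indicator {0..L} (snd p) *\<^sub>R exp (- (\<Sum>j\<le>nat \<lfloor>snd p * real (Suc n)\<rfloor>. fst p j)))
      \<in> borel_measurable (?P \<Otimes>\<^sub>M lborel)"
    by (intro borel_measurable_scaleR) auto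
  then have "(\<lambda>(d, v). indicator {0..L} v *\<^sub>R exp (- (\<Sum>j\<le>nat \<lfloor>v * real (Suc n)\<rfloor>. d j)))
      \<in> borel_measurable (?P \<Otimes>\<^sub>M lborel)"
    by (simp add: case_prod_beta)
  then show ?thesis
    unfolding step_functional_def set_lebesgue_integral_def by (rule lborel.borel_measurable_lebesgue_integral)
qed

section \<open>Approximation of \<open>J\<close> by functions of increments\<close>

context pii
begin

text \<open>The functional of the process restarted at \<open>s\<close>. With \<open>X s\<close> in
  place of the left limit it depends only on increments after \<open>s\<close>.\<close>

definition J :: "real \<Rightarrow> real \<Rightarrow> 'a \<Rightarrow> real" where
  "J T s \<omega> = exp (X s \<omega>) * Y T s \<omega>"

lemma J_measurable [measurable]: "0 \<le> s \<Longrightarrow> J T s \<in> borel_measurable M"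
  unfolding J_def by measurable

lemma J_pos: "\<omega> \<in> space M \<Longrightarrow> 0 \<le> s \<Longrightarrow> s < T \<Longrightarrow> J T s \<omega> > 0"
  by (simp add: J_def Y_pos)

lemma J_eq:
  assumes "0 \<le> s"
  shows "J T s \<omega> = (LBINT u:{s..T}. exp (- (X u \<omega> - X s \<omega>)))"
proof -
  have "J T s \<omega> = (LBINT u:{s..T}. exp (X s \<omega>) * V u \<omega>)" by (simp add: J_def Y_def)
  also have "\<dots> = (LBINT u:{s..T}. exp (- (X u \<omega> - X s \<omega>)))"
    using assms by (intro set_lebesgue_integral_cong) (auto simp: V_def exp_diff exp_minus field_simps)
  finally show ?thesis .
qed

definition inc :: "real \<Rightarrow> nat \<Rightarrow> nat \<Rightarrow> 'a \<Rightarrow> real" where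
  "inc s n j \<omega> = X (s + real (Suc j) / real (Suc n)) \<omega> - X (s + real j / real (Suc n)) \<omega>"

lemma inc_measurable [measurable]: "0 \<le> s \<Longrightarrow> inc s n j \<in> borel_measurable M"
  unfolding inc_def by (intro borel_measurable_diff rv) auto

lemma sum_inc: "(\<Sum>i\<le>j. inc s n i \<omega>) = X (s + real (Suc j) / real (Suc n)) \<omega> - X s \<omega>"
  by (induction j) (simp_all add: inc_def)

text \<open>Right continuity gives convergence of the integrand at every time, and boundedness of
  the path on a slightly longer interval gives domination.\<close>

lemma step_functional_tendsto:
  assumes \<omega>: "\<omega> \<in> space M" and s: "0 \<le> s" "s \<le> T"
  shows "(\<lambda>n. step_functional (T - s) n (\<lambda>j. inc s n j \<omega>)) \<longlonglongrightarrow> J T s \<omega>"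
proof -
  \<comment> \<open>Cell \<open>j\<close> sums the \<open>j + 1\<close> increments with indices up
    to \<open>j\<close>, so the path is read at the right end of the cell, which is
    \<open>grid_right\<close>.\<close>
  have grid: "s + real (Suc (nat \<lfloor>v * real (Suc n)\<rfloor>)) / real (Suc n) = grid_right s n (s + v)" if "v \<ge> 0" for v n
    using that by (simp add: grid_right_def)
  define f where "f = (\<lambda>n v. indicator {0..T - s} v *\<^sub>R exp (- (\<Sum>i\<le>nat \<lfloor>v * real (Suc n)\<rfloor>. inc s n i \<omega>)))"
  have feq: "f n v = indicator {0..T - s} v * (exp (X s \<omega>) * V (grid_right s n (s + v)) \<omega>)" for n v
  proof (cases "v \<in> {0..T - s}")
    case True
    then have "grid_right s n (s + v) \<ge> 0" using grid_right_gt[of "s + v" s n] s by simp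
    moreover have "(\<Sum>i\<le>nat \<lfloor>v * real (Suc n)\<rfloor>. inc s n i \<omega>) = X (grid_right s n (s + v)) \<omega> - X s \<omega>"
      using True by (simp only: sum_inc grid atLeastAtMost_iff)
    ultimately show ?thesis using True by (simp only: f_def V_def) (simp add: mult_exp_exp)
  qed (simp add: f_def)
  \<comment> \<open>Grid points may lie beyond \<open>T\<close>, but by at most 1.\<close>
  obtain B where B: "\<And>u. u \<in> {0..T + 1} \<Longrightarrow> V u \<omega> \<le> B" using V_bounded[OF \<omega>] by metis
  have "(\<lambda>n. \<integral>v. f n v \<partial>lborel) \<longlonglongrightarrow> (\<integral>v. indicator {0..T - s} v * (exp (X s \<omega>) * V (s + v) \<omega>) \<partial>lborel)"
  proof (rule integral_dominated_convergence)
    show "integrable lborel (\<lambda>v. indicator {0..T - s} v *\<^sub>R (exp (X s \<omega>) * B))" by (rule integrable_indicator_Icc)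
    show "AE v in lborel. (\<lambda>n. f n v) \<longlonglongrightarrow> indicator {0..T - s} v * (exp (X s \<omega>) * V (s + v) \<omega>)"
    proof (rule AE_I2)
      fix v
      show "(\<lambda>n. f n v) \<longlonglongrightarrow> indicator {0..T - s} v * (exp (X s \<omega>) * V (s + v) \<omega>)"
      proof (cases "v \<ge> 0")
        case True
        then have p: "s + v \<ge> 0" using s by simp
        have "V (grid_right s n (s + v)) \<omega> = exp (- X (grid_right s n (s + v)) \<omega>)" for n
          using grid_right_gt[of "s + v" s n] p by (simp add: V_def)
        then have "(\<lambda>n. V (grid_right s n (s + v)) \<omega>) \<longlonglongrightarrow> V (s + v) \<omega>"
          using p cadlag_path_grid_tendsto[OF path[OF \<omega>] p, of s]
          by (simp add: V_def tendsto_exp tendsto_minus)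
        then show ?thesis unfolding feq by (intro tendsto_mult tendsto_const)
      qed (simp add: feq)
    qed
    show "AE v in lborel. norm (f n v) \<le> indicator {0..T - s} v *\<^sub>R (exp (X s \<omega>) * B)" for n
    proof (rule AE_I2)
      fix v
      show "norm (f n v) \<le> indicator {0..T - s} v *\<^sub>R (exp (X s \<omega>) * B)"
      proof (cases "v \<in> {0..T - s}")
        case True
        have "1 / real (Suc n) \<le> 1" by simp
        then have "grid_right s n (s + v) \<le> s + v + 1" using grid_right_le[of s n "s + v"] by linarith
        then have "grid_right s n (s + v) \<in> {0..T + 1}"
          using True grid_right_gt[of "s + v" s n] s by auto
        then show ?thesis unfolding feq using True B V_nonneg by simp
      qed (simp add: feq)
    qed
    have [measurable]: "(\<lambda>u. V u \<omega>) \<in> borel_measurable borel" by (rule V_path_measurable[OF \<omega>])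
    show "f n \<in> borel_measurable lborel" for n
      unfolding feq[abs_def] by measurable
    show "(\<lambda>v. indicator {0..T - s} v * (exp (X s \<omega>) * V (s + v) \<omega>)) \<in> borel_measurable lborel"
      by measurable
  qed
  moreover have "(\<integral>v. f n v \<partial>lborel) = step_functional (T - s) n (\<lambda>j. inc s n j \<omega>)" for n
    by (simp add: step_functional_def set_lebesgue_integral_def f_def)
  moreover have "(\<integral>v. indicator {0..T - s} v * (exp (X s \<omega>) * V (s + v) \<omega>) \<partial>lborel) = J T s \<omega>"
  proof -
    have "J T s \<omega> = (\<integral>u. indicator {s..T} u * (exp (X s \<omega>) * V u \<omega>) \<partial>lborel)"
      by (simp add: J_def Y_def set_lebesgue_integral_def mult.left_commute)
    also have "\<dots> = (\<integral>v. indicator {s..T} (s + 1 * v) * (exp (X s \<omega>) * V (s + 1 * v) \<omega>) \<partial>lborel)"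
      by (subst lborel_integral_real_affine[of 1 _ s]) auto
    also have "\<dots> = (\<integral>v. indicator {0..T - s} v * (exp (X s \<omega>) * V (s + v) \<omega>) \<partial>lborel)"
      by (intro Bochner_Integration.integral_cong) (auto simp: indicator_def)
    finally show ?thesis by simp
  qed
  ultimately show ?thesis by simp
qed

lemma indep_X_step_functional:
  assumes s: "0 \<le> s"
  shows "indep_var borel (\<lambda>\<omega>. X s \<omega> - X 0 \<omega>) borel (\<lambda>\<omega>. step_functional L n (\<lambda>j. inc s n j \<omega>))"
proof -
  \<comment> \<open>Prepending the time 0 makes \<open>X s - X 0\<close> the increment with index 0
    and \<open>inc s n j\<close> the one with index \<open>j + 1\<close>, so that disjoint blocks of
    indices separate them.\<close>
  define \<tau> where "\<tau> = (\<lambda>j. if j = 0 then 0 else s + real (j - 1) / real (Suc n))"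
  have "mono \<tau>"
    unfolding incseq_Suc_iff \<tau>_def using s by (auto simp: divide_right_mono)
  then have "indep_vars (\<lambda>_. borel) (\<lambda>j \<omega>. X (\<tau> (Suc j)) \<omega> - X (\<tau> j) \<omega>) UNIV"
    by (rule indep_increments) (simp add: \<tau>_def)
  then have ind: "indep_var (PiM {0} (\<lambda>_. borel)) (\<lambda>\<omega>. \<lambda>j\<in>{0}. X (\<tau> (Suc j)) \<omega> - X (\<tau> j) \<omega>)
     (PiM {1..} (\<lambda>_. borel)) (\<lambda>\<omega>. \<lambda>j\<in>{1..}. X (\<tau> (Suc j)) \<omega> - X (\<tau> j) \<omega>)"
    by (rule indep_var_restrict) auto
  have sh: "(\<lambda>f j. f (Suc j)) \<in> PiM {1::nat..} (\<lambda>_. borel :: real measure) \<rightarrow>\<^sub>M PiM UNIV (\<lambda>_. borel)"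
    by (rule measurable_PiM_single') (auto intro: measurable_component_singleton)
  have "indep_var borel ((\<lambda>f. f 0) \<circ> (\<lambda>\<omega>. \<lambda>j\<in>{0}. X (\<tau> (Suc j)) \<omega> - X (\<tau> j) \<omega>))
     borel ((\<lambda>f. step_functional L n (\<lambda>j. f (Suc j))) \<circ> (\<lambda>\<omega>. \<lambda>j\<in>{1..}. X (\<tau> (Suc j)) \<omega> - X (\<tau> j) \<omega>))"
    by (rule indep_var_compose[OF ind measurable_component_singleton measurable_compose[OF sh step_functional_measurable]]) simp
  moreover have "((\<lambda>f. step_functional L n (\<lambda>j. f (Suc j))) \<circ> (\<lambda>\<omega>. \<lambda>j\<in>{1..}. X (\<tau> (Suc j)) \<omega> - X (\<tau> j) \<omega>))
      = (\<lambda>\<omega>. step_functional L n (\<lambda>j. inc s n j \<omega>))"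
    by (auto simp: fun_eq_iff \<tau>_def inc_def)
  moreover have "((\<lambda>f. f 0) \<circ> (\<lambda>\<omega>. \<lambda>j\<in>{0}. X (\<tau> (Suc j)) \<omega> - X (\<tau> j) \<omega>)) = (\<lambda>\<omega>. X s \<omega> - X 0 \<omega>)"
    by (auto simp: fun_eq_iff \<tau>_def)
  ultimately show ?thesis by simp
qed

end

section \<open>Product formulas for \<open>X\<close> and \<open>J\<close>\<close>

context pii
begin

lemma step_functional_inc_measurable [measurable]:
  assumes "0 \<le> s"
  shows "(\<lambda>\<omega>. step_functional L n (\<lambda>j. inc s n j \<omega>)) \<in> borel_measurable M"
proof -
  have "(\<lambda>\<omega> j. inc s n j \<omega>) \<in> M \<rightarrow>\<^sub>M PiM UNIV (\<lambda>_. borel)"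
    using assms by (intro measurable_PiM_single') auto
  then show ?thesis by (rule measurable_compose) (rule step_functional_measurable)
qed

lemma integral_step_functional_tendsto:
  fixes h :: "real \<Rightarrow> real"
  assumes s: "0 \<le> s" "s \<le> T" and h: "continuous_on UNIV h" "\<And>y. \<bar>h y\<bar> \<le> B"
  shows "(\<lambda>n. \<integral>\<omega>. h (step_functional (T - s) n (\<lambda>j. inc s n j \<omega>)) \<partial>M) \<longlonglongrightarrow> (\<integral>\<omega>. h (J T s \<omega>) \<partial>M)"
proof (rule integral_dominated_convergence)
  have [measurable]: "h \<in> borel_measurable borel" by (rule borel_measurable_continuous_onI[OF h(1)])
  have [measurable]: "J T s \<in> borel_measurable M" using s by auto
  show "AE \<omega> in M. (\<lambda>n. h (step_functional (T - s) n (\<lambda>j. inc s n j \<omega>))) \<longlonglongrightarrow> h (J T s \<omega>)"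
    by (intro AE_I2 continuous_on_tendsto_compose[OF h(1) step_functional_tendsto[OF _ s]]) auto
  show "AE \<omega> in M. norm (h (step_functional (T - s) n (\<lambda>j. inc s n j \<omega>))) \<le> B" for n
    using h(2) by simp
  show "(\<lambda>\<omega>. h (step_functional (T - s) n (\<lambda>j. inc s n j \<omega>))) \<in> borel_measurable M" for n
    using step_functional_inc_measurable[OF s(1)] by (rule measurable_compose) measurable
  show "(\<lambda>\<omega>. h (J T s \<omega>)) \<in> borel_measurable M" by measurable
qed simp

text \<open>The product formula holds for each step functional by independence and passes to the
  limit because \<open>h\<close> is continuous and bounded. The exponential factor may be unbounded;
  its integrability provides the domination.\<close>

lemma integral_mult_bounded_J:
  fixes h :: "real \<Rightarrow> real"
  assumes s: "0 \<le> s" "s \<le> T" and int: "integrable M (\<lambda>\<omega>. exp (a * X s \<omega>))"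
    and h: "continuous_on UNIV h" "\<And>y. 0 \<le> h y" "\<And>y. h y \<le> B"
  shows "(\<integral>\<omega>. exp (a * X s \<omega>) * h (J T s \<omega>) \<partial>M) = (\<integral>\<omega>. exp (a * X s \<omega>) \<partial>M) * (\<integral>\<omega>. h (J T s \<omega>) \<partial>M)"
proof -
  define S where "S = (\<lambda>n \<omega>. step_functional (T - s) n (\<lambda>j. inc s n j \<omega>))"
  have [measurable]: "S n \<in> borel_measurable M" for n unfolding S_def using s(1) by measurable
  have [measurable]: "h \<in> borel_measurable borel" by (rule borel_measurable_continuous_onI[OF h(1)])
  have [measurable]: "X s \<in> borel_measurable M" "J T s \<in> borel_measurable M" using s by auto
  have B: "0 \<le> B" using h(2,3)[of 0] by linarith
  have bound: "norm (h y) \<le> B" for y using h by simp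
  have hS: "integrable M (\<lambda>\<omega>. h (S n \<omega>))" for n
    by (rule integrable_const_bound[of _ B]) (auto simp: h)
  have int0: "integrable M (\<lambda>\<omega>. exp (a * (X s \<omega> - X 0 \<omega>)))"
    using int by (rule Bochner_Integration.integrable_cong[THEN iffD1, OF refl, rotated]) (simp add: X_0)
  have prod: "(\<integral>\<omega>. exp (a * X s \<omega>) * h (S n \<omega>) \<partial>M) = (\<integral>\<omega>. exp (a * X s \<omega>) \<partial>M) * (\<integral>\<omega>. h (S n \<omega>) \<partial>M)" for n
  proof -
    have "indep_var borel ((\<lambda>x. exp (a * x)) \<circ> (\<lambda>\<omega>. X s \<omega> - X 0 \<omega>)) borel (h \<circ> S n)"
      unfolding S_def by (rule indep_var_compose[OF indep_X_step_functional[OF s(1)]]) measurable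
    then have "(\<integral>\<omega>. exp (a * (X s \<omega> - X 0 \<omega>)) * h (S n \<omega>) \<partial>M)
        = (\<integral>\<omega>. exp (a * (X s \<omega> - X 0 \<omega>)) \<partial>M) * (\<integral>\<omega>. h (S n \<omega>) \<partial>M)"
      unfolding o_def using int0 hS by (intro indep_var_lebesgue_integral)
    moreover have "(\<integral>\<omega>. exp (a * (X s \<omega> - X 0 \<omega>)) * h (S n \<omega>) \<partial>M) = (\<integral>\<omega>. exp (a * X s \<omega>) * h (S n \<omega>) \<partial>M)"
      by (rule Bochner_Integration.integral_cong) (simp_all add: X_0)
    moreover have "(\<integral>\<omega>. exp (a * (X s \<omega> - X 0 \<omega>)) \<partial>M) = (\<integral>\<omega>. exp (a * X s \<omega>) \<partial>M)"
      by (rule Bochner_Integration.integral_cong) (simp_all add: X_0)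
    ultimately show ?thesis by simp
  qed
  have lim: "(\<lambda>n. h (S n \<omega>)) \<longlonglongrightarrow> h (J T s \<omega>)" if "\<omega> \<in> space M" for \<omega>
    using continuous_on_tendsto_compose[OF h(1) step_functional_tendsto[OF that s]] by (simp add: S_def)
  have "(\<lambda>n. \<integral>\<omega>. exp (a * X s \<omega>) * h (S n \<omega>) \<partial>M) \<longlonglongrightarrow> (\<integral>\<omega>. exp (a * X s \<omega>) * h (J T s \<omega>) \<partial>M)"
  proof (rule integral_dominated_convergence)
    show "integrable M (\<lambda>\<omega>. exp (a * X s \<omega>) * B)" using int by simp
    show "AE \<omega> in M. (\<lambda>n. exp (a * X s \<omega>) * h (S n \<omega>)) \<longlonglongrightarrow> exp (a * X s \<omega>) * h (J T s \<omega>)"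
      by (intro AE_I2 tendsto_mult tendsto_const lim)
    show "AE \<omega> in M. norm (exp (a * X s \<omega>) * h (S n \<omega>)) \<le> exp (a * X s \<omega>) * B" for n
      using bound by (intro AE_I2) (simp add: abs_mult)
  qed measurable
  moreover have "(\<lambda>n. \<integral>\<omega>. h (S n \<omega>) \<partial>M) \<longlonglongrightarrow> (\<integral>\<omega>. h (J T s \<omega>) \<partial>M)"
    unfolding S_def using h(2,3) by (intro integral_step_functional_tendsto[OF s h(1), of B]) simp
  then have "(\<lambda>n. (\<integral>\<omega>. exp (a * X s \<omega>) \<partial>M) * (\<integral>\<omega>. h (S n \<omega>) \<partial>M)) \<longlonglongrightarrow>
      (\<integral>\<omega>. exp (a * X s \<omega>) \<partial>M) * (\<integral>\<omega>. h (J T s \<omega>) \<partial>M)"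
    by (intro tendsto_mult tendsto_const)
  ultimately show ?thesis unfolding prod by (rule LIMSEQ_unique)
qed

text \<open>Bounded continuous functions that increase to the power \<open>- p\<close> on the
  positive half line: they admit limits along Riemann sums and, in \<open>N\<close>, monotone
  convergence.\<close>

definition trunc :: "real \<Rightarrow> nat \<Rightarrow> real \<Rightarrow> real" where
  "trunc p N y = max y (1 / real (Suc N)) powr (- p)"

lemma trunc_props:
  assumes "p > 0"
  shows "continuous_on UNIV (trunc p N)" "0 \<le> trunc p N y" "trunc p N y \<le> (1 / real (Suc N)) powr (- p)"
    "trunc p N y \<le> trunc p (Suc N) y" "y > 0 \<Longrightarrow> (\<lambda>N. trunc p N y) \<longlonglongrightarrow> y powr (- p)"
proof -
  have pos: "max y (1 / real (Suc N)) > 0" for y N by (simp add: less_max_iff_disj)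
  show "continuous_on UNIV (trunc p N)"
    unfolding trunc_def using pos by (intro continuous_intros) (auto simp: less_imp_neq[symmetric])
  show "0 \<le> trunc p N y" by (simp add: trunc_def)
  show "trunc p N y \<le> (1 / real (Suc N)) powr (- p)"
    unfolding trunc_def using assms by (intro powr_mono2') auto
  have "1 / real (Suc (Suc N)) \<le> 1 / real (Suc N)" by (intro divide_left_mono) auto
  then show "trunc p N y \<le> trunc p (Suc N) y"
    unfolding trunc_def
    by (intro powr_mono2'[OF _ pos max.mono[OF order_refl]]) (use assms in auto)
  assume "y > 0"
  have "(\<lambda>N. 1 / real (Suc N)) \<longlonglongrightarrow> 0"
    using LIMSEQ_inverse_real_of_nat by (simp add: inverse_eq_divide)
  then have "(\<lambda>N. max y (1 / real (Suc N))) \<longlonglongrightarrow> max y 0" by (intro tendsto_max tendsto_const)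
  then show "(\<lambda>N. trunc p N y) \<longlonglongrightarrow> y powr (- p)"
    unfolding trunc_def using \<open>y > 0\<close> by (intro tendsto_powr tendsto_const) auto
qed

text \<open>The exponential factor is carried along so that both sides of the product formula are
  covered, with \<open>b = a\<close> and with \<open>b = 0\<close>.\<close>

lemma nn_integral_trunc_J_tendsto:
  assumes s: "0 \<le> s" "s < T" and p: "p > 0"
  shows "(\<lambda>N. \<integral>\<^sup>+\<omega>. ennreal (exp (b * X s \<omega>) * trunc p N (J T s \<omega>)) \<partial>M) \<longlonglongrightarrow>
      (\<integral>\<^sup>+\<omega>. ennreal (exp (b * X s \<omega>) * J T s \<omega> powr (- p)) \<partial>M)"
proof -
  note tr = trunc_props[OF p]
  have [measurable]: "X s \<in> borel_measurable M" "J T s \<in> borel_measurable M" using s by auto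
  have [measurable]: "trunc p N \<in> borel_measurable borel" for N by (rule borel_measurable_continuous_onI[OF tr(1)])
  \<comment> \<open>Convergence is demanded at every \<open>\<omega>\<close>, while positivity of
    \<open>J\<close> is known only on \<open>space M\<close>; the indicator settles the other
    points.\<close>
  have "(\<lambda>N. \<integral>\<^sup>+\<omega>. ennreal (exp (b * X s \<omega>) * trunc p N (J T s \<omega>)) * indicator (space M) \<omega> \<partial>M) \<longlonglongrightarrow>
    (\<integral>\<^sup>+\<omega>. ennreal (exp (b * X s \<omega>) * J T s \<omega> powr (- p)) * indicator (space M) \<omega> \<partial>M)"
  proof (rule nn_integral_LIMSEQ)
    show "incseq (\<lambda>N \<omega>. ennreal (exp (b * X s \<omega>) * trunc p N (J T s \<omega>)) * indicator (space M) \<omega>)"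
      using tr(2,4) by (intro incseq_SucI le_funI mult_right_mono ennreal_leI mult_left_mono) auto
    show "(\<lambda>N. ennreal (exp (b * X s \<omega>) * trunc p N (J T s \<omega>)) * indicator (space M) \<omega>) \<longlonglongrightarrow>
        ennreal (exp (b * X s \<omega>) * J T s \<omega> powr (- p)) * indicator (space M) \<omega>" for \<omega>
    proof (cases "\<omega> \<in> space M")
      case True
      then have "(\<lambda>N. trunc p N (J T s \<omega>)) \<longlonglongrightarrow> J T s \<omega> powr (- p)" by (intro tr(5) J_pos s)
      then show ?thesis using True by (simp add: tendsto_ennrealI tendsto_mult)
    qed simp
  qed measurable
  moreover have "(\<integral>\<^sup>+\<omega>. f \<omega> * indicator (space M) \<omega> \<partial>M) = (\<integral>\<^sup>+\<omega>. f \<omega> \<partial>M)" for f :: "'a \<Rightarrow> ennreal"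
    by (intro nn_integral_cong) simp
  ultimately show ?thesis by simp
qed

text \<open>Monotone convergence in the extended half line, where both sides may be infinite. This
  is what later allows finiteness of the moment of \<open>J\<close> to be deduced from that of
  \<open>Y\<close>.\<close>

lemma nn_integral_mult_J_powr:
  assumes s: "0 \<le> s" "s < T" and int: "integrable M (\<lambda>\<omega>. exp (a * X s \<omega>))" and p: "p > 0"
  shows "(\<integral>\<^sup>+\<omega>. ennreal (exp (a * X s \<omega>) * J T s \<omega> powr (- p)) \<partial>M) =
     ennreal (\<integral>\<omega>. exp (a * X s \<omega>) \<partial>M) * (\<integral>\<^sup>+\<omega>. ennreal (J T s \<omega> powr (- p)) \<partial>M)"
proof -
  note tr = trunc_props[OF p]
  have [measurable]: "X s \<in> borel_measurable M" "J T s \<in> borel_measurable M" using s by auto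
  have [measurable]: "trunc p N \<in> borel_measurable borel" for N by (rule borel_measurable_continuous_onI[OF tr(1)])
  note lim = nn_integral_trunc_J_tendsto[OF s p]
  have "(\<integral>\<^sup>+\<omega>. ennreal (exp (a * X s \<omega>) * trunc p N (J T s \<omega>)) \<partial>M) =
     ennreal (\<integral>\<omega>. exp (a * X s \<omega>) \<partial>M) * (\<integral>\<^sup>+\<omega>. ennreal (trunc p N (J T s \<omega>)) \<partial>M)" for N
  proof -
    have i1: "integrable M (\<lambda>\<omega>. trunc p N (J T s \<omega>))"
      by (rule integrable_const_bound[of _ "(1 / real (Suc N)) powr (- p)"]) (use tr(2,3) in auto)
    have i2: "integrable M (\<lambda>\<omega>. exp (a * X s \<omega>) * trunc p N (J T s \<omega>))"
    proof (rule Bochner_Integration.integrable_bound)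
      show "integrable M (\<lambda>\<omega>. exp (a * X s \<omega>) * (1 / real (Suc N)) powr (- p))" using int by simp
      show "AE \<omega> in M. norm (exp (a * X s \<omega>) * trunc p N (J T s \<omega>)) \<le> norm (exp (a * X s \<omega>) * (1 / real (Suc N)) powr (- p))"
        using tr(2,3) by (intro AE_I2) (simp add: abs_mult)
    qed measurable
    have "(\<integral>\<^sup>+\<omega>. ennreal (exp (a * X s \<omega>) * trunc p N (J T s \<omega>)) \<partial>M) =
        ennreal (\<integral>\<omega>. exp (a * X s \<omega>) * trunc p N (J T s \<omega>) \<partial>M)"
      using tr(2) by (intro nn_integral_eq_integral[OF i2]) simp
    also have "\<dots> = ennreal (\<integral>\<omega>. exp (a * X s \<omega>) \<partial>M) * ennreal (\<integral>\<omega>. trunc p N (J T s \<omega>) \<partial>M)"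
      using tr(2) unfolding integral_mult_bounded_J[OF s(1) less_imp_le[OF s(2)] int tr(1,2,3), of N]
      by (intro ennreal_mult Bochner_Integration.integral_nonneg) auto
    also have "ennreal (\<integral>\<omega>. trunc p N (J T s \<omega>) \<partial>M) = (\<integral>\<^sup>+\<omega>. ennreal (trunc p N (J T s \<omega>)) \<partial>M)"
      using tr(2) by (intro nn_integral_eq_integral[OF i1, symmetric]) simp
    finally show ?thesis .
  qed
  then have "(\<lambda>N. ennreal (\<integral>\<omega>. exp (a * X s \<omega>) \<partial>M) * (\<integral>\<^sup>+\<omega>. ennreal (trunc p N (J T s \<omega>)) \<partial>M)) \<longlonglongrightarrow>
      (\<integral>\<^sup>+\<omega>. ennreal (exp (a * X s \<omega>) * J T s \<omega> powr (- p)) \<partial>M)"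
    using lim[of a] by simp
  moreover have "(\<lambda>N. ennreal (\<integral>\<omega>. exp (a * X s \<omega>) \<partial>M) * (\<integral>\<^sup>+\<omega>. ennreal (trunc p N (J T s \<omega>)) \<partial>M)) \<longlonglongrightarrow>
      ennreal (\<integral>\<omega>. exp (a * X s \<omega>) \<partial>M) * (\<integral>\<^sup>+\<omega>. ennreal (J T s \<omega> powr (- p)) \<partial>M)"
    using lim[of 0] by (intro ennreal_tendsto_cmult) auto
  ultimately show ?thesis by (rule LIMSEQ_unique)
qed

section \<open>Negative powers of the tail integral and Jensen's inequality\<close>

lemma V_powr: "0 \<le> u \<Longrightarrow> V u \<omega> powr (- q) = exp (q * X u \<omega>)"
  by (simp add: V_def powr_def)

lemma Y_powr_eq:
  assumes "\<omega> \<in> space M" "0 \<le> s" "s < T"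
  shows "exp (p * X s \<omega>) * J T s \<omega> powr (- p) = Y T s \<omega> powr (- p)"
proof -
  have "J T s \<omega> powr (- p) = exp (X s \<omega>) powr (- p) * Y T s \<omega> powr (- p)"
    unfolding J_def using Y_pos[OF assms] by (intro powr_mult)
  also have "exp (X s \<omega>) powr (- p) = exp (- (p * X s \<omega>))" by (simp add: powr_def)
  finally show ?thesis by (simp add: exp_minus)
qed

lemma V_powr_set_integrable:
  assumes "\<omega> \<in> space M" "0 \<le> s" "q > 0"
  shows "set_integrable lborel {s..T} (\<lambda>u. V u \<omega> powr (- q))"
proof -
  obtain B where B: "\<And>u. u \<in> {0..T} \<Longrightarrow> \<bar>X u \<omega>\<bar> \<le> B"
    using cadlag_path_bounded[OF path[OF assms(1)], of 0 T] by auto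
  have "integrable lborel (\<lambda>u. indicator {s..T} u *\<^sub>R exp (q * B))" by (rule integrable_indicator_Icc)
  then show ?thesis
    unfolding set_integrable_def
  proof (rule Bochner_Integration.integrable_bound)
    show "AE u in lborel. norm (indicator {s..T} u *\<^sub>R V u \<omega> powr (- q)) \<le> norm (indicator {s..T} u *\<^sub>R exp (q * B))"
    proof (rule AE_I2)
      fix u
      have "V u \<omega> powr (- q) \<le> exp (q * B)" if "u \<in> {s..T}"
      proof -
        have "X u \<omega> \<le> B" "0 \<le> u" using B[of u] that assms(2) by auto
        then show ?thesis using assms(3) by (simp add: V_powr)
      qed
      then show "norm (indicator {s..T} u *\<^sub>R V u \<omega> powr (- q)) \<le> norm (indicator {s..T} u *\<^sub>R exp (q * B))"
        by (auto simp: indicator_def)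
    qed
    have [measurable]: "(\<lambda>u. V u \<omega>) \<in> borel_measurable borel" by (rule V_path_measurable[OF assms(1)])
    show "(\<lambda>u. indicator {s..T} u *\<^sub>R V u \<omega> powr (- q)) \<in> borel_measurable lborel" by measurable
  qed
qed

lemma powr_minus_tangent:
  fixes y m q :: real
  assumes "y > 0" "m > 0" "q > 0"
  shows "m powr (- q) + q * m powr (- q - 1) * (m - y) \<le> y powr (- q)"
proof (cases "y \<le> m")
  case True
  then show ?thesis using powr_minus_mean_value_bounds(1)[of y m q] assms by simp
next
  case False
  then show ?thesis using powr_minus_mean_value_bounds(2)[of m y q] assms by (simp add: algebra_simps)
qed

text \<open>Jensen's inequality for the convex power \<open>- q\<close> under the uniform law on the
  interval from \<open>s\<close> to \<open>T\<close>: integrating the tangent at the mean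
  \<open>m\<close> makes its linear term vanish.\<close>

lemma Y_powr_le:
  assumes \<omega>: "\<omega> \<in> space M" and s: "0 \<le> s" "s < T" and q: "q > 0"
  shows "(T - s) * (Y T s \<omega> / (T - s)) powr (- q) \<le> (LBINT u:{s..T}. V u \<omega> powr (- q))"
proof -
  define m where "m = Y T s \<omega> / (T - s)"
  have m: "m > 0" using Y_pos[OF \<omega> s] s by (simp add: m_def)
  have c: "set_integrable lborel {s..T} (\<lambda>u. c)" for c :: real
    unfolding set_integrable_def by (rule integrable_indicator_Icc)
  have V: "set_integrable lborel {s..T} (\<lambda>u. V u \<omega>)" by (rule V_set_integrable[OF \<omega> s(1)])
  have cI: "(LBINT u:{s..T}. c) = c * (T - s)" for c :: real
    using s by (simp add: set_lebesgue_integral_def)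
  have "(LBINT u:{s..T}. m powr (- q) + q * m powr (- q - 1) * (m - V u \<omega>)) =
      (LBINT u:{s..T}. m powr (- q)) + q * m powr (- q - 1) * ((LBINT u:{s..T}. m) - (LBINT u:{s..T}. V u \<omega>))"
    using c V by (simp add: set_integral_add set_integral_diff)
  also have "\<dots> = m powr (- q) * (T - s)"
    unfolding cI using s by (simp add: m_def Y_def)
  finally have "m powr (- q) * (T - s) = (LBINT u:{s..T}. m powr (- q) + q * m powr (- q - 1) * (m - V u \<omega>))" by simp
  also have "\<dots> \<le> (LBINT u:{s..T}. V u \<omega> powr (- q))"
  proof (rule set_integral_mono)
    show "set_integrable lborel {s..T} (\<lambda>u. m powr (- q) + q * m powr (- q - 1) * (m - V u \<omega>))"
      using c V by (intro set_integral_add set_integrable_mult_right set_integral_diff) auto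
    show "m powr (- q) + q * m powr (- q - 1) * (m - V u \<omega>) \<le> V u \<omega> powr (- q)" if "u \<in> {s..T}" for u
      using that s m q by (intro powr_minus_tangent V_pos) auto
  qed (rule V_powr_set_integrable[OF \<omega> s(1) q])
  finally show ?thesis by (simp add: m_def mult.commute)
qed

end

subsection \<open>Moments of the exponential functional\<close>

lemma (in pii) Y_joint_measurable [measurable]:
  "(\<lambda>(\<omega>, u). Y T u \<omega>) \<in> borel_measurable (M \<Otimes>\<^sub>M lborel)"
proof -
  have [measurable]: "(\<lambda>q. V (snd q) (fst (fst q))) \<in> borel_measurable ((M \<Otimes>\<^sub>M lborel) \<Otimes>\<^sub>M lborel)"
  proof -
    have "(\<lambda>q. (fst (fst q), snd q)) \<in> ((M \<Otimes>\<^sub>M lborel) \<Otimes>\<^sub>M lborel) \<rightarrow>\<^sub>M M \<Otimes>\<^sub>M (lborel :: real measure)"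
      by measurable
    from measurable_compose[OF this V_measurable] show ?thesis by simp
  qed
  \<comment> \<open>The lower limit of integration varies, so it is moved into the integrand as a
    condition relating two time variables.\<close>
  have "(\<lambda>q. if snd (fst q) \<le> snd q \<and> snd q \<le> T then V (snd q) (fst (fst q)) else 0)
      \<in> borel_measurable ((M \<Otimes>\<^sub>M lborel) \<Otimes>\<^sub>M lborel)"
    by measurable
  also have "(\<lambda>q. if snd (fst q) \<le> snd q \<and> snd q \<le> T then V (snd q) (fst (fst q)) else 0) =
      (\<lambda>(p, w). indicator {snd p..T} w *\<^sub>R V w (fst p))"
    by (auto simp: fun_eq_iff indicator_def)
  finally have "(\<lambda>p. \<integral>w. indicator {snd p..T} w *\<^sub>R V w (fst p) \<partial>lborel) \<in> borel_measurable (M \<Otimes>\<^sub>M lborel)"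
    by (rule lborel.borel_measurable_lebesgue_integral)
  then show ?thesis by (simp add: Y_def set_lebesgue_integral_def case_prod_beta)
qed

lemma (in pii) Y_path_measurable [measurable]: "\<omega> \<in> space M \<Longrightarrow> (\<lambda>u. Y T u \<omega>) \<in> borel_measurable borel"
  using measurable_compose[OF measurable_Pair1' Y_joint_measurable, of \<omega>] by simp

lemma (in pii) Y_continuous:
  assumes "\<omega> \<in> space M"
  shows "continuous_on {0..T} (\<lambda>u. Y T u \<omega>)"
proof -
  have "continuous_on {0..T} (\<lambda>u. integral {u..T} (\<lambda>u. V u \<omega>))"
    by (rule indefinite_integral_continuous_1'[OF V_integrable_on[OF assms order_refl]])
  then show ?thesis
    by (rule continuous_on_cong[THEN iffD1, OF refl, rotated]) (use assms in \<open>simp add: Y_eq_integral\<close>)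
qed

text \<open>What the moment argument uses besides independent increments: exponential moments of all
  orders up to \<open>be + 1\<close>, with exponents \<open>k\<close> continuous in time. A triplet
  supplies them up to its horizon, and stationarity of the increments on every horizon.\<close>

locale exp_pii = pii +
  fixes T be :: real and k :: "real \<Rightarrow> real \<Rightarrow> real"
  assumes T_pos: "T > 0" and be_pos: "be > 0"
    and mgf: "0 \<le> c \<Longrightarrow> c \<le> be + 1 \<Longrightarrow> 0 \<le> u \<Longrightarrow> u \<le> T \<Longrightarrow>
      integrable M (\<lambda>\<omega>. exp (c * X u \<omega>)) \<and> (\<integral>\<omega>. exp (c * X u \<omega>) \<partial>M) = exp (k c u)"
    and k_cont: "0 \<le> c \<Longrightarrow> c \<le> be + 1 \<Longrightarrow> continuous_on {0..T} (k c)"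
begin

text \<open>Jensen's inequality and Tonelli's theorem bound the moment by a multiple of the time
  integral of \<open>exp (k q u)\<close>.\<close>

lemma Y_powr_integrable:
  assumes s: "0 \<le> s" "s < T" and q: "0 < q" "q \<le> be + 1"
  shows "integrable M (\<lambda>\<omega>. Y T s \<omega> powr (- q))"
proof -
  interpret P: pair_sigma_finite M lborel ..
  \<comment> \<open>The exponent collects \<open>- q\<close> from rescaling \<open>Y\<close> to its
    mean and \<open>- 1\<close> from averaging over the interval.\<close>
  define D where "D = (T - s) powr (- q - 1)"
  have D: "Y T s \<omega> powr (- q) \<le> D * (LBINT u:{s..T}. V u \<omega> powr (- q))" if "\<omega> \<in> space M" for \<omega>
  proof -
    have "Y T s \<omega> powr (- q) = D * ((T - s) * (Y T s \<omega> / (T - s)) powr (- q))"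
    proof -
      have "(Y T s \<omega> / (T - s)) powr (- q) = Y T s \<omega> powr (- q) / (T - s) powr (- q)"
        by (rule powr_divide)
      moreover have "D * (T - s) = (T - s) powr (- q)"
        unfolding D_def using s powr_add[of "T - s" "- q - 1" 1] by simp
      ultimately have "D * ((T - s) * (Y T s \<omega> / (T - s)) powr (- q)) =
          (T - s) powr (- q) * (Y T s \<omega> powr (- q) / (T - s) powr (- q))"
        by (simp only: mult.assoc[symmetric])
      then show ?thesis using s by simp
    qed
    also have "\<dots> \<le> D * (LBINT u:{s..T}. V u \<omega> powr (- q))"
      using Y_powr_le[OF that s q(1)] by (intro mult_left_mono) (auto simp: D_def)
    finally show ?thesis .
  qed
  have Vm: "(\<lambda>(\<omega>, u). ennreal (indicator {s..T} u *\<^sub>R V u \<omega> powr (- q))) \<in> borel_measurable (M \<Otimes>\<^sub>M lborel)"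
  proof -
    have [measurable]: "(\<lambda>p. V (snd p) (fst p)) \<in> borel_measurable (M \<Otimes>\<^sub>M lborel)"
      using V_measurable by (simp add: case_prod_beta)
    show ?thesis unfolding case_prod_beta by measurable
  qed
  have "(\<integral>\<^sup>+\<omega>. ennreal (norm (Y T s \<omega> powr (- q))) \<partial>M)
      \<le> (\<integral>\<^sup>+\<omega>. ennreal D * (\<integral>\<^sup>+u. ennreal (indicator {s..T} u *\<^sub>R V u \<omega> powr (- q)) \<partial>lborel) \<partial>M)"
  proof (rule nn_integral_mono)
    fix \<omega> assume \<omega>: "\<omega> \<in> space M"
    have "ennreal (norm (Y T s \<omega> powr (- q))) \<le> ennreal (D * (LBINT u:{s..T}. V u \<omega> powr (- q)))"
      using D[OF \<omega>] by (intro ennreal_leI) simp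
    also have "\<dots> = ennreal D * ennreal (LBINT u:{s..T}. V u \<omega> powr (- q))"
      unfolding set_lebesgue_integral_def
      by (intro ennreal_mult Bochner_Integration.integral_nonneg) (auto simp: D_def)
    also have "ennreal (LBINT u:{s..T}. V u \<omega> powr (- q)) = (\<integral>\<^sup>+u. ennreal (indicator {s..T} u *\<^sub>R V u \<omega> powr (- q)) \<partial>lborel)"
      using V_powr_set_integrable[OF \<omega> s(1) q(1), of T]
      unfolding set_lebesgue_integral_def set_integrable_def
      by (intro nn_integral_eq_integral[symmetric]) auto
    finally show "ennreal (norm (Y T s \<omega> powr (- q))) \<le>
      ennreal D * (\<integral>\<^sup>+u. ennreal (indicator {s..T} u *\<^sub>R V u \<omega> powr (- q)) \<partial>lborel)" .
  qed
  also have "\<dots> = ennreal D * (\<integral>\<^sup>+\<omega>. (\<integral>\<^sup>+u. ennreal (indicator {s..T} u *\<^sub>R V u \<omega> powr (- q)) \<partial>lborel) \<partial>M)"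
    by (rule nn_integral_cmult) (rule lborel.borel_measurable_nn_integral[OF Vm])
  also have "(\<integral>\<^sup>+\<omega>. (\<integral>\<^sup>+u. ennreal (indicator {s..T} u *\<^sub>R V u \<omega> powr (- q)) \<partial>lborel) \<partial>M) =
      (\<integral>\<^sup>+u. (\<integral>\<^sup>+\<omega>. ennreal (indicator {s..T} u *\<^sub>R V u \<omega> powr (- q)) \<partial>M) \<partial>lborel)"
    by (rule P.Fubini'[OF Vm, symmetric])
  also have "\<dots> = (\<integral>\<^sup>+u. ennreal (indicator {s..T} u *\<^sub>R exp (k q u)) \<partial>lborel)"
  proof (rule nn_integral_cong)
    fix u
    show "(\<integral>\<^sup>+\<omega>. ennreal (indicator {s..T} u *\<^sub>R V u \<omega> powr (- q)) \<partial>M) = ennreal (indicator {s..T} u *\<^sub>R exp (k q u))"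
    proof (cases "u \<in> {s..T}")
      case True
      then have u: "0 \<le> u" "u \<le> T" using s by auto
      have "(\<integral>\<^sup>+\<omega>. ennreal (exp (q * X u \<omega>)) \<partial>M) = ennreal (exp (k q u))"
        using mgf[OF less_imp_le[OF q(1)] q(2) u] by (subst nn_integral_eq_integral) auto
      then show ?thesis using True u by (simp add: V_powr)
    qed simp
  qed
  also have "\<dots> = ennreal (LBINT u:{s..T}. exp (k q u))"
  proof -
    have "continuous_on {s..T} (\<lambda>u. exp (k q u))"
      using q s by (intro continuous_intros continuous_on_subset[OF k_cont]) auto
    then have "set_integrable lborel {s..T} (\<lambda>u. exp (k q u))" by (rule borel_integrable_atLeastAtMost')
    then show ?thesis unfolding set_lebesgue_integral_def set_integrable_def
      by (intro nn_integral_eq_integral) auto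
  qed
  finally show ?thesis
    unfolding integrable_iff_bounded by (auto simp: ennreal_mult_less_top le_less_trans)
qed

text \<open>\<open>Y\<close> is \<open>J\<close> times \<open>exp (- X s)\<close>, and the two
  factors separate in expectation. Since \<open>exp (k q s)\<close> is positive, finiteness passes
  from \<open>Y\<close> to \<open>J\<close>.\<close>

lemma Y_powr_moment:
  assumes s: "0 \<le> s" "s < T" and q: "0 < q" "q \<le> be + 1"
  shows "integrable M (\<lambda>\<omega>. J T s \<omega> powr (- q))"
    and "(\<integral>\<omega>. Y T s \<omega> powr (- q) \<partial>M) = exp (k q s) * (\<integral>\<omega>. J T s \<omega> powr (- q) \<partial>M)"
proof -
  have [measurable]: "J T s \<in> borel_measurable M" using s by auto
  have mg: "integrable M (\<lambda>\<omega>. exp (q * X s \<omega>))" "(\<integral>\<omega>. exp (q * X s \<omega>) \<partial>M) = exp (k q s)"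
    using mgf[of q s] q s by auto
  have "(\<integral>\<^sup>+\<omega>. ennreal (Y T s \<omega> powr (- q)) \<partial>M) = (\<integral>\<^sup>+\<omega>. ennreal (exp (q * X s \<omega>) * J T s \<omega> powr (- q)) \<partial>M)"
    by (intro nn_integral_cong) (simp add: Y_powr_eq s)
  also have "\<dots> = ennreal (exp (k q s)) * (\<integral>\<^sup>+\<omega>. ennreal (J T s \<omega> powr (- q)) \<partial>M)"
    unfolding nn_integral_mult_J_powr[OF s mg(1) q(1)] mg(2) ..
  finally have eq: "ennreal (\<integral>\<omega>. Y T s \<omega> powr (- q) \<partial>M) = ennreal (exp (k q s)) * (\<integral>\<^sup>+\<omega>. ennreal (J T s \<omega> powr (- q)) \<partial>M)"
    using Y_powr_integrable[OF s q] by (simp add: nn_integral_eq_integral)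
  have "(\<integral>\<^sup>+\<omega>. ennreal (J T s \<omega> powr (- q)) \<partial>M) < \<infinity>"
  proof (rule ccontr)
    assume "\<not> ?thesis"
    then have "(\<integral>\<^sup>+\<omega>. ennreal (J T s \<omega> powr (- q)) \<partial>M) = top" by (simp add: less_top[symmetric])
    with eq show False by (simp add: ennreal_mult_top)
  qed
  then show J: "integrable M (\<lambda>\<omega>. J T s \<omega> powr (- q))"
    unfolding integrable_iff_bounded by simp
  have "ennreal (\<integral>\<omega>. Y T s \<omega> powr (- q) \<partial>M) = ennreal (exp (k q s) * (\<integral>\<omega>. J T s \<omega> powr (- q) \<partial>M))"
    using eq J by (simp add: nn_integral_eq_integral ennreal_mult)
  then show "(\<integral>\<omega>. Y T s \<omega> powr (- q) \<partial>M) = exp (k q s) * (\<integral>\<omega>. J T s \<omega> powr (- q) \<partial>M)"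
    by (subst (asm) ennreal_inj) (auto intro!: mult_nonneg_nonneg Bochner_Integration.integral_nonneg)
qed

section \<open>The derivative of the moments in the starting time\<close>

definition phi :: "real \<Rightarrow> real" where
  "phi u = exp (k be u) * (\<integral>\<omega>. J T u \<omega> powr (- be - 1) \<partial>M)"

text \<open>The factor \<open>V u\<close>, which is \<open>exp (- X u)\<close>, lowers the
  exponential from order \<open>be + 1\<close> to order \<open>be\<close>; therefore
  \<open>k be\<close> appears next to the power \<open>- be - 1\<close> of \<open>J\<close>.\<close>

lemma nn_integral_Y_powr_V:
  assumes u: "0 \<le> u" "u < T"
  shows "(\<integral>\<^sup>+\<omega>. ennreal (Y T u \<omega> powr (- be - 1) * V u \<omega>) \<partial>M) = ennreal (phi u)"
proof -
  have q: "0 < be + 1" "be + 1 \<le> be + 1" using be_pos by auto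
  have e: "- (be + 1) = - be - 1" by simp
  have mg: "integrable M (\<lambda>\<omega>. exp (be * X u \<omega>))" "(\<integral>\<omega>. exp (be * X u \<omega>) \<partial>M) = exp (k be u)"
    using mgf[of be u] be_pos u by auto
  note J = Y_powr_moment(1)[OF u q, unfolded e]
  have "Y T u \<omega> powr (- be - 1) * V u \<omega> = exp (be * X u \<omega>) * J T u \<omega> powr (- be - 1)" if "\<omega> \<in> space M" for \<omega>
  proof -
    have "exp ((be + 1) * X u \<omega>) * V u \<omega> = exp (be * X u \<omega>)"
      using u by (simp add: V_def mult_exp_exp algebra_simps)
    then show ?thesis
      using Y_powr_eq[OF that u, of "be + 1"] by (simp only: e) (metis mult.assoc mult.commute)
  qed
  then have "(\<integral>\<^sup>+\<omega>. ennreal (Y T u \<omega> powr (- be - 1) * V u \<omega>) \<partial>M) =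
      (\<integral>\<^sup>+\<omega>. ennreal (exp (be * X u \<omega>) * J T u \<omega> powr (- be - 1)) \<partial>M)"
    by (intro nn_integral_cong) simp
  also have "\<dots> = ennreal (exp (k be u)) * (\<integral>\<^sup>+\<omega>. ennreal (J T u \<omega> powr (- be - 1)) \<partial>M)"
    using nn_integral_mult_J_powr[OF u mg(1) q(1)] unfolding e mg(2) .
  also have "(\<integral>\<^sup>+\<omega>. ennreal (J T u \<omega> powr (- be - 1)) \<partial>M) = ennreal (\<integral>\<omega>. J T u \<omega> powr (- be - 1) \<partial>M)"
    by (intro nn_integral_eq_integral J) simp
  finally show ?thesis by (simp add: phi_def ennreal_mult Bochner_Integration.integral_nonneg)
qed

text \<open>\<open>Y\<close> decreases in time, so its negative power at \<open>r\<close> dominates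
  the earlier ones; \<open>r < T\<close> keeps \<open>Y T r\<close> positive.\<close>

lemma Y_moment_continuous:
  assumes q: "0 < q" "q \<le> be + 1" and r: "r < T"
  shows "continuous_on {0..r} (\<lambda>u. \<integral>\<omega>. Y T u \<omega> powr (- q) \<partial>M)"
  unfolding continuous_on_sequentially
proof (intro allI ballI impI)
  fix x :: "nat \<Rightarrow> real" and a assume a: "a \<in> {0..r}" and x: "(\<forall>n. x n \<in> {0..r}) \<and> x \<longlonglongrightarrow> a"
  have r0: "0 \<le> r" using a by auto
  have "(\<lambda>n. \<integral>\<omega>. Y T (x n) \<omega> powr (- q) \<partial>M) \<longlonglongrightarrow> (\<integral>\<omega>. Y T a \<omega> powr (- q) \<partial>M)"
  proof (rule integral_dominated_convergence)
    show "integrable M (\<lambda>\<omega>. Y T r \<omega> powr (- q))" by (rule Y_powr_integrable[OF r0 r q])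
    show "AE \<omega> in M. (\<lambda>n. Y T (x n) \<omega> powr (- q)) \<longlonglongrightarrow> Y T a \<omega> powr (- q)"
    proof (rule AE_I2)
      fix \<omega> assume \<omega>: "\<omega> \<in> space M"
      have "(\<lambda>n. Y T (x n) \<omega>) \<longlonglongrightarrow> Y T a \<omega>"
        using continuous_on_subset[OF Y_continuous[OF \<omega>, of T], of "{0..r}"] a x r
        unfolding continuous_on_sequentially o_def by auto
      then show "(\<lambda>n. Y T (x n) \<omega> powr (- q)) \<longlonglongrightarrow> Y T a \<omega> powr (- q)"
        using Y_pos[OF \<omega>, of a T] a r by (intro tendsto_powr tendsto_const) auto
    qed
    show "AE \<omega> in M. norm (Y T (x n) \<omega> powr (- q)) \<le> Y T r \<omega> powr (- q)" for n
    proof (rule AE_I2)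
      fix \<omega> assume \<omega>: "\<omega> \<in> space M"
      have "0 \<le> x n" "x n \<le> r" using x by auto
      then have "Y T r \<omega> \<le> Y T (x n) \<omega>" by (rule Y_antimono[OF \<omega>])
      then show "norm (Y T (x n) \<omega> powr (- q)) \<le> Y T r \<omega> powr (- q)"
        using Y_pos[OF \<omega> r0 r] q by (simp add: powr_mono2')
    qed
  qed simp_all
  then show "((\<lambda>u. \<integral>\<omega>. Y T u \<omega> powr (- q) \<partial>M) \<circ> x) \<longlonglongrightarrow> (\<integral>\<omega>. Y T a \<omega> powr (- q) \<partial>M)" by (simp add: o_def)
qed

text \<open>\<open>V\<close> has jumps, so continuity is not visible in the integrand
  \<open>Y powr (- be - 1) * V\<close>. Exchanging \<open>J\<close> for \<open>Y\<close> leaves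
  continuous exponents and a continuous moment of \<open>Y\<close>.\<close>

lemma phi_continuous:
  assumes "r < T"
  shows "continuous_on {0..r} phi"
proof -
  have q: "0 < be + 1" "be + 1 \<le> be + 1" using be_pos by auto
  have e: "- (be + 1) = - be - 1" by simp
  have "continuous_on {0..r} (\<lambda>u. exp (k be u - k (be + 1) u) * (\<integral>\<omega>. Y T u \<omega> powr (- (be + 1)) \<partial>M))"
    using be_pos assms
    by (intro continuous_intros Y_moment_continuous continuous_on_subset[OF k_cont]) auto
  then show ?thesis
  proof (rule continuous_on_cong[THEN iffD1, OF refl, rotated])
    show "exp (k be u - k (be + 1) u) * (\<integral>\<omega>. Y T u \<omega> powr (- (be + 1)) \<partial>M) = phi u" if "u \<in> {0..r}" for u
    proof -
      have u: "0 \<le> u" "u < T" using that assms by auto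
      show ?thesis unfolding Y_powr_moment(2)[OF u q] by (simp add: phi_def exp_diff e)
    qed
  qed
qed

lemma phi_nonneg: "phi u \<ge> 0"
  by (simp add: phi_def Bochner_Integration.integral_nonneg)

text \<open>The path identity \<open>integral_powr_of_tail_integral\<close> is integrated over
  \<open>\<omega>\<close>; its integrand is nonnegative, so Tonelli's theorem exchanges the two
  integrals.\<close>

lemma Y_moment_increment:
  assumes s: "0 \<le> s" "s \<le> r" "r < T"
  shows "(\<integral>\<omega>. Y T r \<omega> powr (- be) \<partial>M) - (\<integral>\<omega>. Y T s \<omega> powr (- be) \<partial>M) = be * integral {s..r} phi"
proof -
  interpret P: pair_sigma_finite M lborel ..
  define g where "g = (\<lambda>\<omega> u. Y T u \<omega> powr (- be - 1) * V u \<omega>)"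
  have r0: "0 \<le> r" and sT: "s < T" using s by auto
  have g0: "g \<omega> u \<ge> 0" for \<omega> u by (simp add: g_def V_nonneg)
  have gm: "(\<lambda>(\<omega>, u). ennreal (indicator {s..r} u *\<^sub>R g \<omega> u)) \<in> borel_measurable (M \<Otimes>\<^sub>M lborel)"
  proof -
    have [measurable]: "(\<lambda>p. V (snd p) (fst p)) \<in> borel_measurable (M \<Otimes>\<^sub>M lborel)"
        "(\<lambda>p. Y T (snd p) (fst p)) \<in> borel_measurable (M \<Otimes>\<^sub>M lborel)"
      using V_measurable Y_joint_measurable[of T] by (simp_all add: case_prod_beta)
    show ?thesis unfolding case_prod_beta g_def by measurable
  qed
  have gi: "set_integrable lborel {s..r} (g \<omega>)" if \<omega>: "\<omega> \<in> space M" for \<omega>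
    unfolding set_integrable_def
  proof (rule Bochner_Integration.integrable_bound)
    show "integrable lborel (\<lambda>u. Y T r \<omega> powr (- be - 1) * (indicator {s..r} u *\<^sub>R V u \<omega>))"
      using V_set_integrable[OF \<omega> s(1), of r] unfolding set_integrable_def by (rule integrable_mult_right)
    have [measurable]: "(\<lambda>u. V u \<omega>) \<in> borel_measurable borel" "(\<lambda>u. Y T u \<omega>) \<in> borel_measurable borel"
      using \<omega> by measurable
    show "(\<lambda>u. indicator {s..r} u *\<^sub>R g \<omega> u) \<in> borel_measurable lborel" unfolding g_def by measurable
    show "AE u in lborel. norm (indicator {s..r} u *\<^sub>R g \<omega> u) \<le> norm (Y T r \<omega> powr (- be - 1) * (indicator {s..r} u *\<^sub>R V u \<omega>))"
    proof (rule AE_I2)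
      fix u
      show "norm (indicator {s..r} u *\<^sub>R g \<omega> u) \<le> norm (Y T r \<omega> powr (- be - 1) * (indicator {s..r} u *\<^sub>R V u \<omega>))"
      proof (cases "u \<in> {s..r}")
        case True
        then have "Y T r \<omega> \<le> Y T u \<omega>" using s by (intro Y_antimono[OF \<omega>]) auto
        then have "Y T u \<omega> powr (- be - 1) \<le> Y T r \<omega> powr (- be - 1)"
          using be_pos Y_pos[OF \<omega> r0 s(3)] by (intro powr_mono2') auto
        then show ?thesis using True V_nonneg[of u \<omega>] by (simp add: g_def abs_mult mult_right_mono)
      qed simp
    qed
  qed
  have path_eq: "Y T r \<omega> powr (- be) - Y T s \<omega> powr (- be) = be * (LBINT u:{s..r}. g \<omega> u)" if \<omega>: "\<omega> \<in> space M" for \<omega>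
  proof -
    obtain B where B: "\<And>u. u \<in> {0..T} \<Longrightarrow> V u \<omega> \<le> B" using V_bounded[OF \<omega>] by metis
    have Yeq: "Y T u \<omega> = integral {u..T} (\<lambda>u. V u \<omega>)" if "0 \<le> u" for u by (rule Y_eq_integral[OF \<omega> that])
    have geq: "g \<omega> u = integral {u..T} (\<lambda>u. V u \<omega>) powr (- be - 1) * V u \<omega>" if "0 \<le> u" for u
      by (simp add: g_def Yeq[OF that])
    have gI: "(\<lambda>u. integral {u..T} (\<lambda>u. V u \<omega>) powr (- be - 1) * V u \<omega>) integrable_on {s..r}"
      by (rule integrable_eq[OF set_borel_integral_eq_integral(1)[OF gi[OF \<omega>]]]) (use s geq in auto)
    have "integral {r..T} (\<lambda>u. V u \<omega>) powr (- be) - integral {s..T} (\<lambda>u. V u \<omega>) powr (- be) =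
       be * integral {s..r} (\<lambda>u. integral {u..T} (\<lambda>u. V u \<omega>) powr (- be - 1) * V u \<omega>)"
    proof (rule integral_powr_of_tail_integral[OF be_pos s(2) less_imp_le[OF s(3)] V_integrable_on[OF \<omega> s(1)] _ _ _ gI])
      show "V u \<omega> \<le> B" if "u \<in> {s..T}" for u using that s by (intro B) auto
      show "0 < integral {r..T} (\<lambda>u. V u \<omega>)" using Y_pos[OF \<omega> r0 s(3)] Yeq[OF r0] by simp
    qed (rule V_nonneg)
    also have "integral {s..r} (\<lambda>u. integral {u..T} (\<lambda>u. V u \<omega>) powr (- be - 1) * V u \<omega>) = integral {s..r} (g \<omega>)"
      by (rule integral_cong) (use s geq in auto)
    also have "\<dots> = (LBINT u:{s..r}. g \<omega> u)" by (rule set_borel_integral_eq_integral(2)[OF gi[OF \<omega>], symmetric])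
    finally show ?thesis using Yeq[OF r0] Yeq[OF s(1)] by simp
  qed
  have iY: "integrable M (\<lambda>\<omega>. Y T r \<omega> powr (- be))" "integrable M (\<lambda>\<omega>. Y T s \<omega> powr (- be))"
    using be_pos s sT r0 by (auto intro!: Y_powr_integrable)
  have nonneg: "0 \<le> (LBINT u:{s..r}. g \<omega> u)" for \<omega>
    unfolding set_lebesgue_integral_def using g0 by (intro Bochner_Integration.integral_nonneg) auto
  have phic: "set_integrable lborel {s..r} phi"
    using s by (intro borel_integrable_atLeastAtMost' continuous_on_subset[OF phi_continuous[OF s(3)]]) auto
  have "ennreal ((\<integral>\<omega>. Y T r \<omega> powr (- be) \<partial>M) - (\<integral>\<omega>. Y T s \<omega> powr (- be) \<partial>M)) =
      (\<integral>\<^sup>+\<omega>. ennreal (Y T r \<omega> powr (- be) - Y T s \<omega> powr (- be)) \<partial>M)"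
    using iY path_eq be_pos nonneg by (subst nn_integral_eq_integral) auto
  also have "\<dots> = (\<integral>\<^sup>+\<omega>. ennreal be * (\<integral>\<^sup>+u. ennreal (indicator {s..r} u *\<^sub>R g \<omega> u) \<partial>lborel) \<partial>M)"
  proof (rule nn_integral_cong)
    fix \<omega> assume \<omega>: "\<omega> \<in> space M"
    have "(\<integral>\<^sup>+u. ennreal (indicator {s..r} u *\<^sub>R g \<omega> u) \<partial>lborel) = ennreal (LBINT u:{s..r}. g \<omega> u)"
      using gi[OF \<omega>] g0 unfolding set_lebesgue_integral_def set_integrable_def by (intro nn_integral_eq_integral) auto
    then show "ennreal (Y T r \<omega> powr (- be) - Y T s \<omega> powr (- be)) =
        ennreal be * (\<integral>\<^sup>+u. ennreal (indicator {s..r} u *\<^sub>R g \<omega> u) \<partial>lborel)"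
      using path_eq[OF \<omega>] be_pos nonneg by (simp add: ennreal_mult)
  qed
  also have "\<dots> = ennreal be * (\<integral>\<^sup>+\<omega>. (\<integral>\<^sup>+u. ennreal (indicator {s..r} u *\<^sub>R g \<omega> u) \<partial>lborel) \<partial>M)"
    by (rule nn_integral_cmult) (rule lborel.borel_measurable_nn_integral[OF gm])
  also have "(\<integral>\<^sup>+\<omega>. (\<integral>\<^sup>+u. ennreal (indicator {s..r} u *\<^sub>R g \<omega> u) \<partial>lborel) \<partial>M) =
      (\<integral>\<^sup>+u. (\<integral>\<^sup>+\<omega>. ennreal (indicator {s..r} u *\<^sub>R g \<omega> u) \<partial>M) \<partial>lborel)"
    by (rule P.Fubini'[OF gm, symmetric])
  also have "\<dots> = (\<integral>\<^sup>+u. ennreal (indicator {s..r} u *\<^sub>R phi u) \<partial>lborel)"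
  proof (rule nn_integral_cong)
    fix u
    show "(\<integral>\<^sup>+\<omega>. ennreal (indicator {s..r} u *\<^sub>R g \<omega> u) \<partial>M) = ennreal (indicator {s..r} u *\<^sub>R phi u)"
      using nn_integral_Y_powr_V[of u] s by (cases "u \<in> {s..r}") (auto simp: g_def)
  qed
  also have "\<dots> = ennreal (LBINT u:{s..r}. phi u)"
    using phic phi_nonneg unfolding set_lebesgue_integral_def set_integrable_def by (intro nn_integral_eq_integral) auto
  also have "(LBINT u:{s..r}. phi u) = integral {s..r} phi" by (rule set_borel_integral_eq_integral(2)[OF phic])
  finally have eq: "ennreal ((\<integral>\<omega>. Y T r \<omega> powr (- be) \<partial>M) - (\<integral>\<omega>. Y T s \<omega> powr (- be) \<partial>M)) = ennreal be * ennreal (integral {s..r} phi)" .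
  have pos: "0 \<le> integral {s..r} phi"
    using set_borel_integral_eq_integral(1)[OF phic] phi_nonneg by (intro Henstock_Kurzweil_Integration.integral_nonneg) auto
  \<comment> \<open>\<open>ennreal\<close> sends negative numbers to 0, so the order of the two
    moments must be known before the equation can be read in the reals.\<close>
  have "(\<integral>\<omega>. Y T s \<omega> powr (- be) \<partial>M) \<le> (\<integral>\<omega>. Y T r \<omega> powr (- be) \<partial>M)"
  proof (rule integral_mono[OF iY(2,1)])
    fix \<omega> assume \<omega>: "\<omega> \<in> space M"
    show "Y T s \<omega> powr (- be) \<le> Y T r \<omega> powr (- be)"
      using path_eq[OF \<omega>] be_pos nonneg[of \<omega>] mult_nonneg_nonneg[of be] by (metis diff_ge_0_iff_ge less_imp_le)
  qed
  then show ?thesis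
    using eq be_pos pos by (subst (asm) ennreal_mult[symmetric]) (auto simp: ennreal_inj)
qed

lemma Y_moment_derivative:
  assumes s: "0 < s" "s < T"
  shows "((\<lambda>u. \<integral>\<omega>. Y T u \<omega> powr (- be) \<partial>M) has_real_derivative be * phi s) (at s)"
proof -
  \<comment> \<open>Any point strictly between \<open>s\<close> and \<open>T\<close> would serve:
    \<open>phi\<close> is known to be continuous only before \<open>T\<close>.\<close>
  define r where "r = (s + T) / 2"
  have r: "s < r" "r < T" using s by (auto simp: r_def)
  have cont: "continuous_on {0..r} phi" by (rule phi_continuous[OF r(2)])
  have "((\<lambda>u. integral {0..u} phi) has_real_derivative phi s) (at s within {0..r})"
    using s r by (intro integral_has_real_derivative[OF cont]) auto
  then have "((\<lambda>u. integral {0..u} phi) has_real_derivative phi s) (at s)"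
    using s r by (simp add: at_within_Icc_at)
  then have d: "((\<lambda>u. (\<integral>\<omega>. Y T 0 \<omega> powr (- be) \<partial>M) + be * integral {0..u} phi) has_real_derivative be * phi s) (at s)"
    by (auto intro!: derivative_eq_intros)
  show ?thesis
  proof (rule has_field_derivative_transform_within_open[OF d])
    show "open {0<..<r}" "s \<in> {0<..<r}" using s r by auto
    show "(\<integral>\<omega>. Y T 0 \<omega> powr (- be) \<partial>M) + be * integral {0..u} phi = (\<integral>\<omega>. Y T u \<omega> powr (- be) \<partial>M)"
      if "u \<in> {0<..<r}" for u
      using Y_moment_increment[of 0 u] that r by auto
  qed
qed

text \<open>Product rule for \<open>exp (- k be u)\<close> times the moment of \<open>Y\<close>.
  Here differentiability of the exponent enters, and only at the single time
  \<open>s\<close>.\<close>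

lemma J_moment_derivative:
  assumes s: "0 < s" "s < T" and k': "(k be has_real_derivative k') (at s)"
  shows "((\<lambda>u. \<integral>\<omega>. J T u \<omega> powr (- be) \<partial>M) has_real_derivative
     be * (\<integral>\<omega>. J T s \<omega> powr (- be - 1) \<partial>M) - k' * (\<integral>\<omega>. J T s \<omega> powr (- be) \<partial>M)) (at s)"
proof -
  have q: "0 < be" "be \<le> be + 1" using be_pos by auto
  define G where "G = (\<lambda>u. \<integral>\<omega>. Y T u \<omega> powr (- be) \<partial>M)"
  have eq: "exp (- k be u) * G u = (\<integral>\<omega>. J T u \<omega> powr (- be) \<partial>M)" if "0 \<le> u" "u < T" for u
    unfolding G_def Y_powr_moment(2)[OF that q] by (simp add: exp_minus)
  have G': "(G has_real_derivative be * phi s) (at s)" unfolding G_def by (rule Y_moment_derivative[OF s])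
  have d: "((\<lambda>u. exp (- k be u) * G u) has_real_derivative
      exp (- k be s) * (be * phi s) - k' * (exp (- k be s) * G s)) (at s)"
    by (rule derivative_eq_intros G' k' refl)+ (simp add: algebra_simps)
  have "((\<lambda>u. \<integral>\<omega>. J T u \<omega> powr (- be) \<partial>M) has_real_derivative
      exp (- k be s) * (be * phi s) - k' * (exp (- k be s) * G s)) (at s)"
    by (rule has_field_derivative_transform_within_open[OF d, of "{0<..<T}"]) (use s eq in auto)
  moreover have "exp (- k be s) * (be * phi s) = be * (\<integral>\<omega>. J T s \<omega> powr (- be - 1) \<partial>M)"
    by (simp add: phi_def exp_minus)
  moreover have "exp (- k be s) * G s = (\<integral>\<omega>. J T s \<omega> powr (- be) \<partial>M)" using eq s by simp
  ultimately show ?thesis by simp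
qed

end

subsection \<open>Left limits\<close>

context pii
begin

lemma nn_integral_exp_increment:
  assumes r: "0 \<le> r" "r \<le> s"
  shows "(\<integral>\<^sup>+\<omega>. ennreal (exp (c * X s \<omega>)) \<partial>M) =
    (\<integral>\<^sup>+\<omega>. ennreal (exp (c * X r \<omega>)) \<partial>M) * (\<integral>\<^sup>+\<omega>. ennreal (exp (c * (X s \<omega> - X r \<omega>))) \<partial>M)"
proof -
  \<comment> \<open>The times are \<open>0, r, s, s, ...\<close>, so the increments with indices 0
    and 1 are \<open>X r - X 0\<close> and \<open>X s - X r\<close>.\<close>
  define \<tau> where "\<tau> = (\<lambda>j::nat. if j = 0 then 0 else if j = 1 then r else s)"
  have "mono \<tau>" unfolding incseq_Suc_iff \<tau>_def using r by auto
  then have "indep_vars (\<lambda>_. borel) (\<lambda>j \<omega>. X (\<tau> (Suc j)) \<omega> - X (\<tau> j) \<omega>) UNIV"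
    by (rule indep_increments) (simp add: \<tau>_def)
  then have "indep_vars (\<lambda>_. borel) (\<lambda>j \<omega>. X (\<tau> (Suc j)) \<omega> - X (\<tau> j) \<omega>) {0, 1}"
    by (rule indep_vars_subset) auto
  then have "indep_vars (\<lambda>_. borel) (\<lambda>j \<omega>. ennreal (exp (c * (X (\<tau> (Suc j)) \<omega> - X (\<tau> j) \<omega>)))) {0, 1}"
    by (rule indep_vars_compose2[where Y="\<lambda>_ x. ennreal (exp (c * x))"]) measurable
  then have eq: "(\<integral>\<^sup>+\<omega>. (\<Prod>j\<in>{0, 1}. ennreal (exp (c * (X (\<tau> (Suc j)) \<omega> - X (\<tau> j) \<omega>)))) \<partial>M) =
      (\<Prod>j\<in>{0, 1}. \<integral>\<^sup>+\<omega>. ennreal (exp (c * (X (\<tau> (Suc j)) \<omega> - X (\<tau> j) \<omega>))) \<partial>M)"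
    by (intro indep_vars_nn_integral) auto
  have "(\<integral>\<^sup>+\<omega>. ennreal (exp (c * X s \<omega>)) \<partial>M) =
      (\<integral>\<^sup>+\<omega>. (\<Prod>j\<in>{0, 1}. ennreal (exp (c * (X (\<tau> (Suc j)) \<omega> - X (\<tau> j) \<omega>)))) \<partial>M)"
    by (intro nn_integral_cong)
      (simp add: \<tau>_def X_0 ennreal_mult[symmetric] mult_exp_exp algebra_simps)
  also have "\<dots> = (\<integral>\<^sup>+\<omega>. ennreal (exp (c * X r \<omega>)) \<partial>M) * (\<integral>\<^sup>+\<omega>. ennreal (exp (c * (X s \<omega> - X r \<omega>))) \<partial>M)"
  proof -
    have "(\<integral>\<^sup>+\<omega>. ennreal (exp (c * (X r \<omega> - X 0 \<omega>))) \<partial>M) = (\<integral>\<^sup>+\<omega>. ennreal (exp (c * X r \<omega>)) \<partial>M)"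
      by (intro nn_integral_cong) (simp add: X_0)
    then show ?thesis unfolding eq by (simp add: \<tau>_def)
  qed
  finally show ?thesis .
qed

lemma left_lim_tendsto:
  assumes "\<omega> \<in> space M" "s > 0"
  shows "((\<lambda>u. X u \<omega>) \<longlongrightarrow> left_lim X s \<omega>) (at_left s)"
proof -
  obtain l where l: "((\<lambda>u. X u \<omega>) \<longlongrightarrow> l) (at_left s)"
    using path[OF assms(1)] assms(2) by (auto simp: cadlag_path_def)
  moreover have "left_lim X s \<omega> = l"
    unfolding left_lim_def by (rule tendsto_Lim[OF _ l]) simp
  ultimately show ?thesis by simp
qed

definition left_seq :: "real \<Rightarrow> nat \<Rightarrow> real" where
  "left_seq s n = s - s / real (n + 2)"

lemma left_seq: "s > 0 \<Longrightarrow> 0 \<le> left_seq s n" "s > 0 \<Longrightarrow> left_seq s n < s"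
  by (auto simp: left_seq_def field_simps)

lemma left_seq_tendsto: "left_seq s \<longlonglongrightarrow> s"
proof -
  have "(\<lambda>n. s / real (n + 2)) \<longlonglongrightarrow> 0"
    using LIMSEQ_ignore_initial_segment[OF lim_const_over_n[of s], of 2] by simp
  then have "(\<lambda>n. s - s / real (n + 2)) \<longlonglongrightarrow> s - 0" by (intro tendsto_diff tendsto_const)
  then show ?thesis by (simp add: left_seq_def[abs_def])
qed

lemma left_lim_seq:
  assumes "\<omega> \<in> space M" "s > 0"
  shows "(\<lambda>n. X (left_seq s n) \<omega>) \<longlonglongrightarrow> left_lim X s \<omega>"
proof -
  have "filterlim (left_seq s) (at_left s) sequentially"
    unfolding filterlim_at using left_seq_tendsto left_seq(2)[OF assms(2)]
    by (auto intro!: always_eventually simp: less_imp_neq)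
  then show ?thesis by (rule filterlim_compose[OF left_lim_tendsto[OF assms]])
qed

lemma left_lim_measurable:
  assumes "s > 0"
  shows "left_lim X s \<in> borel_measurable M"
  by (rule borel_measurable_LIMSEQ_real[OF left_lim_seq]) (use assms left_seq in auto)

lemma exp_functional_between_eq:
  assumes "0 \<le> s"
  shows "exp_functional_between X s T \<omega> = exp (left_lim X s \<omega>) * Y T s \<omega>"
proof -
  have "exp (left_lim X s \<omega>) * Y T s \<omega> = (LBINT u:{s..T}. exp (left_lim X s \<omega>) * V u \<omega>)" by (simp add: Y_def)
  also have "\<dots> = exp_functional_between X s T \<omega>"
    unfolding exp_functional_between_def
    using assms by (intro set_lebesgue_integral_cong) (auto simp: V_def exp_diff exp_minus field_simps)
  finally show ?thesis by simp
qed

lemma exp_functional_between_integrable: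
  assumes "\<omega> \<in> space M" "0 \<le> s"
  shows "set_integrable lborel {s..T} (\<lambda>u. exp (- (X u \<omega> - left_lim X s \<omega>)))"
proof -
  have "set_integrable lborel {s..T} (\<lambda>u. exp (left_lim X s \<omega>) * V u \<omega>)"
    by (intro set_integrable_mult_right V_set_integrable assms)
  also have "?this \<longleftrightarrow> ?thesis"
    using assms(2) by (intro set_integrable_cong) (auto simp: V_def exp_diff exp_minus field_simps)
  finally show ?thesis .
qed

end

section \<open>Absence of fixed jumps, and the moments with left limits\<close>

context exp_pii
begin

lemma increment_mgf:
  assumes r: "0 \<le> r" "r \<le> s" "s \<le> T" and c: "0 \<le> c" "c \<le> be + 1"
  shows "(\<integral>\<^sup>+\<omega>. ennreal (exp (c * (X s \<omega> - X r \<omega>))) \<partial>M) = ennreal (exp (k c s - k c r))"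
proof -
  have nn: "(\<integral>\<^sup>+\<omega>. ennreal (exp (c * X u \<omega>)) \<partial>M) = ennreal (exp (k c u))" if "0 \<le> u" "u \<le> T" for u
    using mgf[OF c that] by (subst nn_integral_eq_integral) auto
  \<comment> \<open>Cancellation in the extended half line: multiply by the inverse of the positive
    finite factor \<open>exp (k c r)\<close>.\<close>
  have "ennreal (exp (- k c r)) * ennreal (exp (k c s)) =
      ennreal (exp (- k c r)) * (ennreal (exp (k c r)) * (\<integral>\<^sup>+\<omega>. ennreal (exp (c * (X s \<omega> - X r \<omega>))) \<partial>M))"
    using nn_integral_exp_increment[OF r(1,2), of c] nn[of r] nn[of s] r by simp
  also have "\<dots> = (ennreal (exp (- k c r)) * ennreal (exp (k c r))) * (\<integral>\<^sup>+\<omega>. ennreal (exp (c * (X s \<omega> - X r \<omega>))) \<partial>M)"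
    by (simp only: mult.assoc)
  also have "ennreal (exp (- k c r)) * ennreal (exp (k c r)) = 1"
    by (simp add: ennreal_mult[symmetric] mult_exp_exp)
  finally show ?thesis by (simp add: ennreal_mult[symmetric] mult_exp_exp)
qed

text \<open>Continuity of the exponents makes \<open>exp (c * (X s - X r))\<close> converge to 1 in
  mean square as \<open>r\<close> increases to \<open>s\<close>, and Fatou's lemma carries this over
  to the left limit.\<close>

lemma no_fixed_jump:
  assumes s: "0 < s" "s \<le> T"
  shows "AE \<omega> in M. left_lim X s \<omega> = X s \<omega>"
proof -
  \<comment> \<open>Squaring the exponential of order \<open>c\<close> then gives order
    \<open>be\<close>, for which the moment is available.\<close>
  define c where "c = be / 2"
  have c: "0 < c" "c \<le> be + 1" "2 * c = be" using be_pos by (auto simp: c_def)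
  have [measurable]: "left_lim X s \<in> borel_measurable M" "X s \<in> borel_measurable M"
    using left_lim_measurable s by auto
  define d where "d = (\<lambda>n \<omega>. exp (c * (X s \<omega> - X (left_seq s n) \<omega>)))"
  have [measurable]: "X (left_seq s n) \<in> borel_measurable M" for n using left_seq s by auto
  have [measurable]: "d n \<in> borel_measurable M" for n unfolding d_def by measurable
  define e where "e = (\<lambda>b n. exp (k b s - k b (left_seq s n)))"
  have inc: "integrable M (\<lambda>\<omega>. exp (b * (X s \<omega> - X (left_seq s n) \<omega>)))"
     "(\<integral>\<omega>. exp (b * (X s \<omega> - X (left_seq s n) \<omega>)) \<partial>M) = e b n" if "0 \<le> b" "b \<le> be + 1" for b n
  proof -
    have nn: "(\<integral>\<^sup>+\<omega>. ennreal (exp (b * (X s \<omega> - X (left_seq s n) \<omega>))) \<partial>M) = ennreal (e b n)"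
      unfolding e_def using left_seq[OF s(1), of n] s that by (intro increment_mgf) auto
    have hb: "has_bochner_integral M (\<lambda>\<omega>. exp (b * (X s \<omega> - X (left_seq s n) \<omega>))) (e b n)"
      by (rule has_bochner_integral_nn_integral[OF _ _ _ nn]) (auto simp: e_def)
    then show "integrable M (\<lambda>\<omega>. exp (b * (X s \<omega> - X (left_seq s n) \<omega>)))"
     "(\<integral>\<omega>. exp (b * (X s \<omega> - X (left_seq s n) \<omega>)) \<partial>M) = e b n" by (auto simp: has_bochner_integral_iff)
  qed
  have elim: "e b \<longlonglongrightarrow> 1" if "0 \<le> b" "b \<le> be + 1" for b
  proof -
    have "(\<lambda>n. k b (left_seq s n)) \<longlonglongrightarrow> k b s"
    proof (rule continuous_on_tendsto_compose[OF k_cont[OF that] left_seq_tendsto])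
      have "left_seq s n \<in> {0..T}" for n using left_seq[OF s(1), of n] s by auto
      then show "\<forall>\<^sub>F n in sequentially. left_seq s n \<in> {0..T}" by simp
    qed (use s in auto)
    then have "e b \<longlonglongrightarrow> exp (k b s - k b s)" unfolding e_def by (intro tendsto_intros)
    then show ?thesis by simp
  qed
  have sq: "d n \<omega> ^ 2 = exp (be * (X s \<omega> - X (left_seq s n) \<omega>))" for n \<omega>
    using c(3) by (simp add: d_def exp_double[symmetric] mult.assoc[symmetric])
  have nn: "(\<integral>\<^sup>+\<omega>. ennreal ((d n \<omega> - 1)\<^sup>2) \<partial>M) = ennreal (e be n - 2 * e c n + 1)" for n
  proof -
    have i: "integrable M (\<lambda>\<omega>. d n \<omega> ^ 2)" "(\<integral>\<omega>. d n \<omega> ^ 2 \<partial>M) = e be n"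
        "integrable M (d n)" "(\<integral>\<omega>. d n \<omega> \<partial>M) = e c n"
      unfolding sq using inc[of be n] inc[of c n] be_pos c by (auto simp: d_def[abs_def])
    have eq: "(d n \<omega> - 1)\<^sup>2 = d n \<omega> ^ 2 - 2 * d n \<omega> + 1" for \<omega> by (simp add: power2_eq_square algebra_simps)
    have "integrable M (\<lambda>\<omega>. (d n \<omega> - 1)\<^sup>2)" unfolding eq using i by simp
    then have "(\<integral>\<^sup>+\<omega>. ennreal ((d n \<omega> - 1)\<^sup>2) \<partial>M) = ennreal (\<integral>\<omega>. (d n \<omega> - 1)\<^sup>2 \<partial>M)"
      by (intro nn_integral_eq_integral) auto
    also have "(\<integral>\<omega>. (d n \<omega> - 1)\<^sup>2 \<partial>M) = e be n - 2 * e c n + 1"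
      unfolding eq using i by (simp add: prob_space)
    finally show ?thesis .
  qed
  define D where "D = (\<lambda>\<omega>. (exp (c * (X s \<omega> - left_lim X s \<omega>)) - 1)\<^sup>2)"
  have "(\<integral>\<^sup>+\<omega>. ennreal (D \<omega>) \<partial>M) = (\<integral>\<^sup>+\<omega>. liminf (\<lambda>n. ennreal ((d n \<omega> - 1)\<^sup>2)) \<partial>M)"
  proof (rule nn_integral_cong)
    fix \<omega> assume \<omega>: "\<omega> \<in> space M"
    have "(\<lambda>n. ennreal ((d n \<omega> - 1)\<^sup>2)) \<longlonglongrightarrow> ennreal (D \<omega>)"
      unfolding d_def D_def by (intro tendsto_intros tendsto_ennrealI left_lim_seq[OF \<omega> s(1)])
    then show "ennreal (D \<omega>) = liminf (\<lambda>n. ennreal ((d n \<omega> - 1)\<^sup>2))"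
      by (rule lim_imp_Liminf[OF sequentially_bot, symmetric])
  qed
  also have "\<dots> \<le> liminf (\<lambda>n. \<integral>\<^sup>+\<omega>. ennreal ((d n \<omega> - 1)\<^sup>2) \<partial>M)"
    by (rule nn_integral_liminf) measurable
  also have "\<dots> = ennreal 0"
  proof (rule lim_imp_Liminf[OF sequentially_bot])
    have "(\<lambda>n. e be n - 2 * e c n + 1) \<longlonglongrightarrow> 1 - 2 * 1 + 1"
      using be_pos c by (intro tendsto_intros elim) auto
    then show "(\<lambda>n. \<integral>\<^sup>+\<omega>. ennreal ((d n \<omega> - 1)\<^sup>2) \<partial>M) \<longlonglongrightarrow> ennreal 0"
      unfolding nn by (intro tendsto_ennrealI) simp
  qed
  finally have "(\<integral>\<^sup>+\<omega>. ennreal (D \<omega>) \<partial>M) = 0" by simp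
  then have "AE \<omega> in M. ennreal (D \<omega>) = 0"
    by (subst (asm) nn_integral_0_iff_AE) (auto simp: D_def)
  then show ?thesis
    by eventually_elim (use c in \<open>auto simp: D_def\<close>)
qed

lemma exp_functional_between_AE:
  assumes s: "0 < s" "s < T"
  shows "AE \<omega> in M. exp_functional_between X s T \<omega> = J T s \<omega>"
  using no_fixed_jump[OF s(1) less_imp_le[OF s(2)]]
  by eventually_elim (use s in \<open>simp add: exp_functional_between_eq J_def\<close>)

lemma exp_functional_between_measurable:
  assumes s: "0 < s"
  shows "exp_functional_between X s T \<in> borel_measurable M"
proof -
  have "(\<lambda>\<omega>. exp (left_lim X s \<omega>) * Y T s \<omega>) \<in> borel_measurable M"
    using left_lim_measurable[OF s] by measurable
  also have "(\<lambda>\<omega>. exp (left_lim X s \<omega>) * Y T s \<omega>) = exp_functional_between X s T"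
    using s by (simp add: exp_functional_between_eq fun_eq_iff)
  finally show ?thesis .
qed

lemma moment_between_eq:
  assumes s: "0 < s" "s < T"
  shows "moment_between M X (- q) s T = (\<integral>\<omega>. J T s \<omega> powr (- q) \<partial>M)"
  unfolding moment_between_def
proof (rule integral_cong_AE)
  have [measurable]: "exp_functional_between X s T \<in> borel_measurable M" "J T s \<in> borel_measurable M"
    using exp_functional_between_measurable s by auto
  show "(\<lambda>\<omega>. exp_functional_between X s T \<omega> powr (- q)) \<in> borel_measurable M" by measurable
  show "(\<lambda>\<omega>. J T s \<omega> powr (- q)) \<in> borel_measurable M" by measurable
  show "AE \<omega> in M. exp_functional_between X s T \<omega> powr (- q) = J T s \<omega> powr (- q)"
    using exp_functional_between_AE[OF s] by eventually_elim simp
qed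

lemma moment_between_well_defined:
  assumes s: "0 < s" "s < T" and q: "0 < q" "q \<le> be + 1"
  shows "moment_between_well_defined M X (- q) s T"
  unfolding moment_between_well_defined_def
proof (intro conjI ballI)
  show "set_integrable lborel {s..T} (\<lambda>u. exp (- (X u \<omega> - left_lim X s \<omega>)))" if "\<omega> \<in> space M" for \<omega>
    using s by (intro exp_functional_between_integrable that) auto
  have [measurable]: "exp_functional_between X s T \<in> borel_measurable M" "J T s \<in> borel_measurable M"
    using exp_functional_between_measurable s by auto
  have J: "integrable M (\<lambda>\<omega>. J T s \<omega> powr (- q))" using s q by (intro Y_powr_moment(1)) auto
  have "AE \<omega> in M. J T s \<omega> powr (- q) = exp_functional_between X s T \<omega> powr (- q)"
    using exp_functional_between_AE[OF s] by eventually_elim simp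
  then show "integrable M (\<lambda>\<omega>. exp_functional_between X s T \<omega> powr (- q))"
    by (intro integrable_cong_AE_imp[OF J]) auto
qed

lemma moment_between_derivative:
  assumes s: "0 < s" "s < T" and k': "(k be has_real_derivative k') (at s)"
  shows "((\<lambda>u. moment_between M X (- be) u T) has_real_derivative
     be * moment_between M X (- be - 1) s T - k' * moment_between M X (- be) s T) (at s)"
proof -
  have e: "- be - 1 = - (be + 1)" by simp
  have "((\<lambda>u. moment_between M X (- be) u T) has_real_derivative
     be * (\<integral>\<omega>. J T s \<omega> powr (- be - 1) \<partial>M) - k' * (\<integral>\<omega>. J T s \<omega> powr (- be) \<partial>M)) (at s)"
    by (rule has_field_derivative_transform_within_open[OF J_moment_derivative[OF s k'], of "{0<..<T}"])
      (use s moment_between_eq in auto)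
  then show ?thesis by (simp only: moment_between_eq[OF s] e)
qed

end

subsection \<open>Levy processes\<close>

context pii
begin

text \<open>The exponent is known only on \<open>[0, t]\<close>; stationarity extends it to any
  time, cut into equal steps no longer than \<open>t\<close>.\<close>

lemma nn_integral_exp_levy:
  assumes levy: "levy_process M X" and t: "t > 0"
    and small: "\<And>u. 0 \<le> u \<Longrightarrow> u \<le> t \<Longrightarrow> (\<integral>\<^sup>+\<omega>. ennreal (exp (c * X u \<omega>)) \<partial>M) = ennreal (exp (u * \<eta>))"
    and u: "u \<ge> 0"
  shows "(\<integral>\<^sup>+\<omega>. ennreal (exp (c * X u \<omega>)) \<partial>M) = ennreal (exp (u * \<eta>))"
proof -
  \<comment> \<open>The lower bound 1 keeps \<open>N\<close> positive even for
    \<open>u = 0\<close>.\<close>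
  obtain N :: nat where "max 1 (u / t) \<le> real N" using real_arch_simple by blast
  then have N: "N > 0" "u / t \<le> real N" by simp_all
  define h where "h = u / real N"
  have h: "0 \<le> h" "h \<le> t" using N t u by (auto simp: h_def field_simps)
  have "(\<integral>\<^sup>+\<omega>. ennreal (exp (c * X (real n * h) \<omega>)) \<partial>M) = ennreal (exp (real n * h * \<eta>))" for n
  proof (induction n)
    case 0
    then show ?case using small[of 0] t by simp
  next
    case (Suc n)
    have nh: "0 \<le> real n * h" "real n * h \<le> real (Suc n) * h" using h by (auto intro: mult_right_mono)
    have [measurable]: "X (real n * h) \<in> borel_measurable M" "X (real n * h + h) \<in> borel_measurable M" "X h \<in> borel_measurable M"
      using h nh by auto
    have eq: "distr M borel (\<lambda>\<omega>. X (real n * h + h) \<omega> - X (real n * h) \<omega>) = distr M borel (X h)"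
      using levy h nh by (simp add: levy_process_def)
    have "(\<integral>\<^sup>+\<omega>. ennreal (exp (c * (X (real n * h + h) \<omega> - X (real n * h) \<omega>))) \<partial>M) =
        (\<integral>\<^sup>+x. ennreal (exp (c * x)) \<partial>distr M borel (\<lambda>\<omega>. X (real n * h + h) \<omega> - X (real n * h) \<omega>))"
      by (subst nn_integral_distr) auto
    also have "\<dots> = (\<integral>\<^sup>+\<omega>. ennreal (exp (c * X h \<omega>)) \<partial>M)"
      unfolding eq by (subst nn_integral_distr) auto
    also have "\<dots> = ennreal (exp (h * \<eta>))" by (rule small[OF h])
    finally have inc: "(\<integral>\<^sup>+\<omega>. ennreal (exp (c * (X (real n * h + h) \<omega> - X (real n * h) \<omega>))) \<partial>M) = ennreal (exp (h * \<eta>))" .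
    have S: "real (Suc n) * h = real n * h + h" by (simp add: algebra_simps)
    have "(\<integral>\<^sup>+\<omega>. ennreal (exp (c * X (real (Suc n) * h) \<omega>)) \<partial>M) = ennreal (exp (real n * h * \<eta>)) * ennreal (exp (h * \<eta>))"
      using nn_integral_exp_increment[OF nh, of c] unfolding S inc Suc.IH .
    also have "\<dots> = ennreal (exp (real (Suc n) * h * \<eta>))"
      by (simp add: ennreal_mult[symmetric] mult_exp_exp algebra_simps)
    finally show ?case .
  qed
  from this[of N] show ?thesis using N by (simp add: h_def)
qed

text \<open>Increments over a regular grid are independent and identically distributed, so their
  joint law is a product that does not depend on the starting time.\<close>

lemma distr_inc_levy:
  assumes levy: "levy_process M X" and s: "0 \<le> s"
  shows "distr M (PiM UNIV (\<lambda>_. borel)) (\<lambda>\<omega> j. inc s n j \<omega>) = distr M (PiM UNIV (\<lambda>_. borel)) (\<lambda>\<omega> j. inc 0 n j \<omega>)"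
proof -
  have "distr M (PiM UNIV (\<lambda>_. borel)) (\<lambda>\<omega> j. inc r n j \<omega>) = PiM UNIV (\<lambda>j. distr M borel (X (1 / real (Suc n))))"
    if r: "0 \<le> r" for r
  proof -
    have "indep_vars (\<lambda>_. borel) (\<lambda>j \<omega>. X (r + real (Suc j) / real (Suc n)) \<omega> - X (r + real j / real (Suc n)) \<omega>) UNIV"
      using r by (intro indep_increments[of "\<lambda>j. r + real j / real (Suc n)"])
        (auto simp: incseq_Suc_iff divide_right_mono)
    then have "indep_vars (\<lambda>_. borel) (inc r n) UNIV" by (simp add: inc_def[abs_def])
    then have "distr M (PiM UNIV (\<lambda>_. borel)) (\<lambda>\<omega>. \<lambda>j\<in>UNIV. inc r n j \<omega>) = PiM UNIV (\<lambda>j. distr M borel (inc r n j))"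
      using r by (subst (asm) indep_vars_iff_distr_eq_PiM) auto
    moreover have "distr M borel (inc r n j) = distr M borel (X (1 / real (Suc n)))" for j
    proof -
      have "r + real (Suc j) / real (Suc n) = (r + real j / real (Suc n)) + 1 / real (Suc n)"
        by (simp add: add_divide_distrib)
      moreover have "distr M borel (\<lambda>\<omega>. X ((r + real j / real (Suc n)) + 1 / real (Suc n)) \<omega> - X (r + real j / real (Suc n)) \<omega>)
          = distr M borel (X (1 / real (Suc n)))"
        using levy r unfolding levy_process_def by simp
      ultimately show ?thesis by (simp only: inc_def[abs_def])
    qed
    ultimately show ?thesis by (simp add: restrict_def)
  qed
  from this[OF s] this[of 0] show ?thesis by simp
qed

text \<open>\<open>J T s\<close> and \<open>J (T - s) 0\<close> are limits of the same step
  functionals, applied to sequences of increments with the same law.\<close>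

lemma nn_integral_J_levy:
  assumes levy: "levy_process M X" and s: "0 \<le> s" "s < T" and p: "p > 0"
  shows "(\<integral>\<^sup>+\<omega>. ennreal (J T s \<omega> powr (- p)) \<partial>M) = (\<integral>\<^sup>+\<omega>. ennreal (J (T - s) 0 \<omega> powr (- p)) \<partial>M)"
proof -
  note tr = trunc_props[OF p]
  define B where "B = (\<lambda>N. (1 / real (Suc N)) powr (- p))"
  have hB: "\<bar>trunc p N y\<bar> \<le> B N" for N y using tr(2,3) by (simp add: B_def)
  have "(\<integral>\<omega>. trunc p N (J T s \<omega>) \<partial>M) = (\<integral>\<omega>. trunc p N (J (T - s) 0 \<omega>) \<partial>M)" for N
  proof (rule LIMSEQ_unique)
    have [measurable]: "trunc p N \<in> borel_measurable borel" by (rule borel_measurable_continuous_onI[OF tr(1)])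
    show "(\<lambda>n. \<integral>\<omega>. trunc p N (step_functional (T - s) n (\<lambda>j. inc s n j \<omega>)) \<partial>M) \<longlonglongrightarrow> (\<integral>\<omega>. trunc p N (J T s \<omega>) \<partial>M)"
      using s by (intro integral_step_functional_tendsto[where B="B N"] tr(1) hB) auto
    have "(\<integral>\<omega>. trunc p N (step_functional (T - s) n (\<lambda>j. inc s n j \<omega>)) \<partial>M) =
        (\<integral>\<omega>. trunc p N (step_functional (T - s) n (\<lambda>j. inc 0 n j \<omega>)) \<partial>M)" for n
    proof -
      have m: "(\<lambda>\<omega> j. inc r n j \<omega>) \<in> M \<rightarrow>\<^sub>M PiM UNIV (\<lambda>_. borel)" if "0 \<le> r" for r
        using that by (intro measurable_PiM_single') auto
      have "(\<integral>\<omega>. trunc p N (step_functional (T - s) n (\<lambda>j. inc r n j \<omega>)) \<partial>M) =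
          (\<integral>d. trunc p N (step_functional (T - s) n d) \<partial>distr M (PiM UNIV (\<lambda>_. borel)) (\<lambda>\<omega> j. inc r n j \<omega>))"
        if "0 \<le> r" for r
        by (rule integral_distr[OF m[OF that], symmetric]) measurable
      from this[OF s(1)] this[of 0] show ?thesis unfolding distr_inc_levy[OF levy s(1)] by simp
    qed
    then show "(\<lambda>n. \<integral>\<omega>. trunc p N (step_functional (T - s) n (\<lambda>j. inc s n j \<omega>)) \<partial>M) \<longlonglongrightarrow> (\<integral>\<omega>. trunc p N (J (T - s) 0 \<omega>) \<partial>M)"
      using s integral_step_functional_tendsto[of 0 "T - s" "trunc p N" "B N"] tr(1) hB by simp
  qed
  then have eq: "(\<integral>\<^sup>+\<omega>. ennreal (trunc p N (J T s \<omega>)) \<partial>M) = (\<integral>\<^sup>+\<omega>. ennreal (trunc p N (J (T - s) 0 \<omega>)) \<partial>M)" for N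
  proof -
    have [measurable]: "trunc p N \<in> borel_measurable borel" by (rule borel_measurable_continuous_onI[OF tr(1)])
    have "integrable M (\<lambda>\<omega>. trunc p N (J T' s' \<omega>))" if "0 \<le> s'" for T' s'
    proof -
      have [measurable]: "J T' s' \<in> borel_measurable M" using that by measurable
      show ?thesis by (rule integrable_const_bound[of _ "B N"]) (use hB in auto)
    qed
    then have "(\<integral>\<^sup>+\<omega>. ennreal (trunc p N (J T' s' \<omega>)) \<partial>M) = ennreal (\<integral>\<omega>. trunc p N (J T' s' \<omega>) \<partial>M)" if "0 \<le> s'" for T' s'
      using that tr(2) by (intro nn_integral_eq_integral) auto
    from this[OF s(1)] this[of 0] show ?thesis
      using \<open>\<And>N. (\<integral>\<omega>. trunc p N (J T s \<omega>) \<partial>M) = (\<integral>\<omega>. trunc p N (J (T - s) 0 \<omega>) \<partial>M)\<close> by simp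
  qed
  have "(\<lambda>N. \<integral>\<^sup>+\<omega>. ennreal (trunc p N (J T s \<omega>)) \<partial>M) \<longlonglongrightarrow> (\<integral>\<^sup>+\<omega>. ennreal (J T s \<omega> powr (- p)) \<partial>M)"
    using nn_integral_trunc_J_tendsto[OF s p, of 0] by simp
  moreover have "(\<lambda>N. \<integral>\<^sup>+\<omega>. ennreal (trunc p N (J (T - s) 0 \<omega>)) \<partial>M) \<longlonglongrightarrow>
      (\<integral>\<^sup>+\<omega>. ennreal (J (T - s) 0 \<omega> powr (- p)) \<partial>M)"
    using nn_integral_trunc_J_tendsto[OF order_refl, of "T - s" p 0] s p by simp
  ultimately show ?thesis unfolding eq by (rule LIMSEQ_unique)
qed

lemma integral_J_levy:
  assumes "levy_process M X" "0 \<le> s" "s < T" "p > 0"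
  shows "(\<integral>\<omega>. J T s \<omega> powr (- p) \<partial>M) = (\<integral>\<omega>. J (T - s) 0 \<omega> powr (- p) \<partial>M)"
proof -
  have "(\<integral>\<omega>. J T' s' \<omega> powr (- p) \<partial>M) = enn2real (\<integral>\<^sup>+\<omega>. ennreal (J T' s' \<omega> powr (- p)) \<partial>M)" if "0 \<le> s'" for T' s'
  proof (rule integral_eq_nn_integral)
    have [measurable]: "J T' s' \<in> borel_measurable M" using that by measurable
    show "(\<lambda>\<omega>. J T' s' \<omega> powr (- p)) \<in> borel_measurable M" by measurable
  qed simp
  from this[OF assms(2), of T] this[of 0 "T - s"] show ?thesis using nn_integral_J_levy[OF assms] by simp
qed

lemma exp_functional_eq:
  assumes "\<omega> \<in> space M"
  shows "exp_functional X u \<omega> = J u 0 \<omega>"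
  unfolding J_eq[OF order_refl] exp_functional_def using X_0[OF assms] by simp

lemma moment_eq: "moment M X a u = (\<integral>\<omega>. J u 0 \<omega> powr a \<partial>M)"
  unfolding moment_def by (intro Bochner_Integration.integral_cong) (simp_all add: exp_functional_eq)

end

context exp_pii
begin

lemma moment_well_defined:
  assumes q: "0 < q" "q \<le> be + 1"
  shows "moment_well_defined M X (- q) T"
  unfolding moment_well_defined_def
proof (intro conjI ballI)
  show "set_integrable lborel {0..T} (\<lambda>u. exp (- X u \<omega>))" if "\<omega> \<in> space M" for \<omega>
  proof -
    have "set_integrable lborel {0..T} (\<lambda>u. V u \<omega>)" by (rule V_set_integrable[OF that order_refl])
    also have "?this \<longleftrightarrow> ?thesis" by (intro set_integrable_cong) (auto simp: V_def)
    finally show ?thesis .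
  qed
  have "integrable M (\<lambda>\<omega>. J T 0 \<omega> powr (- q))" by (rule Y_powr_moment(1)[OF order_refl T_pos q])
  then show "integrable M (\<lambda>\<omega>. exp_functional X T \<omega> powr (- q))"
    by (rule Bochner_Integration.integrable_cong[THEN iffD1, OF refl, rotated]) (simp add: exp_functional_eq)
qed

text \<open>By stationarity \<open>J T u\<close> has the moments of the functional of length
  \<open>T - u\<close>; differentiating in the length instead of the starting time reverses the
  sign.\<close>

lemma moment_derivative_levy:
  assumes levy: "levy_process M X" and s: "0 < s" "s < T" and k': "(k be has_real_derivative k') (at s)"
  shows "(moment M X (- be) has_real_derivative
     k' * moment M X (- be) (T - s) - be * moment M X (- be - 1) (T - s)) (at (T - s))"
proof -
  have q: "0 < be" "0 < be + 1" using be_pos by auto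
  have e: "- be - 1 = - (be + 1)" by simp
  have eq: "(\<integral>\<omega>. J T u \<omega> powr (- p) \<partial>M) = moment M X (- p) (T - u)" if "0 \<le> u" "u < T" "p > 0" for u p
    unfolding moment_eq by (rule integral_J_levy[OF levy that])
  have s': "0 \<le> s" using s by simp
  define D where "D = be * moment M X (- be - 1) (T - s) - k' * moment M X (- be) (T - s)"
  have "((\<lambda>u. \<integral>\<omega>. J T u \<omega> powr (- be) \<partial>M) has_real_derivative D) (at s)"
    using J_moment_derivative[OF s k'] unfolding D_def e eq[OF s' s(2) q(1)] eq[OF s' s(2) q(2)] .
  then have "((\<lambda>u. \<integral>\<omega>. J T u \<omega> powr (- be) \<partial>M) has_real_derivative D) (at (T - (T - s)))" by simp
  then have "((\<lambda>v. \<integral>\<omega>. J T (T - v) \<omega> powr (- be) \<partial>M) has_real_derivative D * (- 1)) (at (T - s))"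
    by (rule DERIV_chain2) (auto intro!: derivative_eq_intros)
  then have "(moment M X (- be) has_real_derivative D * (- 1)) (at (T - s))"
    by (rule has_field_derivative_transform_within_open[where S="{0<..<T}"]) (use s q eq in auto)
  then show ?thesis by (simp add: D_def)
qed

end

subsection \<open>The differential equations\<close>

lemma (in exp_jump_kernel) laplace_exponent_minus:
  "laplace_exponent (- a) b c (K s) = - (a * b + a\<^sup>2 * c / 2 + cumulant a s)"
  by (simp add: laplace_exponent_def cumulant_def)

locale density_triplet = pii +
  fixes B C b c :: "real \<Rightarrow> real" and K :: "real \<Rightarrow> real measure" and \<alpha> t :: real
  assumes neg: "\<alpha> < 0" and t: "t > 0" and jump_kernel: "jump_kernel K"
    and triplet: "has_triplet_upto M X t B C K"
    and Bb: "has_density_upto t B b" and Cc: "has_density_upto t C c"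
    and small_jumps: "(\<integral>\<^sup>+s\<in>{0..t}. (\<integral>\<^sup>+x. ennreal (min (x\<^sup>2) \<bar>x\<bar>) \<partial>K s) \<partial>lborel) < \<infinity>"
    and big_jumps: "(\<integral>\<^sup>+s\<in>{0..t}. (\<integral>\<^sup>+x\<in>{1<..}. ennreal (exp ((\<bar>\<alpha>\<bar> + 1) * x)) \<partial>K s) \<partial>lborel) < \<infinity>"
begin

text \<open>Since \<open>\<alpha> < 0\<close>, the order \<open>\<bar>\<alpha>\<bar> + 1\<close> in
  the hypothesis on big jumps is \<open>- \<alpha> + 1\<close>, which is
  \<open>be + 1\<close>.\<close>

sublocale jumps: exp_jump_kernel K t "- \<alpha> + 1"
  using neg jump_kernel small_jumps big_jumps by unfold_locales auto

text \<open>\<open>H\<close> with parameter \<open>- a\<close> belongs to the transform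
  \<open>exp (a * X)\<close> and enters its exponent with a minus sign.\<close>

definition k :: "real \<Rightarrow> real \<Rightarrow> real" where
  "k a u = integral {0..u} (\<lambda>s. - H (- a) b c K s)"

lemma minus_H_eq: "- H (- a) b c K s = a * b s + a\<^sup>2 / 2 * c s + jumps.cumulant a s"
  by (simp add: H_def jumps.laplace_exponent_minus)

lemma set_integrable_minus_H:
  assumes "0 \<le> a" "a \<le> - \<alpha> + 1"
  shows "set_integrable lborel {0..t} (\<lambda>s. - H (- a) b c K s)"
  unfolding minus_H_eq using Bb Cc assms
  by (intro set_integral_add(1) set_integrable_mult_right jumps.set_integrable_cumulant)
    (auto simp: has_density_upto_def)

lemma minus_H_integrable_on:
  assumes "0 \<le> a" "a \<le> - \<alpha> + 1"
  shows "(\<lambda>s. - H (- a) b c K s) integrable_on {0..t}"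
  by (rule set_borel_integral_eq_integral(1)[OF set_integrable_minus_H[OF assms]])

lemma exp_moment:
  assumes a: "0 \<le> a" "a \<le> - \<alpha> + 1" and u: "0 \<le> u" "u \<le> t"
  shows "integrable M (\<lambda>\<omega>. exp (a * X u \<omega>))" "(\<integral>\<omega>. exp (a * X u \<omega>) \<partial>M) = exp (k a u)"
proof -
  have sub: "set_integrable lborel {0..u} f" if "set_integrable lborel {0..t} f" for f :: "real \<Rightarrow> real"
    using that by (rule set_integrable_subset) (use u in auto)
  have i: "set_integrable lborel {0..u} b" "set_integrable lborel {0..u} c" "set_integrable lborel {0..u} (jumps.cumulant a)"
    using Bb Cc a by (auto intro!: sub jumps.set_integrable_cumulant simp: has_density_upto_def)
  have "k a u = (LBINT s:{0..u}. - H (- a) b c K s)"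
    unfolding k_def by (rule set_borel_integral_eq_integral(2)[OF sub[OF set_integrable_minus_H[OF a]], symmetric])
  also have "\<dots> = (LBINT s:{0..u}. (a * b s + a\<^sup>2 / 2 * c s) + jumps.cumulant a s)"
    by (simp only: minus_H_eq)
  also have "\<dots> = (LBINT s:{0..u}. a * b s + a\<^sup>2 / 2 * c s) + (LBINT s:{0..u}. jumps.cumulant a s)"
    using i by (intro set_integral_add(2) set_integral_add(1) set_integrable_mult_right) auto
  also have "(LBINT s:{0..u}. a * b s + a\<^sup>2 / 2 * c s) = (LBINT s:{0..u}. a * b s) + (LBINT s:{0..u}. a\<^sup>2 / 2 * c s)"
    using i by (intro set_integral_add(2) set_integrable_mult_right) auto
  also have "\<dots> + (LBINT s:{0..u}. jumps.cumulant a s) = a * (LBINT s:{0..u}. b s) + a\<^sup>2 / 2 * (LBINT s:{0..u}. c s) + (LBINT s:{0..u}. jumps.cumulant a s)"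
    by simp
  also have "\<dots> = a * B u + a\<^sup>2 * C u / 2 + (LBINT s:{0..u}. jumps.cumulant a s)"
    using Bb Cc u by (simp add: has_density_upto_def)
  finally have k: "k a u = a * B u + a\<^sup>2 * C u / 2 + (LBINT s:{0..u}. jumps.cumulant a s)" .
  have char: "(CLINT \<omega>|M. iexp (z * X u \<omega>)) = exp (\<i> * z * B u - z\<^sup>2 * C u / 2 +
      (CLINT s:{0..u}|lborel. (CLINT x|K s. iexp (z * x) - 1 - \<i> * z * x)))" for z :: real
    using triplet u by (simp add: has_triplet_upto_def)
  note em = jumps.exponential_moment[OF prob_space_axioms rv[OF u(1)] u(2) char a]
  show "integrable M (\<lambda>\<omega>. exp (a * X u \<omega>))" by (rule em(1))
  show "(\<integral>\<omega>. exp (a * X u \<omega>) \<partial>M) = exp (k a u)" unfolding k by (rule em(2))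
qed

sublocale exp_pii M X t "- \<alpha>" k
proof unfold_locales
  fix a assume a: "0 \<le> a" "a \<le> - \<alpha> + 1"
  show "continuous_on {0..t} (k a)"
    unfolding k_def by (rule indefinite_integral_continuous_1[OF minus_H_integrable_on[OF a]])
qed (use neg t exp_moment in auto)

lemma moment_between_ode:
  assumes s: "0 < s" "s < t" and k': "(k (- \<alpha>) has_real_derivative - H \<alpha> b c K s) (at s)"
  shows "moment_between_ode_at M X b c K \<alpha> s t"
proof -
  let ?D = "- \<alpha> * moment_between M X (\<alpha> - 1) s t - - H \<alpha> b c K s * moment_between M X \<alpha> s t"
  have d: "((\<lambda>r. moment_between M X \<alpha> r t) has_real_derivative ?D) (at s)"
    using moment_between_derivative[OF s k'] unfolding minus_minus .
  show ?thesis
    unfolding moment_between_ode_at_def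
  proof
    show "(\<lambda>r. moment_between M X \<alpha> r t) differentiable (at s)"
      unfolding real_differentiable_def by (rule exI, rule d)
    show "moment_between M X (\<alpha> - 1) s t = 1 / \<alpha> * (moment_between M X \<alpha> s t * H \<alpha> b c K s -
        deriv (\<lambda>r. moment_between M X \<alpha> r t) s)"
    proof -
      have eq: "moment_between M X \<alpha> s t * H \<alpha> b c K s - ?D = \<alpha> * moment_between M X (\<alpha> - 1) s t"
        by algebra
      have "1 / \<alpha> * (\<alpha> * moment_between M X (\<alpha> - 1) s t) = moment_between M X (\<alpha> - 1) s t"
        using neg by simp
      then show ?thesis unfolding DERIV_imp_deriv[OF d] eq by (rule sym)
    qed
  qed
qed

lemma AE_k_derivative:
  "AE s in lborel. s \<in> {0<..<t} \<longrightarrow> (k (- \<alpha>) has_real_derivative - H \<alpha> b c K s) (at s)"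
proof -
  have "(\<lambda>s. - H (- (- \<alpha>)) b c K s) integrable_on {0..t}" using neg by (intro minus_H_integrable_on) auto
  \<comment> \<open>The differentiation theorem speaks of Lebesgue null sets; almost everywhere has
    the same meaning for a measure and its completion.\<close>
  from AE_has_real_derivative_integral[OF this]
  have "AE s in lborel. s \<in> {0<..<t} \<longrightarrow> (k (- \<alpha>) has_real_derivative - H (- (- \<alpha>)) b c K s) (at s)"
    unfolding AE_completion_iff k_def[abs_def] .
  then show ?thesis by simp
qed

text \<open>At a continuity point the fundamental theorem of calculus settles that very time,
  whereas Lebesgue's theorem leaves the exceptional times unspecified.\<close>

lemma k_derivative:
  assumes s: "0 < s" "s < t" and cont: "isCont (H \<alpha> b c K) s"
  shows "(k (- \<alpha>) has_real_derivative - H \<alpha> b c K s) (at s)"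
proof -
  have "(\<lambda>s. - H (- (- \<alpha>)) b c K s) integrable_on {0..t}" using neg by (intro minus_H_integrable_on) auto
  then have i: "(\<lambda>s. - H \<alpha> b c K s) integrable_on {0..t}" by simp
  have "continuous (at s within {0..t}) (\<lambda>s. - H \<alpha> b c K s)"
    by (rule continuous_minus[OF continuous_at_imp_continuous_at_within[OF cont]])
  then have "((\<lambda>u. integral {0..u} (\<lambda>s. - H \<alpha> b c K s)) has_vector_derivative - H \<alpha> b c K s) (at s within {0..t})"
    using integral_has_vector_derivative_continuous_at[OF i, of s "{}"] s by simp
  then have "((\<lambda>u. integral {0..u} (\<lambda>s. - H \<alpha> b c K s)) has_real_derivative - H \<alpha> b c K s) (at s)"
    unfolding has_real_derivative_iff_has_vector_derivative at_within_Icc_at[OF s] .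
  then show ?thesis by (simp add: k_def[abs_def])
qed

text \<open>Constant characteristics make the exponents linear in time. Stationarity then provides
  the exponential moments at all times, so the horizon can be chosen freely.\<close>

lemma levy_moments:
  assumes levy: "levy_process M X" and const: "\<And>s. s \<ge> 0 \<Longrightarrow> b s = b\<^sub>0 \<and> c s = c\<^sub>0 \<and> K s = K\<^sub>0" and s: "s > 0"
  shows "moment_well_defined M X \<alpha> s \<and> moment_well_defined M X (\<alpha> - 1) s \<and> moment_ode_at M X b\<^sub>0 c\<^sub>0 K\<^sub>0 \<alpha> s"
proof -
  define \<eta> where "\<eta> = (\<lambda>a. - laplace_exponent (- a) b\<^sub>0 c\<^sub>0 K\<^sub>0)"
  have keq: "k a u = u * \<eta> a" if "u \<ge> 0" for a u
  proof -
    have "k a u = integral {0..u} (\<lambda>s. \<eta> a)"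
      unfolding k_def by (intro integral_cong) (use const in \<open>simp add: H_def \<eta>_def\<close>)
    then show ?thesis using that by simp
  qed
  have all: "integrable M (\<lambda>\<omega>. exp (a * X u \<omega>)) \<and> (\<integral>\<omega>. exp (a * X u \<omega>) \<partial>M) = exp (u * \<eta> a)"
    if a: "0 \<le> a" "a \<le> - \<alpha> + 1" and u: "0 \<le> u" for a u
  proof -
    have "(\<integral>\<^sup>+\<omega>. ennreal (exp (a * X v \<omega>)) \<partial>M) = ennreal (exp (v * \<eta> a))" if "0 \<le> v" "v \<le> t" for v
      using exp_moment[OF a that] by (simp add: nn_integral_eq_integral keq[OF that(1)])
    from nn_integral_exp_levy[OF levy t this u]
    have nn: "(\<integral>\<^sup>+\<omega>. ennreal (exp (a * X u \<omega>)) \<partial>M) = ennreal (exp (u * \<eta> a))" by simp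
    have [measurable]: "X u \<in> borel_measurable M" by (rule rv[OF u])
    have "has_bochner_integral M (\<lambda>\<omega>. exp (a * X u \<omega>)) (exp (u * \<eta> a))"
      by (rule has_bochner_integral_nn_integral[OF _ _ _ nn]) auto
    then show ?thesis by (simp add: has_bochner_integral_iff)
  qed
  have E: "exp_pii M X T (- \<alpha>) (\<lambda>a u. u * \<eta> a)" if "T > 0" for T
  proof
    show "T > 0" "- \<alpha> > 0" using that neg by simp_all
    fix a :: real assume a: "0 \<le> a" "a \<le> - \<alpha> + 1"
    show "continuous_on {0..T} (\<lambda>u. u * \<eta> a)" by (intro continuous_intros)
    show "integrable M (\<lambda>\<omega>. exp (a * X u \<omega>)) \<and> (\<integral>\<omega>. exp (a * X u \<omega>) \<partial>M) = exp (u * \<eta> a)"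
      if "0 \<le> u" "u \<le> T" for u
      by (rule all[OF a that(1)])
  qed
  \<comment> \<open>Two horizons: \<open>s\<close> for finiteness of the moments at
    \<open>s\<close>, and \<open>2 * s\<close> for the derivative, because
    \<open>moment_derivative_levy\<close> speaks of the length \<open>T - s\<close>, which equals
    \<open>s\<close> for \<open>T = 2 * s\<close>.\<close>
  interpret S: exp_pii M X s "- \<alpha>" "\<lambda>a u. u * \<eta> a" by (rule E[OF s])
  interpret S2: exp_pii M X "2 * s" "- \<alpha>" "\<lambda>a u. u * \<eta> a" by (rule E) (use s in simp)
  have wd: "moment_well_defined M X \<alpha> s"
    using S.moment_well_defined[of "- \<alpha>"] neg by simp
  have wd1: "moment_well_defined M X (\<alpha> - 1) s"
    using S.moment_well_defined[of "- \<alpha> + 1"] neg by simp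
  have "((\<lambda>u. u * \<eta> (- \<alpha>)) has_real_derivative \<eta> (- \<alpha>)) (at s)"
    by (auto intro!: derivative_eq_intros)
  from S2.moment_derivative_levy[OF levy s _ this]
  have d: "(moment M X \<alpha> has_real_derivative \<eta> (- \<alpha>) * moment M X \<alpha> s + \<alpha> * moment M X (\<alpha> - 1) s) (at s)"
    using s by simp
  have "moment_ode_at M X b\<^sub>0 c\<^sub>0 K\<^sub>0 \<alpha> s"
    unfolding moment_ode_at_def
  proof
    show "(\<lambda>r. moment M X \<alpha> r) differentiable (at s)"
      using d real_differentiable_def by blast
    show "moment M X (\<alpha> - 1) s = 1 / \<alpha> * (moment M X \<alpha> s * laplace_exponent \<alpha> b\<^sub>0 c\<^sub>0 K\<^sub>0 + deriv (moment M X \<alpha>) s)"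
    proof -
      have eta: "\<eta> (- \<alpha>) = - laplace_exponent \<alpha> b\<^sub>0 c\<^sub>0 K\<^sub>0" by (simp add: \<eta>_def)
      show ?thesis unfolding DERIV_imp_deriv[OF d] eta using neg by simp
    qed
  qed
  with wd wd1 show ?thesis by blast
qed

end

theorem theorem2:
  fixes M :: "'a measure" and X :: "real \<Rightarrow> 'a \<Rightarrow> real"
    and B C b c :: "real \<Rightarrow> real" and K :: "real \<Rightarrow> real measure"
    and \<alpha> t :: real
  assumes "\<alpha> < 0" and "t > 0"
    and "independent_increments_process M X"
    and "semimartingale M (natural_filtration M X) X"
    and "set_borel_measurable borel {0..} b"
    and "set_borel_measurable borel {0..} c"
    and "jump_kernel K"
    and "has_triplet_upto M X t B C K"
    and "has_density_upto t B b"
    and "has_density_upto t C c"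
    and "(\<integral>\<^sup>+s\<in>{0..t}. (\<integral>\<^sup>+x. ennreal (min (x\<^sup>2) \<bar>x\<bar>) \<partial>K s) \<partial>lborel) < \<infinity>"
    and "(\<integral>\<^sup>+s\<in>{0..t}. (\<integral>\<^sup>+x\<in>{1<..}. ennreal (exp ((\<bar>\<alpha>\<bar> + 1) * x)) \<partial>K s) \<partial>lborel) < \<infinity>"
  shows "(\<forall>s\<in>{0<..<t}. moment_between_well_defined M X \<alpha> s t \<and>
                        moment_between_well_defined M X (\<alpha> - 1) s t) \<and>
         (AE s in lborel. s \<in> {0<..<t} \<longrightarrow> moment_between_ode_at M X b c K \<alpha> s t) \<and>
         (\<forall>s\<in>{0<..<t}. isCont (H \<alpha> b c K) s \<longrightarrow> moment_between_ode_at M X b c K \<alpha> s t) \<and>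
         (\<forall>b\<^sub>0 c\<^sub>0 K\<^sub>0. levy_process M X \<and> (\<forall>s\<ge>0. b s = b\<^sub>0 \<and> c s = c\<^sub>0 \<and> K s = K\<^sub>0) \<longrightarrow>
            (\<forall>s>0. moment_well_defined M X \<alpha> s \<and> moment_well_defined M X (\<alpha> - 1) s \<and>
                   moment_ode_at M X b\<^sub>0 c\<^sub>0 K\<^sub>0 \<alpha> s))"
proof -
  interpret density_triplet M X B C b c K \<alpha> t
    using assms by unfold_locales auto
  show ?thesis
  proof (intro conjI)
    show "\<forall>s\<in>{0<..<t}. moment_between_well_defined M X \<alpha> s t \<and> moment_between_well_defined M X (\<alpha> - 1) s t"
    proof
      fix s assume "s \<in> {0<..<t}"
      then show "moment_between_well_defined M X \<alpha> s t \<and> moment_between_well_defined M X (\<alpha> - 1) s t"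
        using moment_between_well_defined[of s "- \<alpha>"] moment_between_well_defined[of s "- \<alpha> + 1"] neg by simp
    qed
    show "AE s in lborel. s \<in> {0<..<t} \<longrightarrow> moment_between_ode_at M X b c K \<alpha> s t"
      using AE_k_derivative by eventually_elim (simp add: moment_between_ode)
    show "\<forall>s\<in>{0<..<t}. isCont (H \<alpha> b c K) s \<longrightarrow> moment_between_ode_at M X b c K \<alpha> s t"
      using moment_between_ode k_derivative by simp
    show "\<forall>b\<^sub>0 c\<^sub>0 K\<^sub>0. levy_process M X \<and> (\<forall>s\<ge>0. b s = b\<^sub>0 \<and> c s = c\<^sub>0 \<and> K s = K\<^sub>0) \<longrightarrow>
            (\<forall>s>0. moment_well_defined M X \<alpha> s \<and> moment_well_defined M X (\<alpha> - 1) s \<and>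
                   moment_ode_at M X b\<^sub>0 c\<^sub>0 K\<^sub>0 \<alpha> s)"
      by (intro allI impI levy_moments) auto
  qed
qed

end
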